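(* If the Lie algebra $\mathcal N_{r,s}$ is isomorphic to the Lie algebra $\mathcal N_{s,r}$, then for any $k=1,2,\dots$: 1. the Lie algebras $\mathcal N_{r,s+8k}$ and $\mathcal N_{s+8k,r}$ are isomorphic; 2. the Lie algebras $\mathcal N_{r+8k,s}$ and $\mathcal N_{s,r+8k}$ are isomorphic; 3. the Lie algebras $\mathcal N_{r+4k,s+4k}$ and $\mathcal N_{s+4k,r+4k}$ are isomorphic.
   Context: Here $(r,s)$ is a pair of distinct non-negative integers (the paper considers the pairs $\mathcal N_{r,s}$, $\mathcal N_{s,r}$ with $r\neq s$). $\mathbb R^{r,s}$ denotes $\mathbb R^{r+s}$ with the symmetric bilinear form $\langle x,y\rangle_{r,s}=\sum_{i=1}^r x_iy_i-\sum_{j=1}^s x_{r+j}y_{r+j}$, and $\mathrm{Cl}_{r,s}$ is the Clifford algebra it generates with the convention $x\otimes x=-\langle x,x\rangle_{r,s}$. A $\mathrm{Cl}_{r,s}$-module is a finite-dimensional real vector space $U$ with a linear map $J\colon\mathbb R^{r,s}\to\mathrm{End}(U)$ such that $J_z^2=-\langle z,z\rangle_{r,s}\mathrm{Id}_U$. It is admissible if equipped with a non-degenerate symmetric bilinear form $\langle\cdot,\cdot\rangle_U$ with $\langle J_zx,y\rangle_U+\langle x,J_zy\rangle_U=0$ for all $z,x,y$; minimal admissible (denoted $V^{r,s}$) means (nonzero) admissible of the smallest possible dimension. $\mathcal N_{r,s}(U)=U\oplus\mathbb R^{r,s}$ is the 2-step nilpotent Lie algebra with centre $\mathbb R^{r,s}$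 and bracket $[U,U]\subset\mathbb R^{r,s}$ given by $\langle J_zx,y\rangle_U=\langle z,[x,y]\rangle_{r,s}$. One writes $\mathcal N_{r,s}=\mathcal N_{r,s}(V^{r,s})$; up to isomorphism this does not depend on the choice of the minimal admissible module. *)

theory Defs
  imports "HOL-Analysis.Finite_Function_Topology"
begin

text \<open>
  Vector spaces are linear subspaces of an arbitrary type of class \<^class>\<open>real_vector\<close>, and maps
  on them matter only on the subspace: linearity is required on the carrier only.
\<close>

definition lin_on :: "'a::real_vector set \<Rightarrow> ('a \<Rightarrow> 'b::real_vector) \<Rightarrow> bool" where
  "lin_on A f \<longleftrightarrow>
     (\<forall>x\<in>A. \<forall>y\<in>A. f (x + y) = f x + f y) \<and>
     (\<forall>c. \<forall>x\<in>A. f (c *\<^sub>R x) = c *\<^sub>R f x)"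

text \<open>
  The space \<open>\<real>\<^sup>r\<^sup>,\<^sup>s\<close> consists of the finitely supported sequences that vanish from index \<open>r + s\<close> on;
  coordinates are numbered from \<open>0\<close>.
\<close>

definition Rrs :: "nat \<Rightarrow> nat \<Rightarrow> (nat \<Rightarrow>\<^sub>0 real) set" where
  "Rrs r s = {z. Poly_Mapping.keys z \<subseteq> {..<r + s}}"

definition form_rs :: "nat \<Rightarrow> nat \<Rightarrow> (nat \<Rightarrow>\<^sub>0 real) \<Rightarrow> (nat \<Rightarrow>\<^sub>0 real) \<Rightarrow> real" where
  "form_rs r s x y =
     (\<Sum>i<r. Poly_Mapping.lookup x i * Poly_Mapping.lookup y i) -
     (\<Sum>j<s. Poly_Mapping.lookup x (r + j) * Poly_Mapping.lookup y (r + j))"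

record 'u clifford_module =
  module_space :: "'u set"
  act :: "(nat \<Rightarrow>\<^sub>0 real) \<Rightarrow> 'u \<Rightarrow> 'u"
  module_form :: "'u \<Rightarrow> 'u \<Rightarrow> real"

definition is_clifford_module :: "nat \<Rightarrow> nat \<Rightarrow> 'u::real_vector clifford_module \<Rightarrow> bool" where
  "is_clifford_module r s M \<longleftrightarrow>
     (\<exists>B. finite B \<and> module_space M = span B) \<and>
     (\<forall>z\<in>Rrs r s. \<forall>x\<in>module_space M. act M z x \<in> module_space M) \<and>
     (\<forall>z\<in>Rrs r s. lin_on (module_space M) (act M z)) \<and>
     (\<forall>x\<in>module_space M. lin_on (Rrs r s) (\<lambda>z. act M z x)) \<and>
     (\<forall>z\<in>Rrs r s. \<forall>x\<in>module_space M. act M z (act M z x) = - form_rs r s z z *\<^sub>R x)"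

definition nondegenerate_symmetric_form :: "'u::real_vector set \<Rightarrow> ('u \<Rightarrow> 'u \<Rightarrow> real) \<Rightarrow> bool" where
  "nondegenerate_symmetric_form U b \<longleftrightarrow>
     (\<forall>x\<in>U. \<forall>y\<in>U. b x y = b y x) \<and>
     (\<forall>x\<in>U. lin_on U (b x)) \<and>
     (\<forall>x\<in>U. (\<forall>y\<in>U. b x y = 0) \<longrightarrow> x = 0)"

definition admissible :: "nat \<Rightarrow> nat \<Rightarrow> 'u::real_vector clifford_module \<Rightarrow> bool" where
  "admissible r s M \<longleftrightarrow>
     is_clifford_module r s M \<and>
     nondegenerate_symmetric_form (module_space M) (module_form M) \<and>
     (\<forall>z\<in>Rrs r s. \<forall>x\<in>module_space M. \<forall>y\<in>module_space M.
        module_form M (act M z x) y + module_form M x (act M z y) = 0)"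

text \<open>
  Every finite-dimensional real vector space is isomorphic to a subspace of
  \<^typ>\<open>nat \<Rightarrow>\<^sub>0 real\<close>, so comparing with the modules carried by this type amounts to
  comparing with all modules. (Competitors taken from \<^typ>\<open>'u\<close> would not do: that type may be
  too small.)
\<close>

definition minimal_admissible :: "nat \<Rightarrow> nat \<Rightarrow> 'u::real_vector clifford_module \<Rightarrow> bool" where
  "minimal_admissible r s M \<longleftrightarrow>
     admissible r s M \<and> module_space M \<noteq> {0} \<and>
     (\<forall>M' :: (nat \<Rightarrow>\<^sub>0 real) clifford_module.
        admissible r s M' \<and> module_space M' \<noteq> {0} \<longrightarrow>
        dim (module_space M) \<le> dim (module_space M'))"

record 'g lie_algebra =
  lie_space :: "'g set"
  lie_bracket :: "'g \<Rightarrow> 'g \<Rightarrow> 'g"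

definition lie_isomorphic ::
  "'g::real_vector lie_algebra \<Rightarrow> 'h::real_vector lie_algebra \<Rightarrow> bool" where
  "lie_isomorphic G H \<longleftrightarrow>
     (\<exists>f. lin_on (lie_space G) f \<and> bij_betw f (lie_space G) (lie_space H) \<and>
        (\<forall>x\<in>lie_space G. \<forall>y\<in>lie_space G.
           f (lie_bracket G x y) = lie_bracket H (f x) (f y)))"

definition module_bracket ::
  "nat \<Rightarrow> nat \<Rightarrow> 'u::real_vector clifford_module \<Rightarrow> 'u \<Rightarrow> 'u \<Rightarrow> (nat \<Rightarrow>\<^sub>0 real)" where
  "module_bracket r s M x y =
     (THE v. v \<in> Rrs r s \<and>
        (\<forall>z\<in>Rrs r s. module_form M (act M z x) y = form_rs r s z v))"

text \<open>The definite description in \<^const>\<open>module_bracket\<close> is well defined.\<close>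

lemma lookup_scaleR_pm: "Poly_Mapping.lookup (c *\<^sub>R (z :: nat \<Rightarrow>\<^sub>0 real)) i = c * Poly_Mapping.lookup z i"
proof -
  have "finite {i. c * Poly_Mapping.lookup z i \<noteq> 0}"
    by (rule finite_subset[OF _ finite_lookup[of z]]) auto
  then show ?thesis
    by (simp add: scaleR_poly_mapping_def)
qed

lemma Rrs_functional_sum:
  assumes lin: "lin_on (Rrs r s) (f :: _ \<Rightarrow> real)" and z: "z \<in> Rrs r s"
  shows "f z = (\<Sum>i<r + s. Poly_Mapping.lookup z i * f (Poly_Mapping.single i 1))"
proof -
  define e where "e i = (Poly_Mapping.single i 1 :: nat \<Rightarrow>\<^sub>0 real)" for i :: nat
  define p where "p n = (\<Sum>i<n. Poly_Mapping.lookup z i *\<^sub>R e i)" for n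
  have look: "Poly_Mapping.lookup (p n) j = (if j < n then Poly_Mapping.lookup z j else 0)" for n j
    unfolding p_def e_def
    by (simp add: lookup_sum lookup_scaleR_pm lookup_single when_def if_distrib cong: if_cong)
  have mem: "x \<in> Rrs r s \<longleftrightarrow> (\<forall>i\<ge>r + s. Poly_Mapping.lookup x i = 0)" for x
    unfolding Rrs_def by (auto simp: subset_iff in_keys_iff not_less[symmetric])
  have e_mem: "e i \<in> Rrs r s" if "i < r + s" for i
    using that unfolding mem e_def by (auto simp: lookup_single when_def)
  have step: "n \<le> r + s \<Longrightarrow> p n \<in> Rrs r s \<and> f (p n) = (\<Sum>i<n. Poly_Mapping.lookup z i * f (e i))" for n
  proof (induction n)
    case 0
    have z0: "(0 :: nat \<Rightarrow>\<^sub>0 real) \<in> Rrs r s" by (simp add: Rrs_def)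
    then have "f (0 *\<^sub>R 0) = 0 *\<^sub>R f 0" using lin unfolding lin_on_def by blast
    then show ?case using z0 by (simp add: p_def)
  next
    case (Suc n)
    have 1: "p n \<in> Rrs r s" "e n \<in> Rrs r s" using Suc e_mem by auto
    have 2: "Poly_Mapping.lookup z n *\<^sub>R e n \<in> Rrs r s"
      using 1(2) by (simp add: mem lookup_scaleR_pm)
    have 3: "p (Suc n) = p n + Poly_Mapping.lookup z n *\<^sub>R e n" by (simp add: p_def)
    have "f (p (Suc n)) = f (p n) + Poly_Mapping.lookup z n * f (e n)"
      using lin 1 2 unfolding 3 lin_on_def by simp
    moreover have "p (Suc n) \<in> Rrs r s" using Suc.prems by (auto simp: mem look)
    ultimately show ?case using Suc by simp
  qed
  have "p (r + s) = z"
    using z by (intro poly_mapping_eqI) (auto simp: look mem)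
  then show ?thesis using step[of "r + s"] by (simp add: e_def)
qed

lemma form_rs_signed_sum:
  "form_rs r s x y =
     (\<Sum>i<r + s. (if i < r then 1 else - 1) * Poly_Mapping.lookup x i * Poly_Mapping.lookup y i)"
proof -
  have "(\<Sum>i<r + s. g i) = (\<Sum>i<r. g i) + (\<Sum>j<s. g (r + j))" for g :: "nat \<Rightarrow> real"
    by (induction s) (simp_all add: add.assoc)
  then show ?thesis by (simp add: form_rs_def sum_negf)
qed

lemma module_bracket_unique:
  assumes adm: "admissible r s M" and x: "x \<in> module_space M" and y: "y \<in> module_space M"
  shows "\<exists>!v. v \<in> Rrs r s \<and>
           (\<forall>z\<in>Rrs r s. module_form M (act M z x) y = form_rs r s z v)"
proof -
  define f where "f z = module_form M (act M z x) y" for z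
  have cm: "is_clifford_module r s M"
    and nf: "nondegenerate_symmetric_form (module_space M) (module_form M)"
    using adm unfolding admissible_def by blast+
  have act: "act M z x \<in> module_space M" if "z \<in> Rrs r s" for z
    using cm x that unfolding is_clifford_module_def by blast
  have actlin: "lin_on (Rrs r s) (\<lambda>z. act M z x)"
    using cm x unfolding is_clifford_module_def by blast
  have f': "f z = module_form M y (act M z x)" if "z \<in> Rrs r s" for z
    using nf y act[OF that] unfolding f_def nondegenerate_symmetric_form_def by blast
  have ylin: "lin_on (module_space M) (module_form M y)"
    using nf y unfolding nondegenerate_symmetric_form_def by blast
  have mem: "v \<in> Rrs r s \<longleftrightarrow> (\<forall>i\<ge>r + s. Poly_Mapping.lookup v i = 0)" for v
    unfolding Rrs_def by (auto simp: subset_iff in_keys_iff not_less[symmetric])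
  have add: "z + w \<in> Rrs r s" if "z \<in> Rrs r s" "w \<in> Rrs r s" for z w
    using that by (simp add: mem lookup_add)
  have scl: "c *\<^sub>R z \<in> Rrs r s" if "z \<in> Rrs r s" for z c
    using that by (simp add: mem lookup_scaleR_pm)
  have flin: "lin_on (Rrs r s) f"
    using actlin ylin act unfolding lin_on_def by (simp add: f' add scl)
  define g where "g i = (if i < r then 1 else - 1) * f (Poly_Mapping.single i 1)" for i
  define v where "v = (\<Sum>i<r + s. Poly_Mapping.single i (g i))"
  have look: "Poly_Mapping.lookup v j = (if j < r + s then g j else 0)" for j
    unfolding v_def by (simp add: lookup_sum lookup_single when_def)
  have v: "v \<in> Rrs r s" by (auto simp: mem look)
  have vz: "f z = form_rs r s z v" if "z \<in> Rrs r s" for z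
    unfolding Rrs_functional_sum[OF flin that] form_rs_signed_sum
    by (rule sum.cong) (auto simp: look g_def)
  have uniq: "w = v" if w: "w \<in> Rrs r s" and wz: "\<forall>z\<in>Rrs r s. f z = form_rs r s z w" for w
  proof (rule poly_mapping_eqI)
    fix i
    show "Poly_Mapping.lookup w i = Poly_Mapping.lookup v i"
    proof (cases "i < r + s")
      case True
      have e: "Poly_Mapping.single i 1 \<in> Rrs r s"
        using True by (auto simp: mem lookup_single when_def)
      have pick: "form_rs r s (Poly_Mapping.single i 1) u =
          (if i < r then 1 else - 1) * Poly_Mapping.lookup u i" for u
      proof -
        have "form_rs r s (Poly_Mapping.single i 1) u =
            (\<Sum>j<r + s. if j = i then (if i < r then 1 else - 1) * Poly_Mapping.lookup u i else 0)"
          unfolding form_rs_signed_sum by (rule sum.cong) (auto simp: lookup_single when_def)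
        then show ?thesis using True by simp
      qed
      show ?thesis using wz e vz[OF e] by (auto simp: pick split: if_splits)
    next
      case False
      then show ?thesis using w v by (auto simp: mem)
    qed
  qed
  show ?thesis
    using v vz uniq unfolding f_def by blast
qed

definition pseudo_H_algebra ::
  "nat \<Rightarrow> nat \<Rightarrow> 'u::real_vector clifford_module \<Rightarrow> ('u \<times> (nat \<Rightarrow>\<^sub>0 real)) lie_algebra" where
  "pseudo_H_algebra r s M =
     \<lparr>lie_space = module_space M \<times> Rrs r s,
      lie_bracket = (\<lambda>(x, _) (y, _). (0, module_bracket r s M x y))\<rparr>"

end

theory Submission
  imports Defs "HOL-Analysis.Finite_Cartesian_Product" "HOL-Computational_Algebra.Fundamental_Theorem_Algebra"
begin

text \<open>
  Let \<open>J\<^sub>i\<close> be the action of an orthonormal basis. On a minimal admissible module there is an inner product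
  \<open>p\<close> for which all \<open>J\<^sub>i\<close> are orthogonal, and by Schur's lemma it can be scaled such that the given form is
  \<open>p (G x) y\<close> with \<open>G\<^sup>2 = 1\<close>. The \<open>J\<^sub>i\<close> and \<open>G\<close> commute up to sign, so between any two minimal modules there
  is a nonzero map intertwining them up to sign. It is a multiple of an isometry, so the Lie algebra does not
  depend on the minimal module.

  The bracket only remembers the skew operators \<open>M\<^sub>i = G J\<^sub>i\<close>. For \<open>r \<noteq> s\<close> an isomorphism with \<open>\<N>\<^sub>s\<^sub>,\<^sub>r\<close> acts on
  the centres as a multiple of an anti-isometry, and the orthogonal factor of its polar decomposition turns it
  into a second symmetric involution \<open>K\<close> on the same space with \<open>M\<^sub>i = K J'\<^sub>i\<close>, where the \<open>J'\<^sub>i\<close> have the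
  opposite signature. The data \<open>(M, G, K)\<close> can be tensored with such data on \<open>\<real>\<^sup>1\<^sup>6\<close> for the signatures
  \<open>(0, 8)\<close>, \<open>(8, 0)\<close> and \<open>(4, 4)\<close>. The result is minimal again: in a module of the larger signature a common
  eigenspace of four commuting products of generators is a module of the smaller one, of one sixteenth of the
  dimension.
\<close>

section \<open>Linear maps and forms on subspaces\<close>

text \<open>A minimal admissible module may be reducible over the Clifford algebra, because its
  proper nonzero invariant subspaces may all be degenerate for the form. Schur's lemma is therefore
  run with \<open>G\<close> next to the generators: an invariant subspace that is also stable under
  \<open>G\<close> is nondegenerate. An isomorphism of the Lie algebras respects neither inner
  products nor chosen generators, and it knows the form of the centre only up to a factor. A
  positive factor would force r = s by comparison of signatures; this is how r \<noteq> s produces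
  the change of sign behind \<open>K\<close>. The inequality can be lost later, when s + 8k = r for
  some k, so the induction carries the triple (M, G, K) with a dimension bound and returns to
  isomorphisms only at the end. The number 16 appears twice: the tensor product multiplies
  dimensions by at most 16, and the common eigenspace divides them by at least 16. The two bounds
  meet, which makes the tensor product minimal for both signatures at once. Neither a classification
  of Clifford modules nor a table of minimal dimensions enters.\<close>

lemma lin_on_add: "lin_on U f \<Longrightarrow> x \<in> U \<Longrightarrow> y \<in> U \<Longrightarrow> f (x + y) = f x + f y"
  by (simp add: lin_on_def)

lemma lin_on_scale: "lin_on U f \<Longrightarrow> x \<in> U \<Longrightarrow> f (c *\<^sub>R x) = c *\<^sub>R f x"
  by (simp add: lin_on_def)

lemma lin_on_zero: "lin_on U f \<Longrightarrow> subspace U \<Longrightarrow> f 0 = 0"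
  using lin_on_scale[of U f 0 0] by (simp add: subspace_0)

lemma lin_on_minus: "lin_on U f \<Longrightarrow> x \<in> U \<Longrightarrow> f (- x) = - f x"
  using lin_on_scale[of U f x "-1"] by simp

lemma lin_on_diff: "lin_on U f \<Longrightarrow> subspace U \<Longrightarrow> x \<in> U \<Longrightarrow> y \<in> U \<Longrightarrow> f (x - y) = f x - f y"
  using lin_on_add[of U f x "- y"] lin_on_minus[of U f y] by (simp add: subspace_neg)

lemma lin_on_sum:
  assumes "lin_on U f" "subspace U" "\<And>i. i \<in> I \<Longrightarrow> g i \<in> U"
  shows "f (\<Sum>i\<in>I. g i) = (\<Sum>i\<in>I. f (g i))"
  using assms(3)
  by (induction I rule: infinite_finite_induct)
     (auto simp: lin_on_zero[OF assms(1,2)] lin_on_add[OF assms(1)] subspace_sum[OF assms(2)])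

lemma lin_on_sum_scale:
  assumes "lin_on U f" "subspace U" "\<And>i. i \<in> I \<Longrightarrow> g i \<in> U"
  shows "f (\<Sum>i\<in>I. c i *\<^sub>R g i) = (\<Sum>i\<in>I. c i *\<^sub>R f (g i))"
  by (subst lin_on_sum[OF assms(1,2)])
     (auto simp: subspace_scale[OF assms(2)] lin_on_scale[OF assms(1)] assms(3) intro!: sum.cong)

lemma lin_on_subset: "lin_on U f \<Longrightarrow> E \<subseteq> U \<Longrightarrow> lin_on E f"
  unfolding lin_on_def by blast

lemma lin_on_comp: "lin_on U f \<Longrightarrow> f ` U \<subseteq> W \<Longrightarrow> lin_on W g \<Longrightarrow> lin_on U (\<lambda>x. g (f x))"
  unfolding lin_on_def by (auto simp: image_subset_iff)

lemma lin_on_plus: "lin_on U f \<Longrightarrow> lin_on U g \<Longrightarrow> lin_on U (\<lambda>x. f x + g x)"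
  unfolding lin_on_def by (auto simp: scaleR_add_right)

lemma lin_on_scaleR: "lin_on U f \<Longrightarrow> lin_on U (\<lambda>x. c *\<^sub>R f x)"
  unfolding lin_on_def by (auto simp: scaleR_add_right)

lemma lin_on_mult: "lin_on U (f :: _ \<Rightarrow> real) \<Longrightarrow> lin_on U (\<lambda>x. c * f x)"
  unfolding lin_on_def by (auto simp: distrib_left)

lemma lin_on_id: "lin_on U (\<lambda>x. x)"
  unfolding lin_on_def by auto

lemma lin_on_setsum: "(\<And>i. i \<in> I \<Longrightarrow> lin_on U (f i)) \<Longrightarrow> lin_on U (\<lambda>x. \<Sum>i\<in>I. f i x)"
  unfolding lin_on_def by (auto simp: sum.distrib scaleR_right.sum)

lemma linear_lin_on: "linear f \<Longrightarrow> lin_on U f"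
  unfolding lin_on_def by (auto simp: linear_add linear_scale)

lemma lin_on_inv_into:
  assumes "lin_on U f" "subspace U" "bij_betw f U W"
  shows "lin_on W (inv_into U f)"
proof -
  have inj: "inj_on f U" and im: "f ` U = W" using assms(3) by (auto simp: bij_betw_def)
  have *: "inv_into U f w \<in> U" "f (inv_into U f w) = w" if "w \<in> W" for w
    using that im by (auto simp: inv_into_into f_inv_into_f)
  show ?thesis unfolding lin_on_def
  proof (intro conjI ballI allI)
    fix x y assume x: "x \<in> W" and y: "y \<in> W"
    have "inv_into U f (f (inv_into U f x + inv_into U f y)) = inv_into U f x + inv_into U f y"
      by (rule inv_into_f_f[OF inj]) (simp add: * x y subspace_add[OF assms(2)])
    then show "inv_into U f (x + y) = inv_into U f x + inv_into U f y"
      by (simp add: lin_on_add[OF assms(1)] * x y)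
  next
    fix c x assume x: "x \<in> W"
    have "inv_into U f (f (c *\<^sub>R inv_into U f x)) = c *\<^sub>R inv_into U f x"
      by (rule inv_into_f_f[OF inj]) (simp add: * x subspace_scale[OF assms(2)])
    then show "inv_into U f (c *\<^sub>R x) = c *\<^sub>R inv_into U f x"
      by (simp add: lin_on_scale[OF assms(1)] * x)
  qed
qed

lemma lin_on_image_subspace:
  assumes "lin_on U f" "subspace U"
  shows "subspace (f ` U)"
proof (rule subspaceI)
  show "0 \<in> f ` U" using lin_on_zero[OF assms] subspace_0[OF assms(2)] by force
next
  fix x y assume "x \<in> f ` U" "y \<in> f ` U"
  then show "x + y \<in> f ` U"
    by (auto simp: lin_on_add[OF assms(1), symmetric] subspace_add[OF assms(2)])
next
  fix c x assume "x \<in> f ` U"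
  then show "c *\<^sub>R x \<in> f ` U"
    by (auto simp: lin_on_scale[OF assms(1), symmetric] subspace_scale[OF assms(2)])
qed

lemma lin_on_inj:
  assumes "lin_on U f" "subspace U" "\<And>x. x \<in> U \<Longrightarrow> f x = 0 \<Longrightarrow> x = 0"
  shows "inj_on f U"
proof (rule inj_onI)
  fix x y assume "x \<in> U" "y \<in> U" "f x = f y"
  then have "x - y \<in> U" "f (x - y) = 0"
    by (auto simp: lin_on_diff[OF assms(1,2)] subspace_diff[OF assms(2)])
  then have "x - y = 0" by (rule assms(3))
  then show "x = y" by simp
qed

section \<open>Finite-dimensional subspaces and dimension counts\<close>

definition fin_space :: "'a::real_vector set \<Rightarrow> bool" where
  "fin_space U \<longleftrightarrow> (\<exists>B. finite B \<and> U = span B)"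

lemma fin_space_subspace: "fin_space U \<Longrightarrow> subspace U"
  by (auto simp: fin_space_def)

lemma fin_space_basis:
  assumes "fin_space U"
  obtains B where "finite B" "independent B" "U = span B" "card B = dim U" "B \<subseteq> U"
proof -
  obtain S where S: "finite S" "U = span S" using assms by (auto simp: fin_space_def)
  obtain B where B: "B \<subseteq> S" "independent B" "S \<subseteq> span B"
    using maximal_independent_subset by blast
  have "span B = U" using B S span_mono span_minimal by (metis subset_antisym subspace_span)
  moreover have "finite B" using B S finite_subset by blast
  ultimately show thesis using that[of B] B(2) dim_span_eq_card_independent[OF B(2)] span_superset
    by metis
qed

lemma independent_in_fin_space:
  assumes "fin_space U" "S \<subseteq> U" "independent S"
  shows "finite S \<and> card S \<le> dim U"
proof -
  obtain B where B: "finite B" "independent B" "U = span B" "card B = dim U"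
    using fin_space_basis[OF assms(1)] by metis
  show ?thesis using independent_span_bound[of B S] B assms by auto
qed

lemma fin_space_subset:
  assumes "fin_space U" "subspace E" "E \<subseteq> U"
  shows "fin_space E" "dim E \<le> dim U" "dim U \<le> dim E \<Longrightarrow> E = U"
proof -
  obtain S where S: "S \<subseteq> E" "independent S" "E \<subseteq> span S"
    using maximal_independent_subset by blast
  have fS: "finite S" "card S \<le> dim U"
    using independent_in_fin_space[OF assms(1) _ S(2)] S(1) assms(3) by auto
  have sp: "span S = E" using S assms(2) span_minimal by blast
  show "fin_space E" unfolding fin_space_def using fS sp by blast
  have dE: "dim E = card S" using sp dim_span_eq_card_independent[OF S(2)] by auto
  show "dim E \<le> dim U" using dE fS by simp
  assume le: "dim U \<le> dim E"
  show "E = U"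
  proof (rule ccontr)
    assume "E \<noteq> U"
    then obtain x where x: "x \<in> U" "x \<notin> span S" using assms(3) sp by blast
    have "independent (insert x S)" using x S(2) independent_insertI by blast
    then have "card (insert x S) \<le> dim U"
      using independent_in_fin_space[OF assms(1), of "insert x S"] x S(1) assms(3) by auto
    moreover have "x \<notin> S" using x(2) span_superset by blast
    ultimately show False using fS dE le by simp
  qed
qed

text \<open>Maps are linear on their carrier only; a total extension makes results on
  \<open>linear\<close> maps, such as those on images of spans, available for them.\<close>

lemma lin_on_extend:
  assumes "lin_on U f" "fin_space U"
  obtains g where "linear g" "\<And>x. x \<in> U \<Longrightarrow> g x = f x"
proof -
  obtain B where B: "finite B" "independent B" "U = span B" "B \<subseteq> U"
    using fin_space_basis[OF assms(2)] by metis
  obtain g where g: "linear g" "\<And>x. x \<in> B \<Longrightarrow> g x = f x"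
    using linear_independent_extend[OF B(2)] by metis
  have "subspace {x \<in> U. g x = f x}"
    using fin_space_subspace[OF assms(2)]
    by (auto simp: subspace_def linear_0[OF g(1)] linear_add[OF g(1)] linear_scale[OF g(1)]
        lin_on_add[OF assms(1)] lin_on_scale[OF assms(1)]
        lin_on_zero[OF assms(1) fin_space_subspace[OF assms(2)]])
  then have "span B \<subseteq> {x \<in> U. g x = f x}"
    using g(2) B(4) by (intro span_minimal) auto
  then show thesis using that[OF g(1)] B(3) by auto
qed

lemma lin_on_image_fin_space:
  assumes "lin_on U f" "fin_space U"
  shows "fin_space (f ` U)"
proof -
  obtain g where g: "linear g" "\<And>x. x \<in> U \<Longrightarrow> g x = f x" using lin_on_extend[OF assms] by metis
  obtain B where "finite B" "U = span B" using assms(2) by (auto simp: fin_space_def)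
  then have "f ` U = span (g ` B)"
    using g linear_span_image[OF g(1), of B] by (metis image_cong)
  then show ?thesis using \<open>finite B\<close> unfolding fin_space_def by blast
qed

lemma lin_on_inj_dim:
  assumes "lin_on U f" "fin_space U" "inj_on f U"
  shows "dim (f ` U) = dim U"
proof -
  obtain g where g: "linear g" "\<And>x. x \<in> U \<Longrightarrow> g x = f x" using lin_on_extend[OF assms(1,2)] by metis
  obtain B where B: "finite B" "independent B" "U = span B" "card B = dim U" "B \<subseteq> U"
    using fin_space_basis[OF assms(2)] by metis
  have inj: "inj_on g (span B)" using assms(3) g(2) B(3) by (metis inj_on_cong)
  have "independent (g ` B)" using linear_independent_injective_image[OF g(1) B(2) inj] .
  moreover have "f ` U = span (g ` B)"
    using g B(3) linear_span_image[OF g(1), of B] by (metis image_cong)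
  moreover have "card (g ` B) = card B"
    using inj B(5,3) card_image inj_on_subset by metis
  ultimately show ?thesis using B(4) by (metis dim_span_eq_card_independent)
qed

lemma lin_on_inj_surj:
  assumes "lin_on U f" "fin_space U" "f ` U \<subseteq> U" "\<And>x. x \<in> U \<Longrightarrow> f x = 0 \<Longrightarrow> x = 0"
  shows "f ` U = U"
proof -
  have sub: "subspace U" using fin_space_subspace[OF assms(2)] .
  have "dim (f ` U) = dim U"
    using lin_on_inj_dim[OF assms(1,2)] lin_on_inj[OF assms(1) sub assms(4)] by blast
  then show ?thesis
    using fin_space_subset(3)[OF assms(2) lin_on_image_subspace[OF assms(1) sub] assms(3)] by simp
qed

lemma lin_on_eqI:
  assumes "lin_on U f" "lin_on U g" "subspace U" "U \<subseteq> span B" "B \<subseteq> U" "\<And>b. b \<in> B \<Longrightarrow> f b = g b" "x \<in> U"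
  shows "f x = g x"
proof -
  have "subspace {x \<in> U. f x = g x}"
    using assms(3)
    by (auto simp: subspace_def lin_on_add[OF assms(1)] lin_on_scale[OF assms(1)]
        lin_on_add[OF assms(2)] lin_on_scale[OF assms(2)] lin_on_zero[OF assms(1,3)] lin_on_zero[OF assms(2,3)])
  then have "span B \<subseteq> {x \<in> U. f x = g x}"
    using assms by (intro span_minimal) auto
  then show ?thesis using assms by auto
qed

section \<open>Inner products, nondegenerate forms and representation of functionals\<close>

definition inner_on :: "'a::real_vector set \<Rightarrow> ('a \<Rightarrow> 'a \<Rightarrow> real) \<Rightarrow> bool" where
  "inner_on U p \<longleftrightarrow>
     (\<forall>x\<in>U. \<forall>y\<in>U. p x y = p y x) \<and> (\<forall>x\<in>U. lin_on U (p x)) \<and> (\<forall>x\<in>U. x \<noteq> 0 \<longrightarrow> p x x > 0)"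

lemma inner_on_sym: "inner_on U p \<Longrightarrow> x \<in> U \<Longrightarrow> y \<in> U \<Longrightarrow> p x y = p y x"
  and inner_on_lin: "inner_on U p \<Longrightarrow> x \<in> U \<Longrightarrow> lin_on U (p x)"
  and inner_on_pos: "inner_on U p \<Longrightarrow> x \<in> U \<Longrightarrow> x \<noteq> 0 \<Longrightarrow> p x x > 0"
  by (auto simp: inner_on_def)

lemma inner_on_lin2: "inner_on U p \<Longrightarrow> subspace U \<Longrightarrow> x \<in> U \<Longrightarrow> lin_on U (\<lambda>y. p y x)"
  using inner_on_lin[of U p x] inner_on_sym[of U p]
  by (auto simp: lin_on_def subspace_add subspace_scale)

lemma inner_on_nondeg:
  assumes "inner_on U p" shows "nondegenerate_symmetric_form U p"
  unfolding nondegenerate_symmetric_form_def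
  using assms by (force simp: inner_on_def)

lemma inner_on_exists:
  assumes "fin_space U"
  obtains p where "inner_on U p"
proof -
  obtain B where B: "finite B" "independent B" "U = span B"
    using fin_space_basis[OF assms] by metis
  define p where "p x y = (\<Sum>b\<in>B. representation B x b * representation B y b)" for x y
  have "inner_on U p"
    unfolding inner_on_def
  proof (intro conjI ballI impI)
    fix x y show "p x y = p y x" by (simp add: p_def mult.commute)
  next
    fix x assume "x \<in> U"
    then show "lin_on U (p x)"
      using B by (auto simp: lin_on_def p_def representation_add representation_scale
          distrib_left sum.distrib sum_distrib_left mult.left_commute)
  next
    fix x assume x: "x \<in> U" "x \<noteq> 0"
    have "x = (\<Sum>b\<in>B. representation B x b *\<^sub>R b)"
      using sum_representation_eq[OF B(2) _ B(1), of x] x B(3) by simp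
    have "\<exists>b\<in>B. representation B x b \<noteq> 0"
    proof (rule ccontr)
      assume "\<not> ?thesis"
      then have "(\<Sum>b\<in>B. representation B x b *\<^sub>R b) = 0" by (simp add: sum.neutral)
      then show False using \<open>x = _\<close> x(2) by simp
    qed
    then obtain b where b: "b \<in> B" "representation B x b \<noteq> 0" by blast
    show "p x x > 0" unfolding p_def
      using b B(1) by (intro sum_pos2[of B b]) (auto simp: zero_less_mult_iff linorder_neq_iff)
  qed
  then show thesis using that by blast
qed

lemma nondeg_sym: "nondegenerate_symmetric_form U p \<Longrightarrow> x \<in> U \<Longrightarrow> y \<in> U \<Longrightarrow> p x y = p y x"
  and nondeg_lin: "nondegenerate_symmetric_form U p \<Longrightarrow> x \<in> U \<Longrightarrow> lin_on U (p x)"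
  and nondeg_nondeg: "nondegenerate_symmetric_form U p \<Longrightarrow> x \<in> U \<Longrightarrow> (\<And>y. y \<in> U \<Longrightarrow> p x y = 0) \<Longrightarrow> x = 0"
  by (auto simp: nondegenerate_symmetric_form_def)

lemma nondeg_lin2: "nondegenerate_symmetric_form U p \<Longrightarrow> subspace U \<Longrightarrow> x \<in> U \<Longrightarrow> lin_on U (\<lambda>y. p y x)"
  using nondeg_lin[of U p x] nondeg_sym[of U p]
  by (auto simp: lin_on_def subspace_add subspace_scale)

lemma nondeg_eqI:
  assumes "nondegenerate_symmetric_form U p" "subspace U" "x \<in> U" "x' \<in> U"
    "\<And>y. y \<in> U \<Longrightarrow> p x y = p x' y"
  shows "x = x'"
proof -
  have "x - x' = 0"
    by (rule nondeg_nondeg[OF assms(1)])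
       (auto simp: assms subspace_diff lin_on_diff[OF nondeg_lin2[OF assms(1,2)] assms(2)])
  then show ?thesis by simp
qed

text \<open>The endomorphism \<open>L\<close>, whose coefficients are the values of
  \<open>p x\<close> on a basis, is injective by nondegeneracy and hence onto by dimension. The
  argument covers indefinite forms, such as those of the centres.\<close>

lemma riesz:
  assumes p: "nondegenerate_symmetric_form U p" and U: "fin_space U" and f: "lin_on U f"
  shows "\<exists>u\<in>U. \<forall>y\<in>U. p u y = f y"
proof -
  have sub: "subspace U" using fin_space_subspace[OF U] .
  obtain B where B: "finite B" "independent B" "U = span B" "B \<subseteq> U"
    using fin_space_basis[OF U] by metis
  define L where "L x = (\<Sum>b\<in>B. p x b *\<^sub>R b)" for x
  have inU: "(\<Sum>b\<in>B. g b *\<^sub>R b) \<in> U" for g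
    using B(4) sub by (auto intro!: subspace_sum subspace_scale)
  have "lin_on U L" unfolding L_def
  proof (rule lin_on_setsum)
    fix b assume "b \<in> B"
    then have "lin_on U (\<lambda>x. p x b)" using nondeg_lin2[OF p sub] B(4) by blast
    then show "lin_on U (\<lambda>x. p x b *\<^sub>R b)" by (auto simp: lin_on_def scaleR_add_left)
  qed
  have ind: "g = h" if "(\<Sum>b\<in>B. g b *\<^sub>R b) = (\<Sum>b\<in>B. h b *\<^sub>R b)" "\<And>b. b \<notin> B \<Longrightarrow> g b = 0 \<and> h b = 0"
    for g h :: "_ \<Rightarrow> real"
  proof
    fix b
    have "(\<Sum>b\<in>B. (g b - h b) *\<^sub>R b) = 0"
      using that(1) by (simp add: scaleR_diff_left sum_subtractf)
    then have "\<not> (\<exists>v\<in>B. g v - h v \<noteq> 0)"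
      using B(2) by (auto simp: dependent_finite[OF B(1)] dest: spec[of _ "\<lambda>b. g b - h b"])
    then show "g b = h b"
      using that(2)[of b] by (cases "b \<in> B") auto
  qed
  have agree: "\<forall>y\<in>U. p x y = f y" if x: "x \<in> U" and eq: "\<forall>b\<in>B. p x b = f b"
    and lf: "lin_on U f" for x f
    using lin_on_eqI[OF nondeg_lin[OF p x] lf sub, of B] B eq by blast
  have kernel: "x = 0" if x: "x \<in> U" and L0: "L x = 0" for x
  proof -
    have "(\<Sum>b\<in>B. (if b \<in> B then p x b else 0) *\<^sub>R b) = (\<Sum>b\<in>B. 0 *\<^sub>R b)"
      using L0 by (simp add: L_def)
    from ind[OF this] have e: "(\<lambda>b. if b \<in> B then p x b else 0) = (\<lambda>b. 0)" by auto
    have "\<forall>b\<in>B. p x b = 0" using fun_cong[OF e] by metis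
    then have "\<forall>y\<in>U. p x y = 0" using agree[OF x, of "\<lambda>_. 0"] by (auto simp: lin_on_def)
    then show ?thesis using nondeg_nondeg[OF p x] by blast
  qed
  have "L ` U = U"
    by (rule lin_on_inj_surj[OF \<open>lin_on U L\<close> U _ kernel]) (use inU in \<open>auto simp: L_def\<close>)
  then obtain u where u: "u \<in> U" "L u = (\<Sum>b\<in>B. f b *\<^sub>R b)"
    using inU by (metis imageE)
  have "(\<Sum>b\<in>B. (if b \<in> B then p u b else 0) *\<^sub>R b) = (\<Sum>b\<in>B. (if b \<in> B then f b else 0) *\<^sub>R b)"
    using u(2) by (simp add: L_def)
  from ind[OF this] have e: "(\<lambda>b. if b \<in> B then p u b else 0) = (\<lambda>b. if b \<in> B then f b else 0)" by auto
  have "\<forall>b\<in>B. p u b = f b" using fun_cong[OF e] by metis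
  then show ?thesis using agree[OF u(1) _ f] u(1) by blast
qed

text \<open>Uniqueness of the representing vector makes the choice linear. This rule supplies the
  involution \<open>G\<close>, the product of an intertwiner with its adjoint, and the inverse
  adjoint on centres. In the last case source \<open>E\<close> and target \<open>U\<close> belong to
  different algebras.\<close>

lemma riesz_operator:
  assumes p: "nondegenerate_symmetric_form U p" and U: "fin_space U"
    and q: "\<And>x. x \<in> E \<Longrightarrow> lin_on U (q x)" "\<And>y. y \<in> U \<Longrightarrow> lin_on E (\<lambda>x. q x y)" and E: "subspace E"
  obtains S where "lin_on E S" "S ` E \<subseteq> U" "\<And>x y. x \<in> E \<Longrightarrow> y \<in> U \<Longrightarrow> p (S x) y = q x y"
proof -
  have sub: "subspace U" using fin_space_subspace[OF U] .
  have "\<forall>x\<in>E. \<exists>u\<in>U. \<forall>y\<in>U. p u y = q x y" using riesz[OF p U q(1)] by blast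
  then obtain S where S: "\<And>x. x \<in> E \<Longrightarrow> S x \<in> U" "\<And>x y. x \<in> E \<Longrightarrow> y \<in> U \<Longrightarrow> p (S x) y = q x y"
    by metis
  have "lin_on E S" unfolding lin_on_def
  proof (intro conjI ballI allI)
    fix x y assume "x \<in> E" "y \<in> E"
    then show "S (x + y) = S x + S y"
      by (intro nondeg_eqI[OF p sub])
         (auto simp: S subspace_add sub E lin_on_add[OF nondeg_lin2[OF p sub]] lin_on_add[OF q(2)])
  next
    fix c x assume "x \<in> E"
    then show "S (c *\<^sub>R x) = c *\<^sub>R S x"
      by (intro nondeg_eqI[OF p sub])
         (auto simp: S subspace_scale sub E lin_on_scale[OF nondeg_lin2[OF p sub]] lin_on_scale[OF q(2)])
  qed
  then show thesis using that S by blast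
qed

section \<open>Clifford families and Lie algebra isomorphisms\<close>

definition sig_sign :: "nat \<Rightarrow> nat \<Rightarrow> real" where
  "sig_sign r i = (if i < r then 1 else - 1)"

lemma sig_sign_sq [simp]: "sig_sign r i * sig_sign r i = 1" "sig_sign r i * (sig_sign r i * x) = x"
  by (auto simp: sig_sign_def)

lemma sig_sign_nz [simp]: "sig_sign r i \<noteq> 0"
  by (auto simp: sig_sign_def)

abbreviation pm_unit :: "nat \<Rightarrow> (nat \<Rightarrow>\<^sub>0 real)" where
  "pm_unit i \<equiv> Poly_Mapping.single i 1"

lemma mem_Rrs: "x \<in> Rrs r s \<longleftrightarrow> (\<forall>i\<ge>r + s. Poly_Mapping.lookup x i = 0)"
  unfolding Rrs_def by (auto simp: subset_iff in_keys_iff not_less[symmetric])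

lemma subspace_Rrs: "subspace (Rrs r s)"
  by (auto simp: subspace_def mem_Rrs lookup_add lookup_scaleR_pm)

lemma pm_unit_Rrs [simp]: "i < r + s \<Longrightarrow> pm_unit i \<in> Rrs r s"
  by (auto simp: mem_Rrs lookup_single when_def)

lemma lookup_pm_sum:
  "finite I \<Longrightarrow> Poly_Mapping.lookup (\<Sum>i\<in>I. Poly_Mapping.single i (g i)) j = (if j \<in> I then g j else 0)"
  by (simp add: lookup_sum lookup_single when_def)

lemma scaleR_pm_unit: "c *\<^sub>R pm_unit i = Poly_Mapping.single i c"
  by (rule poly_mapping_eqI) (simp add: lookup_scaleR_pm lookup_single when_def)

lemma Rrs_expand: "z \<in> Rrs r s \<Longrightarrow> z = (\<Sum>i<r + s. Poly_Mapping.lookup z i *\<^sub>R pm_unit i)"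
  by (rule poly_mapping_eqI) (auto simp: scaleR_pm_unit lookup_pm_sum mem_Rrs)

lemma fin_space_Rrs: "fin_space (Rrs r s)"
proof -
  have "Rrs r s = span (pm_unit ` {..<r + s})"
  proof
    show "Rrs r s \<subseteq> span (pm_unit ` {..<r + s})"
    proof
      fix z assume "z \<in> Rrs r s"
      then show "z \<in> span (pm_unit ` {..<r + s})"
        by (subst Rrs_expand[of z r s]) (assumption, rule span_sum, rule span_scale, rule span_base, simp)
    qed
    show "span (pm_unit ` {..<r + s}) \<subseteq> Rrs r s"
      by (rule span_minimal) (auto simp: subspace_Rrs)
  qed
  then show ?thesis unfolding fin_space_def by blast
qed

lemma form_rs_sym: "form_rs r s x y = form_rs r s y x"
  by (simp add: form_rs_def mult.commute)

lemma form_rs_lin: "lin_on U (form_rs r s x)"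
  by (simp add: lin_on_def form_rs_signed_sum lookup_add lookup_scaleR_pm distrib_left sum.distrib
      sum_distrib_left mult.left_commute)

lemma form_rs_add: "form_rs r s x (y + z) = form_rs r s x y + form_rs r s x z"
    "form_rs r s (y + z) x = form_rs r s y x + form_rs r s z x"
  and form_rs_scale: "form_rs r s x (c *\<^sub>R y) = c * form_rs r s x y"
    "form_rs r s (c *\<^sub>R y) x = c * form_rs r s y x"
  using form_rs_lin[of UNIV r s x] unfolding lin_on_def by (auto simp: form_rs_sym[of r s _ x])

lemma form_rs_unit: "i < r + s \<Longrightarrow> form_rs r s (pm_unit i) v = sig_sign r i * Poly_Mapping.lookup v i"
proof -
  assume "i < r + s"
  have "form_rs r s (pm_unit i) v = (\<Sum>j<r + s. if j = i then sig_sign r i * Poly_Mapping.lookup v i else 0)"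
    unfolding form_rs_signed_sum by (rule sum.cong) (auto simp: lookup_single when_def sig_sign_def)
  then show ?thesis using \<open>i < r + s\<close> by simp
qed

lemma form_rs_nondeg: "nondegenerate_symmetric_form (Rrs r s) (form_rs r s)"
  unfolding nondegenerate_symmetric_form_def
proof (intro conjI ballI impI)
  fix x assume x: "x \<in> Rrs r s" and 0: "\<forall>y\<in>Rrs r s. form_rs r s x y = 0"
  show "x = 0"
  proof (rule poly_mapping_eqI)
    fix i
    show "Poly_Mapping.lookup x i = Poly_Mapping.lookup 0 i"
    proof (cases "i < r + s")
      case True
      then have "form_rs r s (pm_unit i) x = 0" using 0 form_rs_sym pm_unit_Rrs by metis
      then show ?thesis using form_rs_unit[OF True, of x] by simp
    next
      case False
      then show ?thesis using x by (simp add: mem_Rrs)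
    qed
  qed
qed (auto simp: form_rs_sym form_rs_lin)

text \<open>The action of an orthogonal basis with norms \<open>e i\<close>. The norms form a
  function instead of a pair (r, s), because they get negated, selected and permuted later
  on.\<close>

definition clifford_family ::
  "nat \<Rightarrow> (nat \<Rightarrow> real) \<Rightarrow> 'u::real_vector set \<Rightarrow> (nat \<Rightarrow> 'u \<Rightarrow> 'u) \<Rightarrow> ('u \<Rightarrow> 'u \<Rightarrow> real) \<Rightarrow> bool" where
  "clifford_family n e U J b \<longleftrightarrow> fin_space U \<and> nondegenerate_symmetric_form U b \<and>
     (\<forall>i<n. lin_on U (J i) \<and> J i ` U \<subseteq> U \<and> (\<forall>x\<in>U. J i (J i x) = - e i *\<^sub>R x) \<and>
        (\<forall>x\<in>U. \<forall>y\<in>U. b (J i x) y = - b x (J i y))) \<and>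
     (\<forall>i<n. \<forall>j<n. i \<noteq> j \<longrightarrow> (\<forall>x\<in>U. J i (J j x) = - J j (J i x)))"

lemma clifford_familyD:
  assumes "clifford_family n e U J b"
  shows "fin_space U" "subspace U" "nondegenerate_symmetric_form U b"
    "\<And>i. i < n \<Longrightarrow> lin_on U (J i)" "\<And>i x. i < n \<Longrightarrow> x \<in> U \<Longrightarrow> J i x \<in> U"
    "\<And>i x. i < n \<Longrightarrow> x \<in> U \<Longrightarrow> J i (J i x) = - e i *\<^sub>R x"
    "\<And>i x y. i < n \<Longrightarrow> x \<in> U \<Longrightarrow> y \<in> U \<Longrightarrow> b (J i x) y = - b x (J i y)"
    "\<And>i j x. i < n \<Longrightarrow> j < n \<Longrightarrow> i \<noteq> j \<Longrightarrow> x \<in> U \<Longrightarrow> J i (J j x) = - J j (J i x)"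
  using assms fin_space_subspace unfolding clifford_family_def by blast+

definition fam_mod ::
  "nat \<Rightarrow> 'u::real_vector set \<Rightarrow> (nat \<Rightarrow> 'u \<Rightarrow> 'u) \<Rightarrow> ('u \<Rightarrow> 'u \<Rightarrow> real) \<Rightarrow> 'u clifford_module" where
  "fam_mod n U J b =
     \<lparr>module_space = U, act = (\<lambda>z x. \<Sum>i<n. Poly_Mapping.lookup z i *\<^sub>R J i x), module_form = b\<rparr>"

lemma fam_mod_simps [simp]:
  "module_space (fam_mod n U J b) = U" "module_form (fam_mod n U J b) = b"
  by (simp_all add: fam_mod_def)

lemma act_fam_mod_unit [simp]: "i < n \<Longrightarrow> act (fam_mod n U J b) (pm_unit i) x = J i x"
  by (simp add: fam_mod_def lookup_single when_def if_distrib if_distribR cong: if_cong)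

lemma admissible_fam_mod:
  assumes "clifford_family (r + s) (sig_sign r) U J b"
  shows "admissible r s (fam_mod (r + s) U J b)"
proof -
  note c = clifford_familyD[OF assms]
  let ?n = "r + s"
  have mem: "(\<Sum>i<?n. f i *\<^sub>R J i x) \<in> U" if "x \<in> U" for f x
    using that c by (auto intro!: subspace_sum subspace_scale)
  have linz: "lin_on U (\<lambda>x. \<Sum>i<?n. f i *\<^sub>R J i x)" for f
    using c(4) by (auto intro!: lin_on_setsum lin_on_scaleR)
  have sq: "(\<Sum>i<?n. z i *\<^sub>R J i (\<Sum>j<?n. z j *\<^sub>R J j x)) = - (\<Sum>i<?n. sig_sign r i * z i * z i) *\<^sub>R x"
    (is "?T = _") if x: "x \<in> U" for z x
  proof -
    have T: "?T = (\<Sum>i<?n. \<Sum>j<?n. (z i * z j) *\<^sub>R J i (J j x))"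
    proof (intro sum.cong refl)
      fix i assume "i \<in> {..<?n}"
      then have i: "i < ?n" by simp
      have "J i (\<Sum>j<?n. z j *\<^sub>R J j x) = (\<Sum>j<?n. z j *\<^sub>R J i (J j x))"
        using x c(5) by (intro lin_on_sum_scale[OF c(4)[OF i] c(2)]) auto
      then show "z i *\<^sub>R J i (\<Sum>j<?n. z j *\<^sub>R J j x) = (\<Sum>j<?n. (z i * z j) *\<^sub>R J i (J j x))"
        by (simp add: scaleR_sum_right)
    qed
    \<comment> \<open>Adding the double sum to itself with the indices exchanged cancels the mixed
      terms, which anticommute, and leaves twice the diagonal.\<close>
    then have "?T + ?T = (\<Sum>i<?n. \<Sum>j<?n. (z i * z j) *\<^sub>R J i (J j x)) + (\<Sum>i<?n. \<Sum>j<?n. (z j * z i) *\<^sub>R J j (J i x))"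
      using sum.swap[of "\<lambda>i j. (z i * z j) *\<^sub>R J i (J j x)" "{..<?n}" "{..<?n}"] by simp
    also have "\<dots> = (\<Sum>i<?n. \<Sum>j<?n. if j = i then - (2 * z i * z i * sig_sign r i) *\<^sub>R x else 0)"
      unfolding sum.distrib[symmetric]
    proof (intro sum.cong refl)
      fix i j assume i: "i \<in> {..<?n}" and j: "j \<in> {..<?n}"
      show "(z i * z j) *\<^sub>R J i (J j x) + (z j * z i) *\<^sub>R J j (J i x) =
          (if j = i then - (2 * z i * z i * sig_sign r i) *\<^sub>R x else 0)"
      proof (cases "i = j")
        case True
        have "(z i * z i) *\<^sub>R J i (J i x) + (z i * z i) *\<^sub>R J i (J i x) = (z i * z i + z i * z i) *\<^sub>R J i (J i x)"
          by (simp only: scaleR_left_distrib)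
        also have "\<dots> = - (2 * z i * z i * sig_sign r i) *\<^sub>R x"
          using i c(6)[of i x] x by (simp add: mult_ac)
        finally show ?thesis using True by simp
      next
        case False
        then show ?thesis using i j c(8)[of i j x] x by (simp add: mult.commute)
      qed
    qed
    also have "\<dots> = (\<Sum>i<?n. - (2 * z i * z i * sig_sign r i) *\<^sub>R x)"
      by (intro sum.cong refl) simp
    also have "\<dots> = 2 *\<^sub>R (- (\<Sum>i<?n. sig_sign r i * z i * z i) *\<^sub>R x)"
      by (simp add: scaleR_left.sum[symmetric] sum_distrib_left sum_negf mult_ac)
    finally have "2 *\<^sub>R ?T = 2 *\<^sub>R (- (\<Sum>i<?n. sig_sign r i * z i * z i) *\<^sub>R x)"
      by (simp add: scaleR_2)
    then show ?thesis by (simp only: scaleR_cancel_left) simp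
  qed
  have skew: "b (\<Sum>i<?n. f i *\<^sub>R J i x) y + b x (\<Sum>i<?n. f i *\<^sub>R J i y) = 0" if x: "x \<in> U" and y: "y \<in> U" for f x y
  proof -
    have "b (\<Sum>i<?n. f i *\<^sub>R J i x) y = (\<Sum>i<?n. f i *\<^sub>R b (J i x) y)"
      using c(5) x by (intro lin_on_sum_scale[OF nondeg_lin2[OF c(3) c(2) y] c(2)]) auto
    moreover have "b x (\<Sum>i<?n. f i *\<^sub>R J i y) = (\<Sum>i<?n. f i *\<^sub>R b x (J i y))"
      using c(5) y by (intro lin_on_sum_scale[OF nondeg_lin[OF c(3) x] c(2)]) auto
    ultimately show ?thesis using c(7)[OF _ x y] by (simp add: sum.distrib[symmetric])
  qed
  show ?thesis
    unfolding admissible_def is_clifford_module_def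
    using c(1) c(3) mem linz sq skew
    by (auto simp: fam_mod_def fin_space_def form_rs_signed_sum sig_sign_def[symmetric] lin_on_def
        lookup_add lookup_scaleR_pm scaleR_left_distrib sum.distrib scaleR_right.sum)
qed

lemma admD:
  assumes "admissible r s M"
  shows "fin_space (module_space M)" "subspace (module_space M)"
    "nondegenerate_symmetric_form (module_space M) (module_form M)"
    "\<And>z. z \<in> Rrs r s \<Longrightarrow> lin_on (module_space M) (act M z)"
    "\<And>x. x \<in> module_space M \<Longrightarrow> lin_on (Rrs r s) (\<lambda>z. act M z x)"
    "\<And>z x. z \<in> Rrs r s \<Longrightarrow> x \<in> module_space M \<Longrightarrow> act M z x \<in> module_space M"
    "\<And>z x. z \<in> Rrs r s \<Longrightarrow> x \<in> module_space M \<Longrightarrow> act M z (act M z x) = - form_rs r s z z *\<^sub>R x"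
    "\<And>z x y. z \<in> Rrs r s \<Longrightarrow> x \<in> module_space M \<Longrightarrow> y \<in> module_space M \<Longrightarrow>
        module_form M (act M z x) y = - module_form M x (act M z y)"
proof -
  show 1: "fin_space (module_space M)"
    using assms unfolding admissible_def is_clifford_module_def fin_space_def by blast
  show "subspace (module_space M)" by (rule fin_space_subspace[OF 1])
  show "\<And>z x y. z \<in> Rrs r s \<Longrightarrow> x \<in> module_space M \<Longrightarrow> y \<in> module_space M \<Longrightarrow>
        module_form M (act M z x) y = - module_form M x (act M z y)"
    using assms unfolding admissible_def by (simp add: add_eq_0_iff2)
qed (use assms in \<open>unfold admissible_def is_clifford_module_def, blast+\<close>)

text \<open>Polarisation of the rule for the square of the action, applied to
  \<open>z + w\<close>.\<close>

lemma act_anticomm: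
  assumes adm: "admissible r s M" and z: "z \<in> Rrs r s" and w: "w \<in> Rrs r s" and x: "x \<in> module_space M"
  shows "act M z (act M w x) + act M w (act M z x) = - (2 * form_rs r s z w) *\<^sub>R x"
proof -
  note a = admD[OF adm]
  have zw: "z + w \<in> Rrs r s" using z w subspace_add[OF subspace_Rrs] by blast
  have "act M (z + w) (act M (z + w) x) = - form_rs r s (z + w) (z + w) *\<^sub>R x"
    by (rule a(7)[OF zw x])
  moreover have "act M (z + w) (act M (z + w) x) =
      act M z (act M z x) + act M z (act M w x) + (act M w (act M z x) + act M w (act M w x))"
    using z w zw x a(6)
    by (simp add: lin_on_add[OF a(5)] lin_on_add[OF a(4)] subspace_add[OF a(2)])
  moreover have "form_rs r s (z + w) (z + w) = form_rs r s z z + 2 * form_rs r s z w + form_rs r s w w"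
    by (simp add: form_rs_add form_rs_sym[of r s w z])
  ultimately have eq: "- (form_rs r s z z + 2 * form_rs r s z w + form_rs r s w w) *\<^sub>R x =
      - form_rs r s z z *\<^sub>R x + act M z (act M w x) + (act M w (act M z x) + - form_rs r s w w *\<^sub>R x)"
    using a(7)[OF z x] a(7)[OF w x] by simp
  have "act M z (act M w x) + act M w (act M z x) =
      - (form_rs r s z z + 2 * form_rs r s z w + form_rs r s w w) *\<^sub>R x + form_rs r s z z *\<^sub>R x + form_rs r s w w *\<^sub>R x"
    unfolding eq by simp
  also have "\<dots> = - (2 * form_rs r s z w) *\<^sub>R x"
    unfolding scaleR_left_distrib[symmetric] by simp
  finally show ?thesis .
qed

lemma clifford_orthogonal:
  assumes adm: "admissible r s M" and z: "\<And>i. i < n \<Longrightarrow> z i \<in> Rrs r s"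
    and orth: "\<And>i j. i < n \<Longrightarrow> j < n \<Longrightarrow> form_rs r s (z i) (z j) = (if i = j then e i else 0)"
  shows "clifford_family n e (module_space M) (\<lambda>i. act M (z i)) (module_form M)"
  unfolding clifford_family_def
proof (intro conjI allI impI ballI)
  note a = admD[OF adm]
  show "fin_space (module_space M)" "nondegenerate_symmetric_form (module_space M) (module_form M)"
    using a by auto
  fix i assume i: "i < n"
  show "lin_on (module_space M) (act M (z i))" "act M (z i) ` module_space M \<subseteq> module_space M"
    using a(4,6)[OF z[OF i]] by auto
  { fix x assume x: "x \<in> module_space M"
    show "act M (z i) (act M (z i) x) = - e i *\<^sub>R x" using a(7)[OF z[OF i] x] orth[OF i i] by simp
    { fix y assume y: "y \<in> module_space M"
      show "module_form M (act M (z i) x) y = - module_form M x (act M (z i) y)"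
        using a(8)[OF z[OF i] x y] . }
    fix j assume j: "j < n" and ij: "i \<noteq> j"
    show "act M (z i) (act M (z j) x) = - act M (z j) (act M (z i) x)"
      using act_anticomm[OF adm z[OF i] z[OF j] x] orth[OF i j] ij by (simp add: add_eq_0_iff2) }
qed

lemma clifford_standard:
  assumes "admissible r s M"
  shows "clifford_family (r + s) (sig_sign r) (module_space M) (\<lambda>i. act M (pm_unit i)) (module_form M)"
  by (rule clifford_orthogonal[OF assms]) (auto simp: form_rs_unit lookup_single when_def)

lemma module_bracket_props:
  assumes "admissible r s M" "x \<in> module_space M" "y \<in> module_space M"
  shows "module_bracket r s M x y \<in> Rrs r s"
    "\<And>z. z \<in> Rrs r s \<Longrightarrow> module_form M (act M z x) y = form_rs r s z (module_bracket r s M x y)"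
  using theI'[OF module_bracket_unique[OF assms]] unfolding module_bracket_def by auto

lemma lookup_module_bracket:
  assumes "admissible r s M" "x \<in> module_space M" "y \<in> module_space M" "i < r + s"
  shows "Poly_Mapping.lookup (module_bracket r s M x y) i = sig_sign r i * module_form M (act M (pm_unit i) x) y"
  using module_bracket_props(2)[OF assms(1-3) pm_unit_Rrs[OF assms(4)]]
  by (simp add: form_rs_unit[OF assms(4)])

text \<open>On the centre the isomorphism is a scaled permutation \<open>C\<close> of coordinates. A
  coordinate of a bracket is a value of the module form up to the sign of that coordinate, so the
  scaling \<open>k\<close> contains the signs of source and target. Both the permutation and the
  scaling occur in later uses.\<close>

lemma lie_isomorphicI:
  assumes adm: "admissible r s M" and adm': "admissible r' s' M'"
    and A: "lin_on (module_space M) A" "bij_betw A (module_space M) (module_space M')"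
    and t: "bij_betw t {..<r + s} {..<r' + s'}"
    and c: "\<And>i. i < r + s \<Longrightarrow> c i \<noteq> 0"
    and eq: "\<And>i x y. i < r + s \<Longrightarrow> x \<in> module_space M \<Longrightarrow> y \<in> module_space M \<Longrightarrow>
       module_form M' (act M' (pm_unit (t i)) (A x)) (A y) = c i * module_form M (act M (pm_unit i) x) y"
  shows "lie_isomorphic (pseudo_H_algebra r s M) (pseudo_H_algebra r' s' M')"
proof -
  define k where "k i = sig_sign r' (t i) * c i * sig_sign r i" for i
  have k0: "i < r + s \<Longrightarrow> k i \<noteq> 0" for i using c by (simp add: k_def)
  define C where "C v = (\<Sum>j<r' + s'. Poly_Mapping.single j
     (k (inv_into {..<r + s} t j) * Poly_Mapping.lookup v (inv_into {..<r + s} t j)))" for v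
  define D where "D w = (\<Sum>i<r + s. Poly_Mapping.single i (Poly_Mapping.lookup w (t i) / k i))" for w
  have it: "inv_into {..<r + s} t (t i) = i" if "i < r + s" for i
    using t that by (simp add: bij_betw_inv_into_left)
  have ti: "t (inv_into {..<r + s} t j) = j" "inv_into {..<r + s} t j < r + s" if "j < r' + s'" for j
    using t that bij_betw_inv_into_right[OF t, of j] bij_betw_apply[OF bij_betw_inv_into[OF t], of j] by auto
  have tb: "t i < r' + s'" if "i < r + s" for i using bij_betw_apply[OF t, of i] that by simp
  have C: "Poly_Mapping.lookup (C v) j = (if j < r' + s' then
     k (inv_into {..<r + s} t j) * Poly_Mapping.lookup v (inv_into {..<r + s} t j) else 0)" for v j
    by (simp add: C_def lookup_pm_sum)
  have D: "Poly_Mapping.lookup (D w) i = (if i < r + s then Poly_Mapping.lookup w (t i) / k i else 0)" for w i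
    by (simp add: D_def lookup_pm_sum)
  have Cmem: "C v \<in> Rrs r' s'" for v by (simp add: mem_Rrs C)
  have Dmem: "D v \<in> Rrs r s" for v by (simp add: mem_Rrs D)
  have bC: "bij_betw C (Rrs r s) (Rrs r' s')"
  proof (rule bij_betw_byWitness[of _ D])
    show "\<forall>v\<in>Rrs r s. D (C v) = v"
      using it tb k0 by (auto intro!: poly_mapping_eqI simp: C D mem_Rrs)
    show "\<forall>w\<in>Rrs r' s'. C (D w) = w"
      using ti k0 by (auto intro!: poly_mapping_eqI simp: C D mem_Rrs)
  qed (use Cmem Dmem in auto)
  have lC: "lin_on X C" for X unfolding lin_on_def
    by (auto intro!: poly_mapping_eqI simp: C lookup_add lookup_scaleR_pm distrib_left)
  define f where "f p = (A (fst p), C (snd p))" for p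
  have br: "C (module_bracket r s M x y) = module_bracket r' s' M' (A x) (A y)"
    if x: "x \<in> module_space M" and y: "y \<in> module_space M" for x y
  proof (rule poly_mapping_eqI)
    fix j
    have A': "A x \<in> module_space M'" "A y \<in> module_space M'" using bij_betw_apply[OF A(2)] x y by auto
    show "Poly_Mapping.lookup (C (module_bracket r s M x y)) j =
        Poly_Mapping.lookup (module_bracket r' s' M' (A x) (A y)) j"
    proof (cases "j < r' + s'")
      case True
      define i where "i = inv_into {..<r + s} t j"
      have i: "i < r + s" "t i = j" using ti[OF True] by (auto simp: i_def)
      show ?thesis
        using eq[OF i(1) x y] i True
        by (simp add: C i_def[symmetric] lookup_module_bracket[OF adm x y i(1)]
            lookup_module_bracket[OF adm' A' True] k_def mult.assoc)
    next
      case False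
      then show ?thesis using Cmem module_bracket_props(1)[OF adm' A'] by (simp add: mem_Rrs)
    qed
  qed
  have "bij_betw f (module_space M \<times> Rrs r s) (module_space M' \<times> Rrs r' s')"
    using bij_betw_map_prod[OF A(2) bC] unfolding f_def by (simp add: map_prod_def case_prod_beta')
  moreover have "lin_on (module_space M \<times> Rrs r s) f"
    using A(1) lC[of "Rrs r s"] by (auto simp: lin_on_def f_def)
  moreover have "A 0 = 0" using lin_on_zero[OF A(1) admD(2)[OF adm]] .
  ultimately show ?thesis
    unfolding lie_isomorphic_def pseudo_H_algebra_def
    using br by (intro exI[of _ f]) (auto simp: f_def)
qed

lemma lie_isomorphic_trans:
  assumes "lie_isomorphic G H" "lie_isomorphic H K"
  shows "lie_isomorphic G K"
proof -
  obtain f where f: "lin_on (lie_space G) f" "bij_betw f (lie_space G) (lie_space H)"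
      "\<And>x y. x \<in> lie_space G \<Longrightarrow> y \<in> lie_space G \<Longrightarrow> f (lie_bracket G x y) = lie_bracket H (f x) (f y)"
    using assms(1) unfolding lie_isomorphic_def by blast
  obtain g where g: "lin_on (lie_space H) g" "bij_betw g (lie_space H) (lie_space K)"
      "\<And>x y. x \<in> lie_space H \<Longrightarrow> y \<in> lie_space H \<Longrightarrow> g (lie_bracket H x y) = lie_bracket K (g x) (g y)"
    using assms(2) unfolding lie_isomorphic_def by blast
  have fH: "x \<in> lie_space G \<Longrightarrow> f x \<in> lie_space H" for x using bij_betw_apply[OF f(2)] .
  show ?thesis unfolding lie_isomorphic_def
  proof (intro exI[of _ "\<lambda>x. g (f x)"] conjI ballI)
    show "lin_on (lie_space G) (\<lambda>x. g (f x))" using lin_on_comp[OF f(1) _ g(1)] fH by blast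
    show "bij_betw (\<lambda>x. g (f x)) (lie_space G) (lie_space K)"
      using bij_betw_trans[OF f(2) g(2)] by (simp add: comp_def)
  qed (simp add: f(3) g(3) fH)
qed

section \<open>Transport of modules to another carrier type\<close>

lemma clifford_transfer:
  fixes U :: "'a::real_vector set" and f :: "'a \<Rightarrow> 'b::real_vector"
  assumes c: "clifford_family n e U J b" and f: "lin_on U f" "inj_on f U"
  shows "clifford_family n e (f ` U) (\<lambda>i y. f (J i (inv_into U f y))) (\<lambda>y y'. b (inv_into U f y) (inv_into U f y'))"
proof -
  note d = clifford_familyD[OF c]
  let ?g = "inv_into U f"
  have bij: "bij_betw f U (f ` U)" using f(2) by (simp add: bij_betw_def)
  have g: "lin_on (f ` U) ?g" by (rule lin_on_inv_into[OF f(1) d(2) bij])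
  have gf: "?g (f x) = x" if "x \<in> U" for x using f(2) that by simp
  have lin: "lin_on (f ` U) (\<lambda>y. h (?g y))" if "lin_on U h" for h :: "'a \<Rightarrow> 'z::real_vector"
    by (rule lin_on_comp[OF g _ that]) (auto simp: gf)
  show ?thesis unfolding clifford_family_def
  proof (intro conjI allI impI ballI)
    show "fin_space (f ` U)" by (rule lin_on_image_fin_space[OF f(1) d(1)])
    show "nondegenerate_symmetric_form (f ` U) (\<lambda>y y'. b (?g y) (?g y'))"
      unfolding nondegenerate_symmetric_form_def
    proof (intro conjI ballI impI)
      fix x assume x: "x \<in> f ` U"
      then show "lin_on (f ` U) (\<lambda>y'. b (?g x) (?g y'))"
        using lin[OF nondeg_lin[OF d(3)]] by (auto simp: gf)
      assume "\<forall>y\<in>f ` U. b (?g x) (?g y) = 0"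
      then have "?g x = 0" using x by (intro nondeg_nondeg[OF d(3)]) (auto simp: gf)
      then show "x = 0" using x by (auto simp: gf lin_on_zero[OF f(1) d(2)])
    qed (auto simp: gf nondeg_sym[OF d(3)])
  next
    fix i assume i: "i < n"
    show "lin_on (f ` U) (\<lambda>y. f (J i (?g y)))"
      by (rule lin[OF lin_on_comp[OF d(4)[OF i] _ f(1)]]) (use d(5)[OF i] in auto)
    show "(\<lambda>y. f (J i (?g y))) ` f ` U \<subseteq> f ` U" using gf d(5)[OF i] by auto
    { fix x assume "x \<in> f ` U"
      then obtain u where u: "u \<in> U" "x = f u" by blast
      show "f (J i (?g (f (J i (?g x))))) = - e i *\<^sub>R x"
        using u lin_on_scale[OF f(1) u(1), of "- e i"] by (simp add: gf d(5,6) i)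
      { fix y assume "y \<in> f ` U"
        then obtain v where v: "v \<in> U" "y = f v" by blast
        show "b (?g (f (J i (?g x)))) (?g y) = - b (?g x) (?g (f (J i (?g y))))"
          using u v by (simp add: gf d(5,7) i) }
      fix j assume j: "j < n" and ij: "i \<noteq> j"
      show "f (J i (?g (f (J j (?g x))))) = - f (J j (?g (f (J i (?g x)))))"
        using u lin_on_minus[OF f(1) d(5)[OF j d(5)[OF i u(1)]]] by (simp add: gf d(5) d(8)[OF i j ij] i j) }
  qed
qed

lemma scaleR_single: "c *\<^sub>R (Poly_Mapping.single i a :: nat \<Rightarrow>\<^sub>0 real) = Poly_Mapping.single i (c * a)"
  by (rule poly_mapping_eqI) (simp add: lookup_scaleR_pm lookup_single when_def)

lemma finite_coordinates:
  fixes U :: "'a::real_vector set"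
  assumes "fin_space U"
  obtains f :: "'a \<Rightarrow> (nat \<Rightarrow>\<^sub>0 real)" where "lin_on U f" "inj_on f U"
proof -
  obtain B where B: "finite B" "independent B" "U = span B"
    using fin_space_basis[OF assms] by metis
  obtain h :: "'a \<Rightarrow> nat" where h: "inj_on h B" using finite_imp_inj_to_nat_seg[OF B(1)] by blast
  define f where "f x = (\<Sum>b\<in>B. Poly_Mapping.single (h b) (representation B x b))" for x
  have look: "Poly_Mapping.lookup (f x) (h b) = representation B x b" if "b \<in> B" for x b
  proof -
    have "Poly_Mapping.lookup (f x) (h b) = (\<Sum>b'\<in>B. if b' = b then representation B x b else 0)"
      unfolding f_def lookup_sum using h that
      by (intro sum.cong) (auto simp: lookup_single when_def inj_on_eq_iff)
    then show ?thesis using that B(1) by simp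
  qed
  have "lin_on U f" unfolding lin_on_def
    by (simp add: B(3) f_def representation_add[OF B(2)] representation_scale[OF B(2)] single_add sum.distrib
        scaleR_sum_right scaleR_single)
  moreover have "inj_on f U"
  proof (rule lin_on_inj[OF \<open>lin_on U f\<close> fin_space_subspace[OF assms]])
    fix x assume "x \<in> U" "f x = 0"
    then have "representation B x b = 0" if "b \<in> B" for b using look[OF that, of x] by simp
    then have "(\<Sum>b\<in>B. representation B x b *\<^sub>R b) = 0" by (simp add: sum.neutral)
    then show "x = 0" using sum_representation_eq[OF B(2) _ B(1), of x] \<open>x \<in> U\<close> B(3) by simp
  qed
  ultimately show thesis using that by blast
qed

text \<open>Minimality compares only with modules carried by
  \<open>nat \<Rightarrow>\<^sub>0 real\<close>. Coordinates with respect to a basis bring any other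
  competitor there.\<close>

lemma admissible_transfer:
  assumes adm: "admissible r s (M :: 'a::real_vector clifford_module)"
  obtains M' :: "(nat \<Rightarrow>\<^sub>0 real) clifford_module" where "admissible r s M'"
    "dim (module_space M') = dim (module_space M)"
    "module_space M' = {0} \<longleftrightarrow> module_space M = {0}"
proof -
  note c = clifford_standard[OF adm]
  note d = clifford_familyD[OF c]
  let ?U = "module_space M"
  obtain f :: "'a \<Rightarrow> (nat \<Rightarrow>\<^sub>0 real)" where f: "lin_on ?U f" "inj_on f ?U"
    using finite_coordinates[OF d(1)] by blast
  define M' where "M' = fam_mod (r + s) (f ` ?U) (\<lambda>i y. f (act M (pm_unit i) (inv_into ?U f y)))
     (\<lambda>y y'. module_form M (inv_into ?U f y) (inv_into ?U f y'))"
  have adm': "admissible r s M'"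
    unfolding M'_def by (rule admissible_fam_mod[OF clifford_transfer[OF c f]])
  have "dim (f ` ?U) = dim ?U" by (rule lin_on_inj_dim[OF f(1) d(1) f(2)])
  moreover have "f ` ?U = {0} \<longleftrightarrow> ?U = {0}"
  proof
    have f0: "f 0 = 0" and 0: "0 \<in> ?U" using lin_on_zero[OF f(1) d(2)] subspace_0[OF d(2)] by auto
    show "f ` ?U = {0} \<Longrightarrow> ?U = {0}" 
      using f0 0 inj_onD[OF f(2), of _ 0] by (metis image_eqI singletonD singletonI subset_antisym subsetI)
    show "?U = {0} \<Longrightarrow> f ` ?U = {0}" using f0 by simp
  qed
  ultimately show thesis using that[OF adm'] by (simp add: M'_def)
qed

lemma minimal_dim_le:
  assumes "minimal_admissible r s M" "admissible r s M'" "module_space M' \<noteq> {0}"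
  shows "dim (module_space M) \<le> dim (module_space M')"
  using admissible_transfer[OF assms(2)] assms(1,3) unfolding minimal_admissible_def by metis

text \<open>The form of minimality that is used: only subspaces on which \<open>b\<close> stays
  nondegenerate are excluded, since a degenerate invariant subspace is not an admissible
  module.\<close>

definition irreducible_family :: "nat \<Rightarrow> 'u::real_vector set \<Rightarrow> (nat \<Rightarrow> 'u \<Rightarrow> 'u) \<Rightarrow> ('u \<Rightarrow> 'u \<Rightarrow> real) \<Rightarrow> bool" where
  "irreducible_family n U J b \<longleftrightarrow> (\<forall>E. subspace E \<and> E \<subseteq> U \<and> E \<noteq> {0} \<and> (\<forall>i<n. J i ` E \<subseteq> E) \<and>
      (\<forall>x\<in>E. (\<forall>y\<in>E. b x y = 0) \<longrightarrow> x = 0) \<longrightarrow> E = U)"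

lemma irreducible_familyD:
  assumes "irreducible_family n U J b" "subspace E" "E \<subseteq> U" "E \<noteq> {0}" "\<And>i x. i < n \<Longrightarrow> x \<in> E \<Longrightarrow> J i x \<in> E"
    "\<And>x. x \<in> E \<Longrightarrow> (\<And>y. y \<in> E \<Longrightarrow> b x y = 0) \<Longrightarrow> x = 0"
  shows "E = U"
  using assms(1)[unfolded irreducible_family_def, rule_format, of E] assms(2-) by blast

text \<open>The map \<open>t\<close> selects and reorders generators. It is the identity for
  invariant subspaces, a selection when the signature shrinks, and a permutation when the positive
  and negative coordinates change places.\<close>

lemma clifford_restrict:
  assumes c: "clifford_family n e U J b" and E: "subspace E" "E \<subseteq> U"
    and t: "\<And>i. i < m \<Longrightarrow> t i < n" "inj_on t {..<m}" "\<And>i. i < m \<Longrightarrow> e' i = e (t i)"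
    and inv: "\<And>i x. i < m \<Longrightarrow> x \<in> E \<Longrightarrow> J (t i) x \<in> E"
    and nd: "\<And>x. x \<in> E \<Longrightarrow> (\<And>y. y \<in> E \<Longrightarrow> b x y = 0) \<Longrightarrow> x = 0"
  shows "clifford_family m e' E (\<lambda>i. J (t i)) b"
proof -
  note d = clifford_familyD[OF c]
  have mem: "x \<in> E \<Longrightarrow> x \<in> U" for x using E(2) by auto
  have nsf: "nondegenerate_symmetric_form E b"
    unfolding nondegenerate_symmetric_form_def
  proof (intro conjI ballI impI)
    fix x assume x: "x \<in> E"
    show "lin_on E (b x)" by (rule lin_on_subset[OF nondeg_lin[OF d(3) mem[OF x]] E(2)])
    show "x = 0" if "\<forall>y\<in>E. b x y = 0" using nd[OF x] that by blast
  qed (simp add: nondeg_sym[OF d(3)] mem)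
  have ne: "t i \<noteq> t j" if "i < m" "j < m" "i \<noteq> j" for i j
    using t(2) that by (auto simp: inj_on_def)
  show ?thesis unfolding clifford_family_def
  proof (intro conjI allI impI ballI)
    show "fin_space E" by (rule fin_space_subset(1)[OF d(1) E])
    fix i assume i: "i < m"
    show "lin_on E (J (t i))" by (rule lin_on_subset[OF d(4)[OF t(1)[OF i]] E(2)])
    show "J (t i) ` E \<subseteq> E" using inv[OF i] by blast
    { fix x assume x: "x \<in> E"
      show "J (t i) (J (t i) x) = - e' i *\<^sub>R x" using d(6)[OF t(1)[OF i] mem[OF x]] t(3)[OF i] by simp
      { fix y assume y: "y \<in> E"
        show "b (J (t i) x) y = - b x (J (t i) y)" by (rule d(7)[OF t(1)[OF i] mem[OF x] mem[OF y]]) }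
      fix j assume j: "j < m" and ij: "i \<noteq> j"
      show "J (t i) (J (t j) x) = - J (t j) (J (t i) x)"
        by (rule d(8)[OF t(1)[OF i] t(1)[OF j] ne[OF i j ij] mem[OF x]]) }
  qed (rule nsf)
qed

lemma minimal_irr:
  assumes "minimal_admissible r s M"
  shows "irreducible_family (r + s) (module_space M) (\<lambda>i. act M (pm_unit i)) (module_form M)"
  unfolding irreducible_family_def
proof (intro allI impI, elim conjE)
  fix E assume E: "subspace E" "E \<subseteq> module_space M" "E \<noteq> {0}"
    "\<forall>i<r + s. act M (pm_unit i) ` E \<subseteq> E"
    "\<forall>x\<in>E. (\<forall>y\<in>E. module_form M x y = 0) \<longrightarrow> x = 0"
  have adm: "admissible r s M" using assms unfolding minimal_admissible_def by blast
  have "clifford_family (r + s) (sig_sign r) E (\<lambda>i. act M (pm_unit i)) (module_form M)"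
    by (rule clifford_restrict[OF clifford_standard[OF adm] E(1,2), of "r + s" "\<lambda>i. i"])
       (use E(4,5) in \<open>auto simp: inj_on_def\<close>)
  from minimal_dim_le[OF assms admissible_fam_mod[OF this]] E(3)
  have "dim (module_space M) \<le> dim E" by simp
  then show "E = module_space M" using fin_space_subset(3)[OF admD(1)[OF adm] E(1,2)] by blast
qed

section \<open>Self-adjoint operators\<close>

text \<open>The polynomial \<open>q\<close> evaluated at the operator \<open>S\<close> and applied
  to \<open>u\<close>, by Horner's rule.\<close>

definition poly_op :: "('a::real_vector \<Rightarrow> 'a) \<Rightarrow> real poly \<Rightarrow> 'a \<Rightarrow> 'a" where
  "poly_op S q u = fold_coeffs (\<lambda>a v. a *\<^sub>R u + S v) q 0"

lemma poly_op_0 [simp]: "poly_op S 0 u = 0"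
  by (simp add: poly_op_def)

context
  fixes S :: "'a::real_vector \<Rightarrow> 'a"
  assumes S: "linear S"
begin

lemma poly_op_pCons [simp]: "poly_op S (pCons a q) u = a *\<^sub>R u + S (poly_op S q u)"
  by (cases "q = 0 \<and> a = 0") (auto simp: poly_op_def linear_0[OF S])

lemma poly_op_zero: "poly_op S q 0 = 0"
  by (induction q) (simp_all add: linear_0[OF S])

lemma poly_op_add: "poly_op S (p + q) u = poly_op S p u + poly_op S q u"
proof (induction p q rule: poly_induct2)
  case (pCons a p b q)
  then show ?case by (simp add: linear_add[OF S] scaleR_left_distrib)
qed simp

lemma poly_op_smult: "poly_op S (smult c q) u = c *\<^sub>R poly_op S q u"
  by (induction q) (simp_all add: linear_scale[OF S] scaleR_add_right)

lemma poly_op_mult: "poly_op S (p * q) u = poly_op S p (poly_op S q u)"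
  by (induction p) (simp_all add: poly_op_add poly_op_smult)

lemma poly_op_monom: "poly_op S (monom 1 k) u = (S ^^ k) u"
  by (induction k) (simp_all add: monom_Suc monom_0 linear_0[OF S])

lemma poly_op_mem: "subspace U \<Longrightarrow> S ` U \<subseteq> U \<Longrightarrow> u \<in> U \<Longrightarrow> poly_op S q u \<in> U"
  by (induction q) (auto simp: subspace_0 subspace_add subspace_scale)

text \<open>The iterates of \<open>S\<close> on \<open>u\<close> cannot remain independent beyond
  \<open>dim U\<close> many, so some iterate lies in the span of the earlier ones.\<close>

lemma annihilating_poly:
  assumes U: "fin_space U" "S ` U \<subseteq> U" and u: "u \<in> U"
  obtains q where "q \<noteq> 0" "poly_op S q u = 0"
proof -
  define f where "f k = (S ^^ k) u" for k
  have fU: "f k \<in> U" for k unfolding f_def by (induction k) (use U(2) u in auto)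
  have "\<exists>k. f k \<in> span (f ` {..<k})"
  proof (rule ccontr)
    assume no: "\<not> ?thesis"
    have "independent (f ` {..<k}) \<and> card (f ` {..<k}) = k" for k
    proof (induction k)
      case (Suc k)
      have nin: "f k \<notin> span (f ` {..<k})" using no by blast
      then have "f k \<notin> f ` {..<k}" using span_base[of "f k" "f ` {..<k}"] by argo
      with nin Suc show ?case by (simp add: lessThan_Suc independent_insertI)
    qed (simp add: independent_empty)
    then show False
      using independent_in_fin_space[OF U(1), of "f ` {..<Suc (dim U)}"] fU by force
  qed
  then obtain k where k: "f k \<in> span (f ` {..<k})" by blast
  \<comment> \<open>Values at \<open>u\<close> of polynomials of degree below \<open>k\<close>.
    Membership of \<open>f k\<close> turns the linear dependence into the monic polynomial
    \<open>r\<close> of degree \<open>k\<close>.\<close>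
  define W where "W = {poly_op S q u |q. \<forall>j\<ge>k. coeff q j = 0}"
  have "subspace W"
  proof (rule subspaceI)
    show "0 \<in> W" unfolding W_def by (auto intro!: exI[of _ 0])
  next
    fix x y assume "x \<in> W" "y \<in> W"
    then obtain p q where "x = poly_op S p u" "y = poly_op S q u" "\<forall>j\<ge>k. coeff p j = 0" "\<forall>j\<ge>k. coeff q j = 0"
      unfolding W_def by blast
    then show "x + y \<in> W" unfolding W_def by (auto intro!: exI[of _ "p + q"] simp: poly_op_add)
  next
    fix c x assume "x \<in> W"
    then obtain p where "x = poly_op S p u" "\<forall>j\<ge>k. coeff p j = 0" unfolding W_def by blast
    then show "c *\<^sub>R x \<in> W" unfolding W_def by (auto intro!: exI[of _ "smult c p"] simp: poly_op_smult)
  qed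
  moreover have "f ` {..<k} \<subseteq> W"
    unfolding W_def f_def by (auto intro!: exI[of _ "monom 1 _"] simp: poly_op_monom)
  ultimately have "f k \<in> W" using k span_minimal by blast
  then obtain q where q: "f k = poly_op S q u" "\<forall>j\<ge>k. coeff q j = 0" unfolding W_def by blast
  define r where "r = monom 1 k + smult (- 1) q"
  have "coeff r k = 1" using q(2) by (simp add: r_def)
  then have "r \<noteq> 0" by auto
  moreover have "poly_op S r u = 0"
    unfolding r_def poly_op_add poly_op_smult poly_op_monom using q(1) by (simp add: f_def)
  ultimately show thesis using that by blast
qed

end

text \<open>The factor is the minimal polynomial over the reals of some complex root of
  \<open>q\<close>.\<close>

lemma real_poly_factor:
  assumes "degree (q :: real poly) > 0"
  obtains (lin) a where "[:- a, 1:] dvd q"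
  | (quad) a b where "b \<noteq> 0" "[:a\<^sup>2 + b\<^sup>2, - 2 * a, 1:] dvd q"
proof -
  let ?c = "map_poly complex_of_real"
  have "\<not> constant (poly (?c q))"
    using assms constant_degree[of "?c q"] by (simp add: degree_map_poly)
  then obtain z where z: "poly (?c q) z = 0" using fundamental_theorem_of_algebra by blast
  \<comment> \<open>Evaluation at \<open>z\<close> becomes \<open>poly_op\<close> of the
    multiplication by \<open>z\<close> on the complex numbers as a real vector space, so the rules
    for products apply to the division by \<open>f\<close> below.\<close>
  have lin: "linear ((*) z)" by (simp add: linear_times)
  have ev: "poly_op ((*) z) p 1 = poly (?c p) z" for p
    by (induction p) (simp_all add: poly_op_pCons[OF lin] map_poly_pCons scaleR_conv_of_real)
  show thesis
  proof (cases "Im z = 0")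
    case True
    then have "z = complex_of_real (Re z)" by (simp add: complex_eq_iff)
    moreover have "poly (?c p) (complex_of_real x) = complex_of_real (poly p x)" for p x
      by (induction p) (simp_all add: map_poly_pCons)
    ultimately have "poly q (Re z) = 0" using z by (metis of_real_eq_0_iff)
    then show thesis using that(1) by (simp add: poly_eq_0_iff_dvd)
  next
    case False
    define f where "f = [:(Re z)\<^sup>2 + (Im z)\<^sup>2, - 2 * Re z, 1:]"
    have deg: "degree f = 2" by (simp add: f_def)
    have fz: "poly_op ((*) z) f 1 = 0"
      by (simp add: f_def poly_op_pCons[OF lin] complex_eq_iff power2_eq_square algebra_simps)
    have "q = (q div f) * f + q mod f" by simp
    then have "poly_op ((*) z) q 1 = poly_op ((*) z) (q mod f) 1"
      by (metis add_0 fz lin linear_0 poly_op_add poly_op_mult poly_op_zero)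
    then have r0: "poly_op ((*) z) (q mod f) 1 = 0" using ev z by simp
    have "degree (q mod f) < 2"
      using degree_mod_less[of f q] deg by (cases "q mod f = 0") (auto simp: f_def)
    then have "q mod f = [:coeff (q mod f) 0, coeff (q mod f) 1:]"
      by (intro poly_eqI) (auto simp: coeff_pCons coeff_eq_0 split: nat.splits)
    then obtain c d where r: "q mod f = [:c, d:]" by blast
    then have "complex_of_real c + z * complex_of_real d = 0"
      using r0 by (simp add: poly_op_pCons[OF lin] scaleR_conv_of_real)
    then have "d = 0 \<and> c = 0" using False by (auto simp: complex_eq_iff)
    then have "f dvd q" using r by (simp add: mod_eq_0_iff_dvd)
    then show thesis using that(2)[of "Im z" "Re z"] False unfolding f_def by blast
  qed
qed

text \<open>Take an annihilating polynomial \<open>q\<close> of a vector with least degree. Every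
  nonconstant factor of \<open>q\<close> then kills a nonzero vector, namely the value of the
  cofactor. A linear factor gives an eigenvector, and a quadratic one contradicts
  positivity.\<close>

lemma self_adjoint_eigenvector:
  assumes p: "inner_on U p" and U: "fin_space U" "U \<noteq> {0}"
    and S: "lin_on U S" "S ` U \<subseteq> U"
    and sa: "\<And>x y. x \<in> U \<Longrightarrow> y \<in> U \<Longrightarrow> p (S x) y = p x (S y)"
  obtains c x where "x \<in> U" "x \<noteq> 0" "S x = c *\<^sub>R x"
proof -
  have sub: "subspace U" by (rule fin_space_subspace[OF U(1)])
  obtain u where u: "u \<in> U" "u \<noteq> 0" using U(2) subspace_0[OF sub] by auto
  obtain g where g: "linear g" "\<And>x. x \<in> U \<Longrightarrow> g x = S x" using lin_on_extend[OF S(1) U(1)] by metis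
  have gU: "g ` U \<subseteq> U" using g(2) S(2) by auto
  define P where "P q \<longleftrightarrow> q \<noteq> 0 \<and> poly_op g q u = 0" for q
  have "\<exists>q. P q" using annihilating_poly[OF g(1) U(1) gU u(1)] unfolding P_def by metis
  then obtain q where q: "P q" "\<And>q'. P q' \<Longrightarrow> degree q \<le> degree q'"
    using ex_has_least_nat[of P _ degree] by blast
  have "degree q > 0"
  proof (rule ccontr)
    assume "\<not> ?thesis"
    then obtain a where "q = [:a:]" using degree_eq_zeroE by blast
    then show False using q(1) u(2) by (auto simp: P_def poly_op_pCons[OF g(1)] linear_0[OF g(1)])
  qed
  have split: "\<exists>v\<in>U. v \<noteq> 0 \<and> poly_op g f v = 0" if f: "f dvd q" "degree f > 0" for f
  proof -
    obtain h where h: "q = f * h" using f(1) by blast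
    have "h \<noteq> 0" "f \<noteq> 0" using h q(1) by (auto simp: P_def)
    then have "degree h < degree q" using h f(2) by (simp add: degree_mult_eq)
    then have "poly_op g h u \<noteq> 0" using q(2)[of h] \<open>h \<noteq> 0\<close> by (auto simp: P_def)
    moreover have "poly_op g f (poly_op g h u) = 0"
      using q(1) h by (simp add: P_def poly_op_mult[OF g(1)])
    ultimately show ?thesis using poly_op_mem[OF g(1) sub gU u(1)] by blast
  qed
  from \<open>degree q > 0\<close> show thesis
  proof (cases rule: real_poly_factor)
    case (lin a)
    then obtain v where v: "v \<in> U" "v \<noteq> 0" "poly_op g [:- a, 1:] v = 0" using split[of "[:- a, 1:]"] by auto
    then have "S v = a *\<^sub>R v" using g(2)[OF v(1)] by (simp add: poly_op_pCons[OF g(1)] linear_0[OF g(1)])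
    then show thesis using that v by blast
  next
    case (quad a b)
    then obtain v where v: "v \<in> U" "v \<noteq> 0" "poly_op g [:a\<^sup>2 + b\<^sup>2, - 2 * a, 1:] v = 0"
      using split[of "[:a\<^sup>2 + b\<^sup>2, - 2 * a, 1:]"] by auto
    \<comment> \<open>With w = (S - a) v the quadratic factor says (S - a) w = - b^2 v.
      Self-adjointness then turns \<open>p w w\<close> into - b^2 times \<open>p v v\<close>, which
      is negative.\<close>
    define w where "w = g v - a *\<^sub>R v"
    have gv: "g v \<in> U" using gU v(1) by blast
    have w: "w \<in> U" using gv v(1) by (simp add: w_def subspace_diff[OF sub] subspace_scale[OF sub])
    have gw: "g w \<in> U" using gU w by blast
    have "(2 * a) *\<^sub>R g v = a *\<^sub>R g v + a *\<^sub>R g v"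
      by (simp add: scaleR_left_distrib[symmetric])
    then have e: "g w - a *\<^sub>R w = - (b\<^sup>2) *\<^sub>R v"
      using v(3) by (simp add: w_def poly_op_pCons[OF g(1)] linear_0[OF g(1)] linear_diff[OF g(1)]
          linear_add[OF g(1)] linear_scale[OF g(1)] linear_neg[OF g(1)] algebra_simps power2_eq_square)
    have lv: "lin_on U (p v)" by (rule inner_on_lin[OF p v(1)])
    have "p w w = p (g v) w - a * p v w"
      using lin_on_diff[OF inner_on_lin2[OF p sub w] sub gv subspace_scale[OF sub v(1), of a]]
        lin_on_scale[OF inner_on_lin2[OF p sub w] v(1), of a] by (simp add: w_def)
    also have "\<dots> = p v (g w) - a * p v w" using sa[OF v(1) w] g(2) v(1) w by simp
    also have "\<dots> = p v (g w - a *\<^sub>R w)"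
      using lin_on_diff[OF lv sub gw subspace_scale[OF sub w, of a]] lin_on_scale[OF lv w, of a] by simp
    also have "\<dots> = - (b\<^sup>2 * p v v)" unfolding e using lin_on_scale[OF lv v(1), of "- (b\<^sup>2)"] by simp
    also have "\<dots> < 0" using quad(1) inner_on_pos[OF p v(1,2)] by simp
    finally have "p w w < 0" .
    moreover have "p w w \<ge> 0"
      using inner_on_pos[OF p w] lin_on_zero[OF inner_on_lin[OF p w] sub] by (cases "w = 0") auto
    ultimately show thesis by simp
  qed
qed

section \<open>Invariant inner products and Schur's lemma\<close>

definition sign_family :: "nat \<Rightarrow> (nat \<Rightarrow> real) \<Rightarrow> bool" where
  "sign_family n e \<longleftrightarrow> (\<forall>i<n. e i = 1 \<or> e i = - 1)"

lemma sign_familyD: "sign_family n e \<Longrightarrow> i < n \<Longrightarrow> e i * e i = 1"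
  by (auto simp: sign_family_def)

lemma sign_family_sig [simp]: "sign_family n (sig_sign r)"
  by (simp add: sign_family_def sig_sign_def)

lemma inner_on_neg:
  assumes "inner_on U p" "subspace U" "x \<in> U" "y \<in> U"
  shows "p (- x) y = - p x y" "p x (- y) = - p x y"
  using lin_on_minus[OF inner_on_lin2[OF assms(1,2,4)] assms(3)]
    lin_on_minus[OF inner_on_lin[OF assms(1,3)] assms(4)] by auto

lemma inner_on_scale:
  assumes "inner_on U p" "subspace U" "x \<in> U" "y \<in> U"
  shows "p (c *\<^sub>R x) y = c * p x y" "p x (c *\<^sub>R y) = c * p x y"
  using lin_on_scale[OF inner_on_lin2[OF assms(1,2,4)] assms(3)]
    lin_on_scale[OF inner_on_lin[OF assms(1,3)] assms(4)] by auto

text \<open>Averaging over one generator at a time suffices, since the generators commute up to sign.\<close>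

lemma invariant_inner:
  assumes c: "clifford_family n e U J b" and e: "sign_family n e"
  obtains p where "inner_on U p" "\<And>i x y. i < n \<Longrightarrow> x \<in> U \<Longrightarrow> y \<in> U \<Longrightarrow> p (J i x) (J i y) = p x y"
proof -
  note d = clifford_familyD[OF c]
  have "m \<le> n \<Longrightarrow> \<exists>p. inner_on U p \<and> (\<forall>i<m. \<forall>x\<in>U. \<forall>y\<in>U. p (J i x) (J i y) = p x y)" for m
  proof (induction m)
    case 0
    then show ?case using inner_on_exists[OF d(1)] by blast
  next
    case (Suc m)
    then obtain p where p: "inner_on U p" "\<forall>i<m. \<forall>x\<in>U. \<forall>y\<in>U. p (J i x) (J i y) = p x y" by auto
    have m: "m < n" using Suc by simp
    \<comment> \<open>The average has two terms because \<open>J m\<close> squares to plus or minus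
      the identity.\<close>
    define q where "q x y = p x y + p (J m x) (J m y)" for x y
    have "inner_on U q" unfolding inner_on_def
    proof (intro conjI ballI impI)
      fix x assume x: "x \<in> U"
      show "lin_on U (q x)"
        unfolding q_def using d(5)[OF m]
        by (intro lin_on_plus inner_on_lin[OF p(1) x]
            lin_on_comp[OF d(4)[OF m] _ inner_on_lin[OF p(1) d(5)[OF m x]]]) auto
      show "q x y = q y x" if "y \<in> U" for y
        using inner_on_sym[OF p(1)] x that d(5)[OF m] by (simp add: q_def)
      assume "x \<noteq> 0"
      then show "q x x > 0"
        using inner_on_pos[OF p(1) x] inner_on_pos[OF p(1) d(5)[OF m x]]
          lin_on_zero[OF inner_on_lin[OF p(1) subspace_0[OF d(2)]] d(2)]
        by (cases "J m x = 0") (auto simp: q_def)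
    qed
    moreover have "q (J i x) (J i y) = q x y" if i: "i < Suc m" and x: "x \<in> U" and y: "y \<in> U" for i x y
    proof (cases "i = m")
      case True
      have "p (- e m *\<^sub>R x) (- e m *\<^sub>R y) = (e m * e m) * p x y"
        by (subst inner_on_scale[OF p(1) d(2)] | (simp add: x y subspace_scale[OF d(2)] subspace_neg[OF d(2)]; fail))+
      then show ?thesis using True d(6)[OF m] x y sign_familyD[OF e m] by (simp add: q_def)
    next
      case False
      then have i: "i < m" "i < n" using i m by auto
      have ne: "m \<noteq> i" using i by simp
      have "p (J m (J i x)) (J m (J i y)) = p (J i (J m x)) (J i (J m y))"
        using d(8)[OF m i(2) ne] x y inner_on_neg[OF p(1) d(2)] d(5)[OF i(2)] d(5)[OF m]
          subspace_neg[OF d(2)] by simp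
      also have "\<dots> = p (J m x) (J m y)" using p(2) i(1) d(5)[OF m] x y by blast
      finally show ?thesis using p(2) i(1) x y by (simp add: q_def)
    qed
    ultimately show ?case by blast
  qed
  from this[of n] show thesis using that by auto
qed

text \<open>An eigenspace of \<open>S\<close> is stable under the generators and under
  \<open>G\<close>. It is nondegenerate, since pairing \<open>x\<close> with \<open>G x\<close>
  under \<open>b\<close> gives \<open>p (G x) (G x)\<close>; so it is everything.\<close>

lemma schur:
  assumes c: "clifford_family n e U J b" and U: "U \<noteq> {0}" and irr: "irreducible_family n U J b" and p: "inner_on U p"
    and G: "\<And>x. x \<in> U \<Longrightarrow> G x \<in> U" "\<And>x y. x \<in> U \<Longrightarrow> y \<in> U \<Longrightarrow> b x y = p (G x) y"
    and S: "lin_on U S" "\<And>x. x \<in> U \<Longrightarrow> S x \<in> U" "\<And>x y. x \<in> U \<Longrightarrow> y \<in> U \<Longrightarrow> p (S x) y = p x (S y)"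
    and SJ: "\<And>i x. i < n \<Longrightarrow> x \<in> U \<Longrightarrow> S (J i x) = J i (S x)" and SG: "\<And>x. x \<in> U \<Longrightarrow> S (G x) = G (S x)"
    and lG: "lin_on U G"
  obtains c where "\<And>x. x \<in> U \<Longrightarrow> S x = c *\<^sub>R x"
proof -
  note d = clifford_familyD[OF c]
  obtain c x where cx: "x \<in> U" "x \<noteq> 0" "S x = c *\<^sub>R x"
    by (rule self_adjoint_eigenvector[OF p d(1) U S(1) _ S(3)]) (use S(2) in auto)
  define E where "E = {x \<in> U. S x = c *\<^sub>R x}"
  have "E = U"
  proof (rule irreducible_familyD[OF irr])
    show "subspace E" unfolding E_def
      by (rule subspaceI) (simp_all add: subspace_0[OF d(2)] subspace_add[OF d(2)] subspace_scale[OF d(2)]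
          lin_on_add[OF S(1)] lin_on_scale[OF S(1)] lin_on_zero[OF S(1) d(2)] scaleR_add_right mult.commute)
    show "E \<subseteq> U" "E \<noteq> {0}" using cx by (auto simp: E_def)
    fix x assume x: "x \<in> E"
    then have xU: "x \<in> U" by (simp add: E_def)
    show "J i x \<in> E" if "i < n" for i
      using x that d(5)[OF that xU] by (auto simp: E_def SJ lin_on_scale[OF d(4)[OF that]])
    assume 0: "\<And>y. y \<in> E \<Longrightarrow> b x y = 0"
    have "G x \<in> E" using x G(1) by (auto simp: E_def SG lin_on_scale[OF lG])
    then have "p (G x) (G x) = 0" using 0 G(2)[OF xU G(1)[OF xU]] by simp
    then have "G x = 0" using inner_on_pos[OF p G(1)[OF xU]] by fastforce
    then show "x = 0"
      using nondeg_nondeg[OF d(3) xU] G(2)[OF xU] lin_on_zero[OF inner_on_lin2[OF p d(2)] d(2)] by simp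
  qed
  then show thesis using that[of c] unfolding E_def by blast
qed

text \<open>The sign in the rule for \<open>G (J i x)\<close> comes from two adjoints of
  \<open>J i\<close>: with respect to \<open>b\<close> it is \<open>- J i\<close>, and with respect
  to \<open>p\<close> it is the inverse, which is \<open>- e i\<close> times
  \<open>J i\<close>.\<close>

definition normal_form ::
  "nat \<Rightarrow> (nat \<Rightarrow> real) \<Rightarrow> 'u::real_vector set \<Rightarrow> (nat \<Rightarrow> 'u \<Rightarrow> 'u) \<Rightarrow> ('u \<Rightarrow> 'u \<Rightarrow> real) \<Rightarrow>
    ('u \<Rightarrow> 'u \<Rightarrow> real) \<Rightarrow> ('u \<Rightarrow> 'u) \<Rightarrow> bool" where
  "normal_form n e U J b p G \<longleftrightarrow> inner_on U p \<and> lin_on U G \<and>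
     (\<forall>i<n. \<forall>x\<in>U. \<forall>y\<in>U. p (J i x) (J i y) = p x y) \<and>
     (\<forall>i<n. \<forall>x\<in>U. G (J i x) = e i *\<^sub>R J i (G x)) \<and>
     (\<forall>x\<in>U. G x \<in> U \<and> G (G x) = x) \<and>
     (\<forall>x\<in>U. \<forall>y\<in>U. p (G x) (G y) = p x y \<and> b x y = p (G x) y)"

lemma normal_formD:
  assumes "normal_form n e U J b p G"
  shows "inner_on U p" "lin_on U G"
    "\<And>i x y. i < n \<Longrightarrow> x \<in> U \<Longrightarrow> y \<in> U \<Longrightarrow> p (J i x) (J i y) = p x y"
    "\<And>i x. i < n \<Longrightarrow> x \<in> U \<Longrightarrow> G (J i x) = e i *\<^sub>R J i (G x)"
    "\<And>x. x \<in> U \<Longrightarrow> G x \<in> U" "\<And>x. x \<in> U \<Longrightarrow> G (G x) = x"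
    "\<And>x y. x \<in> U \<Longrightarrow> y \<in> U \<Longrightarrow> p (G x) (G y) = p x y"
    "\<And>x y. x \<in> U \<Longrightarrow> y \<in> U \<Longrightarrow> b x y = p (G x) y"
  using assms unfolding normal_form_def by blast+

text \<open>\<open>G\<close> commutes with the generators up to signs, so its square commutes with
  them exactly and is a scalar \<open>a\<close> by Schur's lemma. Since \<open>G\<close> is
  symmetric and injective, \<open>a\<close> is positive.\<close>

lemma normal_form_exists:
  assumes c: "clifford_family n e U J b" and U: "U \<noteq> {0}" and irr: "irreducible_family n U J b" and e: "sign_family n e"
  obtains p G where "normal_form n e U J b p G"
proof -
  note d = clifford_familyD[OF c]
  obtain p where p: "inner_on U p" and pJ: "\<And>i x y. i < n \<Longrightarrow> x \<in> U \<Longrightarrow> y \<in> U \<Longrightarrow> p (J i x) (J i y) = p x y"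
    using invariant_inner[OF c e] by metis
  obtain G where lG: "lin_on U G" and GU': "G ` U \<subseteq> U" and Gb: "\<And>x y. x \<in> U \<Longrightarrow> y \<in> U \<Longrightarrow> p (G x) y = b x y"
    using riesz_operator[OF inner_on_nondeg[OF p] d(1) nondeg_lin[OF d(3)] nondeg_lin2[OF d(3) d(2)] d(2)] by metis
  have GU: "x \<in> U \<Longrightarrow> G x \<in> U" for x using GU' by blast
  have GJ: "G (J i x) = e i *\<^sub>R J i (G x)" if i: "i < n" and x: "x \<in> U" for i x
  proof (rule nondeg_eqI[OF inner_on_nondeg[OF p] d(2)])
    show "G (J i x) \<in> U" "e i *\<^sub>R J i (G x) \<in> U" using GU d(5) i x by (auto simp: subspace_scale[OF d(2)])
    fix y assume y: "y \<in> U"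
    have "p (G (J i x)) y = - p (G x) (J i y)" using d(5,7) i x y by (simp add: Gb)
    also have "\<dots> = - p (J i (G x)) (J i (J i y))" using pJ GU d(5) i x y by simp
    also have "\<dots> = e i * p (J i (G x)) y"
      using d(6)[OF i y] inner_on_scale(2)[OF p d(2) d(5)[OF i GU[OF x]] y, of "- e i"] by simp
    also have "\<dots> = p (e i *\<^sub>R J i (G x)) y"
      using inner_on_scale(1)[OF p d(2) d(5)[OF i GU[OF x]] y, of "e i"] by simp
    finally show "p (G (J i x)) y = p (e i *\<^sub>R J i (G x)) y" .
  qed
  have Gsym: "p (G x) y = p x (G y)" if "x \<in> U" "y \<in> U" for x y
    using that Gb nondeg_sym[OF d(3)] inner_on_sym[OF p] GU by metis
  obtain a where a: "\<And>x. x \<in> U \<Longrightarrow> G (G x) = a *\<^sub>R x"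
  proof (rule schur[OF c U irr p, of G "\<lambda>x. G (G x)"])
    fix i x assume "i < n" "x \<in> U"
    then show "G (G (J i x)) = J i (G (G x))"
      using sign_familyD[OF e] d(5) GU by (simp add: GJ lin_on_scale[OF lG])
  next
    show "p (G (G x)) y = p x (G (G y))" if "x \<in> U" "y \<in> U" for x y
      using that by (simp only: Gsym GU)
  qed (use GU Gb lG lin_on_comp[OF lG GU' lG] in auto)
  obtain u where u: "u \<in> U" "u \<noteq> 0" using U subspace_0[OF d(2)] by auto
  have "G u \<noteq> 0"
  proof
    assume "G u = 0"
    then have "b u y = 0" if "y \<in> U" for y
      using Gb[OF u(1) that] lin_on_zero[OF inner_on_lin2[OF p d(2) that] d(2)] by simp
    then show False using nondeg_nondeg[OF d(3) u(1)] u(2) by blast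
  qed
  then have "0 < p (G u) (G u)" using inner_on_pos[OF p GU[OF u(1)]] by blast
  also have "\<dots> = a * p u u"
    using Gsym[OF GU[OF u(1)] u(1)] a[OF u(1)] inner_on_scale(1)[OF p d(2) u(1) u(1)] by simp
  finally have a0: "a > 0" using inner_on_pos[OF p u] by (simp add: zero_less_mult_iff)
  \<comment> \<open>Multiplying \<open>p\<close> and dividing \<open>G\<close> by the same
    \<open>t\<close> leaves \<open>b\<close> unchanged. The new square of the operator is
    \<open>a\<close> divided by \<open>t * t\<close>, which forces the square root.\<close>
  define t where "t = sqrt a"
  have t: "t > 0" "t * t = a" using a0 by (auto simp: t_def)
  define q where "q x y = t * p x y" for x y
  define H where "H x = (1 / t) *\<^sub>R G x" for x
  have q: "inner_on U q"
    using p t(1) unfolding inner_on_def q_def by (auto intro!: lin_on_mult)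
  have HU: "x \<in> U \<Longrightarrow> H x \<in> U" for x by (simp add: H_def GU subspace_scale[OF d(2)])
  have HH: "H (H x) = x" if "x \<in> U" for x
    using that t GU by (simp add: H_def lin_on_scale[OF lG] a) (simp add: t(2)[symmetric])
  have Hb: "b x y = q (H x) y" if "x \<in> U" "y \<in> U" for x y
    using that t inner_on_scale(1)[OF p d(2) GU[OF that(1)] that(2), of "1 / t"] by (simp add: q_def H_def Gb)
  have "normal_form n e U J b q H"
    unfolding normal_form_def
  proof (intro conjI allI impI ballI)
    show "lin_on U H" unfolding H_def by (rule lin_on_scaleR[OF lG])
    show "q (H x) (H y) = q x y" if "x \<in> U" "y \<in> U" for x y
      using that Hb[of x "H y"] Hb[of "H y" x] HU HH nondeg_sym[OF d(3)] inner_on_sym[OF q] by metis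
    show "H (J i x) = e i *\<^sub>R J i (H x)" if "i < n" "x \<in> U" for i x
      using that GU by (simp add: H_def GJ lin_on_scale[OF d(4)] mult.commute)
  qed (use q HU HH Hb pJ in \<open>auto simp: q_def[of _ _, symmetric], auto simp: q_def\<close>)
  then show thesis using that by blast
qed

section \<open>Uniqueness of minimal admissible modules\<close>

text \<open>
  If \<open>T \<noteq> 0\<close> and \<open>g\<close> is one of the generators, then one of \<open>T \<plusminus> g T g\<^sup>-\<^sup>1\<close> is nonzero, and it commutes
  or anticommutes with \<open>g\<close>.
\<close>

lemma twisted_intertwiner:
  fixes U1 :: "'a::real_vector set" and U2 :: "'b::real_vector set"
  assumes U1: "fin_space U1" "U1 \<noteq> {0}" and U2: "subspace U2" "U2 \<noteq> {0}"
    and lg: "\<And>k. k < m \<Longrightarrow> lin_on U1 (g k)" "\<And>k. k < m \<Longrightarrow> lin_on U2 (h k)"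
    and mem: "\<And>k x. k < m \<Longrightarrow> x \<in> U1 \<Longrightarrow> g k x \<in> U1" "\<And>k x. k < m \<Longrightarrow> x \<in> U2 \<Longrightarrow> h k x \<in> U2"
    and a: "\<And>k. k < m \<Longrightarrow> a k * a k = (1::real)"
    and sq: "\<And>k x. k < m \<Longrightarrow> x \<in> U1 \<Longrightarrow> g k (g k x) = a k *\<^sub>R x" "\<And>k x. k < m \<Longrightarrow> x \<in> U2 \<Longrightarrow> h k (h k x) = a k *\<^sub>R x"
    and s: "\<And>k l. k < m \<Longrightarrow> l < m \<Longrightarrow> s k l * s k l = (1::real)"
    and com: "\<And>k l x. k < m \<Longrightarrow> l < m \<Longrightarrow> k \<noteq> l \<Longrightarrow> x \<in> U1 \<Longrightarrow> g k (g l x) = s k l *\<^sub>R g l (g k x)"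
      "\<And>k l x. k < m \<Longrightarrow> l < m \<Longrightarrow> k \<noteq> l \<Longrightarrow> x \<in> U2 \<Longrightarrow> h k (h l x) = s k l *\<^sub>R h l (h k x)"
  obtains T and d :: "nat \<Rightarrow> real" where "lin_on U1 T" "\<And>x. x \<in> U1 \<Longrightarrow> T x \<in> U2" "\<exists>x\<in>U1. T x \<noteq> 0"
    "\<And>k. k < m \<Longrightarrow> d k = 1 \<or> d k = - 1" "\<And>k x. k < m \<Longrightarrow> x \<in> U1 \<Longrightarrow> h k (T x) = d k *\<^sub>R T (g k x)"
proof -
  have sub: "subspace U1" by (rule fin_space_subspace[OF U1(1)])
  have "j \<le> m \<Longrightarrow> \<exists>T d. lin_on U1 T \<and> (\<forall>x\<in>U1. T x \<in> U2) \<and> (\<exists>x\<in>U1. T x \<noteq> 0) \<and>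
      (\<forall>k<j. (d k = (1::real) \<or> d k = - 1) \<and> (\<forall>x\<in>U1. h k (T x) = d k *\<^sub>R T (g k x)))" for j
  proof (induction j)
    case 0
    obtain p where p: "inner_on U1 p" using inner_on_exists[OF U1(1)] by blast
    obtain v where v: "v \<in> U1" "v \<noteq> 0" using U1(2) subspace_0[OF sub] by auto
    obtain u where u: "u \<in> U2" "u \<noteq> 0" using U2(2) subspace_0[OF U2(1)] by auto
    have "lin_on U1 (\<lambda>x. p v x *\<^sub>R u)"
      using inner_on_lin[OF p v(1)] by (auto simp: lin_on_def scaleR_left_distrib)
    moreover have "p v v *\<^sub>R u \<noteq> 0" using inner_on_pos[OF p v] u by auto
    ultimately show ?case using u v subspace_scale[OF U2(1)] by (intro exI[of _ "\<lambda>x. p v x *\<^sub>R u"]) auto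
  next
    case (Suc j)
    have "j \<le> m" using Suc.prems by simp
    from Suc.IH[OF this] obtain T d where "lin_on U1 T \<and> (\<forall>x\<in>U1. T x \<in> U2) \<and> (\<exists>x\<in>U1. T x \<noteq> 0) \<and>
      (\<forall>k<j. (d k = (1::real) \<or> d k = - 1) \<and> (\<forall>x\<in>U1. h k (T x) = d k *\<^sub>R T (g k x)))"
      by (elim exE)
    then have T: "lin_on U1 T" "\<And>x. x \<in> U1 \<Longrightarrow> T x \<in> U2" "\<exists>x\<in>U1. T x \<noteq> 0"
      and d: "\<And>k. k < j \<Longrightarrow> d k = (1::real) \<or> d k = - 1"
        "\<And>k x. k < j \<Longrightarrow> x \<in> U1 \<Longrightarrow> h k (T x) = d k *\<^sub>R T (g k x)"
      by simp_all
    have j: "j < m" using Suc by simp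
    \<comment> \<open>The inverse of \<open>g j\<close> is \<open>a j\<close> times
      \<open>g j\<close>, so \<open>T'\<close> is the conjugate of \<open>T\<close> by the
      \<open>j\<close>-th generator.\<close>
    define T' where "T' x = a j *\<^sub>R h j (T (g j x))" for x
    define R where "R c x = T x + c *\<^sub>R T' x" for c :: real and x
    have T'U: "T' x \<in> U2" if "x \<in> U1" for x
      using that mem j T(2) by (simp add: T'_def subspace_scale[OF U2(1)])
    have lT': "lin_on U1 T'"
      unfolding T'_def using mem j T(2)
      by (intro lin_on_scaleR lin_on_comp[OF lg(1)[OF j], of U1] lin_on_comp[OF T(1), of U2] lg(2)) auto
    have lR: "lin_on U1 (R c)" for c unfolding R_def using T(1) lT' by (intro lin_on_plus lin_on_scaleR)
    have RU: "R c x \<in> U2" if "x \<in> U1" for c x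
      using that T(2) T'U by (simp add: R_def subspace_add[OF U2(1)] subspace_scale[OF U2(1)])
    \<comment> \<open>Conjugation keeps the earlier signs: exchanging generators \<open>k\<close>
      and \<open>j\<close> costs \<open>s k j\<close> once on each side of \<open>T\<close>, and the
      two factors cancel.\<close>
    have Tk': "h k (T' x) = d k *\<^sub>R T' (g k x)" if k: "k < j" and x: "x \<in> U1" for k x
    proof -
      have km: "k < m" "k \<noteq> j" using k j by auto
      have "h k (T' x) = (a j * s k j) *\<^sub>R h j (h k (T (g j x)))"
        using x mem j km T(2)
        by (simp add: T'_def lin_on_scale[OF lg(2)[OF km(1)]] com(2)[OF km(1) j km(2) T(2)[OF mem(1)[OF j x]]])
      also have "\<dots> = (a j * s k j * d k) *\<^sub>R h j (T (g k (g j x)))"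
        using x mem j km T(2) k by (simp add: d(2) lin_on_scale[OF lg(2)])
      also have "\<dots> = (a j * (s k j * s k j) * d k) *\<^sub>R h j (T (g j (g k x)))"
        using x mem j km T(2) by (simp add: com(1)[OF km(1) j km(2) x] lin_on_scale[OF lg(2)] lin_on_scale[OF T(1)] mult_ac)
      finally show ?thesis using s[OF km(1) j] by (simp add: T'_def mult.commute)
    qed
    have Rk: "h k (R c x) = d k *\<^sub>R R c (g k x)" if k: "k < j" and x: "x \<in> U1" for k x c
    proof -
      have km: "k < m" using k j by auto
      show ?thesis
        using x k T(2)[OF x] T'U[OF x] unfolding R_def
        by (simp add: lin_on_add[OF lg(2)[OF km]] lin_on_scale[OF lg(2)[OF km]] subspace_scale[OF U2(1)]
            d(2) Tk' scaleR_add_right mult.commute)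
    qed
    have hT': "h j (T' x) = T (g j x)" if x: "x \<in> U1" for x
      using x mem j T(2) a[OF j] by (simp add: T'_def lin_on_scale[OF lg(2)] sq(2))
    have Tg': "T' (g j x) = h j (T x)" if x: "x \<in> U1" for x
      using x mem j T(2) a[OF j]
      by (simp add: T'_def lin_on_scale[OF lg(2)] lin_on_scale[OF T(1)] sq(1))
    have Rj: "h j (R c x) = c *\<^sub>R R c (g j x)" if x: "x \<in> U1" and c: "c * c = 1" for c x
      using x T(2)[OF x] T'U[OF x] c unfolding R_def
      by (simp add: lin_on_add[OF lg(2)[OF j]] lin_on_scale[OF lg(2)[OF j]] subspace_scale[OF U2(1)]
          hT' Tg' scaleR_add_right add.commute)
    obtain c where c: "c = 1 \<or> c = (- 1 :: real)" "\<exists>x\<in>U1. R c x \<noteq> 0"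
    proof (cases "\<exists>x\<in>U1. R 1 x \<noteq> 0")
      case False
      then have "R (- 1) x = 2 *\<^sub>R T x" if "x \<in> U1" for x
        using that by (simp add: R_def scaleR_2 add_eq_0_iff)
      then show thesis using that[of "- 1"] T(3) by force
    qed (use that[of 1] in auto)
    show ?case
      using lR[of c] RU c Rk[of _ _ c] Rj[of _ c] d(1)
      by (intro exI[of _ "R c"] exI[of _ "d(j := c)"]) (auto simp: less_Suc_eq)
  qed
  from this[OF order_refl] obtain T d where T: "lin_on U1 T \<and> (\<forall>x\<in>U1. T x \<in> U2) \<and> (\<exists>x\<in>U1. T x \<noteq> 0) \<and>
      (\<forall>k<m. (d k = (1::real) \<or> d k = - 1) \<and> (\<forall>x\<in>U1. h k (T x) = d k *\<^sub>R T (g k x)))"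
    by (elim exE)
  show thesis by (rule that[of T d]) (use T in simp_all)
qed

text \<open>The involutions \<open>G1\<close> and \<open>G2\<close> join the generators as index
  \<open>n\<close>, so that \<open>T\<close> respects them up to sign as well. The operator
  \<open>S\<close>, the adjoint of \<open>T\<close> times \<open>T\<close>, then commutes with
  everything and is a scalar. The signs \<open>d i\<close> may differ from one generator to the
  next, which is harmless because central coordinates can be rescaled separately.\<close>

lemma clifford_unique:
  fixes U1 :: "'a::real_vector set" and U2 :: "'b::real_vector set"
  assumes c1: "clifford_family n e U1 J1 b1" and c2: "clifford_family n e U2 J2 b2"
    and i1: "irreducible_family n U1 J1 b1" "U1 \<noteq> {0}" and i2: "irreducible_family n U2 J2 b2" "U2 \<noteq> {0}" and e: "sign_family n e"
  obtains T and d :: "nat \<Rightarrow> real" where "lin_on U1 T" "bij_betw T U1 U2" "\<And>i. i < n \<Longrightarrow> d i \<noteq> 0"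
    "\<And>i x y. i < n \<Longrightarrow> x \<in> U1 \<Longrightarrow> y \<in> U1 \<Longrightarrow> b2 (J2 i (T x)) (T y) = d i * b1 (J1 i x) y"
proof -
  note d1 = clifford_familyD[OF c1] and d2 = clifford_familyD[OF c2]
  obtain p1 G1 where nf1: "normal_form n e U1 J1 b1 p1 G1" by (rule normal_form_exists[OF c1 i1(2,1) e])
  obtain p2 G2 where nf2: "normal_form n e U2 J2 b2 p2 G2" by (rule normal_form_exists[OF c2 i2(2,1) e])
  note n1 = normal_formD[OF nf1] and n2 = normal_formD[OF nf2]
  define g where "g k = (if k < n then J1 k else G1)" for k
  define h where "h k = (if k < n then J2 k else G2)" for k
  define a where "a k = (if k < n then - e k else 1)" for k
  \<comment> \<open>The table of exchange signs: two generators anticommute, and a generator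
    \<open>k\<close> passes the involution with sign \<open>e k\<close> in either order.\<close>
  define s where "s k l = (if k < n \<and> l < n then - 1 else if k < n then e k else if l < n then e l else 1)" for k l
  have ee: "e k * e k = 1" "e k * (e k * x) = x" if "k < n" for k x
    using sign_familyD[OF e that] by (simp_all add: mult.assoc[symmetric])
  obtain T d where T: "lin_on U1 T" "\<And>x. x \<in> U1 \<Longrightarrow> T x \<in> U2" "\<exists>x\<in>U1. T x \<noteq> 0"
    and d': "\<And>k. k < Suc n \<Longrightarrow> d k = (1::real) \<or> d k = - 1"
      "\<And>k x. k < Suc n \<Longrightarrow> x \<in> U1 \<Longrightarrow> h k (T x) = d k *\<^sub>R T (g k x)"
  proof (rule twisted_intertwiner[OF d1(1) i1(2) d2(2) i2(2), of "Suc n" g h a s])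
    show "\<And>k x. k < Suc n \<Longrightarrow> x \<in> U1 \<Longrightarrow> g k (g k x) = a k *\<^sub>R x"
      "\<And>k x. k < Suc n \<Longrightarrow> x \<in> U2 \<Longrightarrow> h k (h k x) = a k *\<^sub>R x"
      by (auto simp: g_def h_def a_def d1(6) d2(6) n1(6) n2(6))
    show "k < Suc n \<Longrightarrow> l < Suc n \<Longrightarrow> k \<noteq> l \<Longrightarrow> x \<in> U1 \<Longrightarrow> g k (g l x) = s k l *\<^sub>R g l (g k x)"
      for k l x
    proof -
      assume k: "k < Suc n" and l: "l < Suc n" and kl: "k \<noteq> l" and x: "x \<in> U1"
      consider "k < n" "l < n" | "k < n" "l = n" | "k = n" "l < n" using k l kl by linarith
      then show "g k (g l x) = s k l *\<^sub>R g l (g k x)"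
        by cases (use d1(8)[of k l x] kl x in \<open>simp_all add: g_def s_def n1(4) ee\<close>)
    qed
    show "k < Suc n \<Longrightarrow> l < Suc n \<Longrightarrow> k \<noteq> l \<Longrightarrow> x \<in> U2 \<Longrightarrow> h k (h l x) = s k l *\<^sub>R h l (h k x)"
      for k l x
    proof -
      assume k: "k < Suc n" and l: "l < Suc n" and kl: "k \<noteq> l" and x: "x \<in> U2"
      consider "k < n" "l < n" | "k < n" "l = n" | "k = n" "l < n" using k l kl by linarith
      then show "h k (h l x) = s k l *\<^sub>R h l (h k x)"
        by cases (use d2(8)[of k l x] kl x in \<open>simp_all add: h_def s_def n2(4) ee\<close>)
    qed
    show "\<And>k. k < Suc n \<Longrightarrow> a k * a k = 1" "\<And>k l. k < Suc n \<Longrightarrow> l < Suc n \<Longrightarrow> s k l * s k l = 1"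
      by (auto simp: a_def s_def ee)
  qed (auto simp: g_def h_def d1(4,5) d2(4,5) n1(2,5) n2(2,5))
  have dd: "d k * d k = 1" "d k * (d k * x) = x" "d k \<noteq> 0" if "k < Suc n" for k x using d'(1)[OF that] by auto
  have TJ: "J2 i (T x) = d i *\<^sub>R T (J1 i x)" if "i < n" "x \<in> U1" for i x
    using d'(2)[of i x] that by (simp add: g_def h_def)
  have TG: "G2 (T x) = d n *\<^sub>R T (G1 x)" if "x \<in> U1" for x
    using d'(2)[of n x] that by (simp add: g_def h_def)
  have iso: "p2 (T (J1 i x)) (T (J1 i y)) = p2 (T x) (T y)" if i: "i < n" and xy: "x \<in> U1" "y \<in> U1" for i x y
  proof -
    have "p2 (T x) (T y) = p2 (J2 i (T x)) (J2 i (T y))" using n2(3)[OF i] T(2) xy by simp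
    also have "\<dots> = (d i * d i) * p2 (T (J1 i x)) (T (J1 i y))"
      using i xy by (simp add: TJ inner_on_scale[OF n2(1) d2(2)] T(2) d1(5) subspace_scale[OF d2(2)])
    finally show ?thesis using dd(1)[of i] i by simp
  qed
  have isoG: "p2 (T (G1 x)) (T (G1 y)) = p2 (T x) (T y)" if xy: "x \<in> U1" "y \<in> U1" for x y
  proof -
    have "p2 (T x) (T y) = p2 (G2 (T x)) (G2 (T y))" using n2(7) T(2) xy by simp
    also have "\<dots> = (d n * d n) * p2 (T (G1 x)) (T (G1 y))"
      using xy by (simp add: TG inner_on_scale[OF n2(1) d2(2)] T(2) n1(5) subspace_scale[OF d2(2)])
    finally show ?thesis using dd(1)[of n] by simp
  qed
  have TU: "T ` U1 \<subseteq> U2" using T(2) by blast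
  obtain S where lS: "lin_on U1 S" and SU': "S ` U1 \<subseteq> U1"
    and S: "\<And>x y. x \<in> U1 \<Longrightarrow> y \<in> U1 \<Longrightarrow> p1 (S x) y = p2 (T x) (T y)"
    by (rule riesz_operator[OF inner_on_nondeg[OF n1(1)] d1(1), of U1 "\<lambda>x y. p2 (T x) (T y)"])
      (use T(2) lin_on_comp[OF T(1) TU inner_on_lin[OF n2(1)]]
         lin_on_comp[OF T(1) TU inner_on_lin2[OF n2(1) d2(2)]] d1(2) in auto)
  have SU: "x \<in> U1 \<Longrightarrow> S x \<in> U1" for x using SU' by blast
  \<comment> \<open>Here \<open>f\<close> stands for a generator or for \<open>G1\<close>. It
    preserves \<open>p1\<close> and the form pulled back by \<open>T\<close>, and by surjectivity
    every test vector can be written as \<open>f z\<close>.\<close>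
  have commute: "S (f x) = f (S x)"
    if f: "\<And>x. x \<in> U1 \<Longrightarrow> f x \<in> U1" and inv: "\<And>x y. x \<in> U1 \<Longrightarrow> y \<in> U1 \<Longrightarrow> p2 (T (f x)) (T (f y)) = p2 (T x) (T y)"
      "\<And>x y. x \<in> U1 \<Longrightarrow> y \<in> U1 \<Longrightarrow> p1 (f x) (f y) = p1 x y" and surj: "\<And>y. y \<in> U1 \<Longrightarrow> \<exists>z\<in>U1. y = f z"
      and x: "x \<in> U1" for f x
  proof (rule nondeg_eqI[OF inner_on_nondeg[OF n1(1)] d1(2)])
    show "S (f x) \<in> U1" "f (S x) \<in> U1" using SU f x by auto
    fix y assume "y \<in> U1"
    then obtain z where z: "z \<in> U1" "y = f z" using surj by blast
    have "p1 (S (f x)) y = p2 (T x) (T z)" using S[OF f[OF x] f[OF z(1)]] inv(1)[OF x z(1)] z(2) by simp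
    also have "\<dots> = p1 (S x) z" using S x z(1) by simp
    also have "\<dots> = p1 (f (S x)) y" using inv(2)[OF SU[OF x] z(1)] z(2) by simp
    finally show "p1 (S (f x)) y = p1 (f (S x)) y" .
  qed
  have Jsurj: "\<exists>z\<in>U1. y = J1 i z" if "i < n" "y \<in> U1" for i y
  proof (rule bexI[of _ "- e i *\<^sub>R J1 i y"])
    have "J1 i (- e i *\<^sub>R J1 i y) = - e i *\<^sub>R J1 i (J1 i y)"
      by (rule lin_on_scale[OF d1(4)[OF that(1)] d1(5)[OF that]])
    then show "y = J1 i (- e i *\<^sub>R J1 i y)" using that by (simp add: d1(6) ee)
    show "- e i *\<^sub>R J1 i y \<in> U1" using d1(5)[OF that] by (rule subspace_scale[OF d1(2)])
  qed
  obtain c where c: "\<And>x. x \<in> U1 \<Longrightarrow> S x = c *\<^sub>R x"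
  proof (rule schur[OF c1 i1(2,1) n1(1), of G1 S])
    show "S (J1 i x) = J1 i (S x)" if "i < n" "x \<in> U1" for i x
      by (rule commute) (use that d1(5) iso n1(3) Jsurj in auto)
    show "S (G1 x) = G1 (S x)" if "x \<in> U1" for x
      by (rule commute) (use that n1(5-7) isoG in \<open>auto intro!: bexI[of _ "G1 _"]\<close>)
    show "p1 (S x) y = p1 x (S y)" if "x \<in> U1" "y \<in> U1" for x y
      using S[OF that] S[OF that(2,1)] inner_on_sym[OF n1(1)] inner_on_sym[OF n2(1)] T(2) that SU by metis
  qed (use n1 lS SU in auto)
  have Tp: "p2 (T x) (T y) = c * p1 x y" if "x \<in> U1" "y \<in> U1" for x y
    using S[OF that] inner_on_scale(1)[OF n1(1) d1(2) that] c[OF that(1)] by simp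
  obtain u where u: "u \<in> U1" "T u \<noteq> 0" using T(3) by blast
  have c0: "c \<noteq> 0" using Tp[OF u(1) u(1)] inner_on_pos[OF n2(1) T(2)[OF u(1)] u(2)] by auto
  have inj: "inj_on T U1"
  proof (rule lin_on_inj[OF T(1) d1(2)])
    fix x assume x: "x \<in> U1" "T x = 0"
    then have "c * p1 x x = 0"
      using Tp[OF x(1) x(1)] lin_on_zero[OF inner_on_lin[OF n2(1) T(2)[OF x(1)]] d2(2)] by simp
    then show "x = 0" using c0 inner_on_pos[OF n1(1) x(1)] by fastforce
  qed
  have "T ` U1 = U2"
  proof (rule irreducible_familyD[OF i2(1) lin_on_image_subspace[OF T(1) d1(2)] TU])
    show "T ` U1 \<noteq> {0}" using u by blast
    show "J2 i x \<in> T ` U1" if "i < n" "x \<in> T ` U1" for i x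
      using that by (auto simp: TJ d1(5) lin_on_scale[OF T(1), symmetric] subspace_scale[OF d1(2)])
    fix x assume x: "x \<in> T ` U1" and 0: "\<And>y. y \<in> T ` U1 \<Longrightarrow> b2 x y = 0"
    have xU: "x \<in> U2" using x TU by blast
    \<comment> \<open>The image of \<open>T\<close> is stable under \<open>G2\<close>, so the
      argument of \<open>schur\<close> applies: pairing \<open>x\<close> with \<open>G2 x\<close>
      under \<open>b2\<close> yields \<open>p2 x x\<close>.\<close>
    have "G2 x \<in> T ` U1"
      using x by (auto simp: TG n1(5) lin_on_scale[OF T(1), symmetric] subspace_scale[OF d1(2)])
    then have "p2 (G2 x) (G2 x) = 0" using 0 n2(8)[OF xU n2(5)[OF xU]] by simp
    then have "p2 x x = 0" using n2(7)[OF xU xU] by simp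
    then show "x = 0" using inner_on_pos[OF n2(1) xU] by fastforce
  qed
  then have bij: "bij_betw T U1 U2" using inj by (simp add: bij_betw_def)
  have fin: "b2 (J2 i (T x)) (T y) = (d i * d n * c) * b1 (J1 i x) y" if i: "i < n" and x: "x \<in> U1" and y: "y \<in> U1" for i x y
  proof -
    have "b2 (J2 i (T x)) (T y) = d i * (d n * p2 (T (G1 (J1 i x))) (T y))"
      using i x y by (simp add: n2(8) d2(5) T(2) TJ d1(5) lin_on_scale[OF n2(2)] TG
          inner_on_scale[OF n2(1) d2(2)] n1(5) n2(5) subspace_scale[OF d2(2)])
    then show ?thesis using i x y by (simp add: Tp d1(5) n1(5,8))
  qed
  show thesis
    by (rule that[OF T(1) bij, of "\<lambda>i. d i * d n * c"]) (use fin c0 dd(3) in auto)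
qed

text \<open>This permits the choice of convenient minimal modules when an isomorphism has to be
  constructed.\<close>

theorem minimal_admissible_unique:
  assumes "minimal_admissible r s M1" "minimal_admissible r s M2"
  shows "lie_isomorphic (pseudo_H_algebra r s M1) (pseudo_H_algebra r s M2)"
proof -
  have a: "admissible r s M1" "admissible r s M2" "module_space M1 \<noteq> {0}" "module_space M2 \<noteq> {0}"
    using assms unfolding minimal_admissible_def by blast+
  obtain T d where "lin_on (module_space M1) T" "bij_betw T (module_space M1) (module_space M2)"
     "\<And>i. i < r + s \<Longrightarrow> d i \<noteq> (0::real)"
    "\<And>i x y. i < r + s \<Longrightarrow> x \<in> module_space M1 \<Longrightarrow> y \<in> module_space M1 \<Longrightarrow>
      module_form M2 (act M2 (pm_unit i) (T x)) (T y) = d i * module_form M1 (act M1 (pm_unit i) x) y"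
    using clifford_unique[OF clifford_standard[OF a(1)] clifford_standard[OF a(2)] minimal_irr[OF assms(1)] a(3)
      minimal_irr[OF assms(2)] a(4) sign_family_sig] by metis
  then show ?thesis
    by (intro lie_isomorphicI[OF a(1,2), of T id d]) auto
qed

section \<open>Isomorphisms and signatures\<close>

lemma act_zero: "admissible r s M \<Longrightarrow> z \<in> Rrs r s \<Longrightarrow> act M z 0 = 0"
  using lin_on_zero admD by blast

lemma act_scale_left:
  "admissible r s M \<Longrightarrow> z \<in> Rrs r s \<Longrightarrow> x \<in> module_space M \<Longrightarrow> act M (c *\<^sub>R z) x = c *\<^sub>R act M z x"
  by (rule lin_on_scale[OF admD(5)])

text \<open>If \<open>u\<close> acts by zero, its anticommutator with any \<open>v\<close> vanishes,
  and hence so does their scalar product.\<close>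

lemma act_faithful:
  assumes adm: "admissible r s M" and nz: "module_space M \<noteq> {0}" and u: "u \<in> Rrs r s"
    and 0: "\<And>x. x \<in> module_space M \<Longrightarrow> act M u x = 0"
  shows "u = 0"
proof (rule nondeg_nondeg[OF form_rs_nondeg u])
  fix v assume v: "v \<in> Rrs r s"
  obtain x where x: "x \<in> module_space M" "x \<noteq> 0" using nz subspace_0[OF admD(2)[OF adm]] by auto
  show "form_rs r s u v = 0"
    using act_anticomm[OF adm u v x(1)] 0 x act_zero[OF adm v] admD(6)[OF adm v x(1)] by simp
qed

lemma act_nonnull_inj:
  assumes "admissible r s M" "z \<in> Rrs r s" "x \<in> module_space M" "form_rs r s z z \<noteq> 0" "act M z x = 0"
  shows "x = 0"
  using admD(7)[OF assms(1-3)] assms(4,5) act_zero[OF assms(1,2)] by simp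

text \<open>This identifies the centre of the algebra as the second factor. A non-null central
  vector, here the first basis vector, acts injectively, so no nonzero \<open>x\<close> is
  orthogonal to everything after its action.\<close>

lemma bracket_eq_0:
  assumes adm: "admissible r s M" and n: "r + s > 0" and x: "x \<in> module_space M"
  shows "(\<forall>y\<in>module_space M. module_bracket r s M x y = 0) \<longleftrightarrow> x = 0"
proof
  assume 0: "\<forall>y\<in>module_space M. module_bracket r s M x y = 0"
  have z: "pm_unit 0 \<in> Rrs r s" by (rule pm_unit_Rrs[OF n])
  have nn: "form_rs r s (pm_unit 0) (pm_unit 0) \<noteq> 0" unfolding form_rs_unit[OF n] by (simp del: single_one)
  have "act M (pm_unit 0) x = 0"
  proof (rule nondeg_nondeg[OF admD(3)[OF adm] admD(6)[OF adm z x]])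
    fix y assume y: "y \<in> module_space M"
    then show "module_form M (act M (pm_unit 0) x) y = 0"
      using module_bracket_props(2)[OF adm x y z] 0 form_rs_scale(1)[of r s _ 0 0] by simp
  qed
  then show "x = 0" by (rule act_nonnull_inj[OF adm z x nn])
next
  assume x0: "x = 0"
  show "\<forall>y\<in>module_space M. module_bracket r s M x y = 0"
  proof
    fix y assume y: "y \<in> module_space M"
    show "module_bracket r s M x y = 0"
    proof (rule nondeg_nondeg[OF form_rs_nondeg module_bracket_props(1)[OF adm x y]])
      fix z assume z: "z \<in> Rrs r s"
      show "form_rs r s (module_bracket r s M x y) z = 0"
        using module_bracket_props(2)[OF adm x y z] x0 act_zero[OF adm z]
          lin_on_zero[OF nondeg_lin2[OF admD(3)[OF adm] admD(2)[OF adm] y] admD(2)[OF adm]]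
        by (simp add: form_rs_sym[of r s _ z])
    qed
  qed
qed

text \<open>
  An isomorphism of the Lie algebras preserves the centre, which is the second factor; its diagonal
  blocks \<open>A\<close> and \<open>C\<close> satisfy \<open>[A x, A y] = C [x, y]\<close>, and \<open>F\<close> below is the inverse of the adjoint of \<open>C\<close>.
\<close>

lemma lie_isomorphicD:
  assumes adm: "admissible r s M" and adm': "admissible r' s' M'" and n: "r + s > 0" "r' + s' > 0"
    and iso: "lie_isomorphic (pseudo_H_algebra r s M) (pseudo_H_algebra r' s' M')"
  obtains A F where "lin_on (module_space M) A" "bij_betw A (module_space M) (module_space M')"
    "lin_on (Rrs r s) F" "F ` Rrs r s = Rrs r' s'"
    "\<And>w x y. w \<in> Rrs r s \<Longrightarrow> x \<in> module_space M \<Longrightarrow> y \<in> module_space M \<Longrightarrow>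
       module_form M' (act M' (F w) (A x)) (A y) = module_form M (act M w x) y"
proof -
  let ?U = "module_space M" and ?U' = "module_space M'" and ?R = "Rrs r s" and ?R' = "Rrs r' s'"
  note d = admD[OF adm] and d' = admD[OF adm']
  obtain f where lf: "lin_on (?U \<times> ?R) f" and bf: "bij_betw f (?U \<times> ?R) (?U' \<times> ?R')"
    and br: "\<forall>p\<in>?U \<times> ?R. \<forall>q\<in>?U \<times> ?R. f (lie_bracket (pseudo_H_algebra r s M) p q) =
       lie_bracket (pseudo_H_algebra r' s' M') (f p) (f q)"
    using iso unfolding lie_isomorphic_def by (auto simp: pseudo_H_algebra_def)
  have bracket: "f (0, module_bracket r s M x y) = (0, module_bracket r' s' M' (fst (f (x, v))) (fst (f (y, w))))"
    if "x \<in> ?U" "v \<in> ?R" "y \<in> ?U" "w \<in> ?R" for x v y w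
    using br[rule_format, of "(x, v)" "(y, w)"] that
    by (simp add: pseudo_H_algebra_def case_prod_beta')
  have sub: "subspace (?U \<times> ?R)" using d(2) subspace_Rrs by (rule subspace_Times)
  have 0: "0 \<in> ?U" "0 \<in> ?R" "0 \<in> ?U'" "0 \<in> ?R'" using subspace_0 d(2) d'(2) subspace_Rrs by blast+
  have f0: "f (0, 0) = (0, 0)" using lin_on_zero[OF lf sub] by (simp add: zero_prod_def)
  have fmem: "fst (f (x, v)) \<in> ?U'" "snd (f (x, v)) \<in> ?R'" if "x \<in> ?U" "v \<in> ?R" for x v
    using bij_betw_apply[OF bf, of "(x, v)"] that by (auto simp: mem_Times_iff)
  have finj: "x = y \<and> v = w" if "f (x, v) = f (y, w)" "x \<in> ?U" "v \<in> ?R" "y \<in> ?U" "w \<in> ?R" for x y v w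
    using inj_onD[OF bij_betw_imp_inj_on[OF bf] that(1)] that by auto
  have fsurj: "\<exists>x\<in>?U. \<exists>v\<in>?R. f (x, v) = (x', v')" if "x' \<in> ?U'" "v' \<in> ?R'" for x' v'
  proof -
    have "(x', v') \<in> f ` (?U \<times> ?R)" using bij_betw_imp_surj_on[OF bf] that by blast
    then show ?thesis by force
  qed
  \<comment> \<open>In both algebras the second factor consists of the elements with vanishing
    brackets, and surjectivity of \<open>f\<close> compares the two conditions.\<close>
  have centre: "fst (f (x, v)) = 0 \<longleftrightarrow> x = 0" if x: "x \<in> ?U" and v: "v \<in> ?R" for x v
  proof -
    have "fst (f (x, v)) = 0 \<longleftrightarrow> (\<forall>y'\<in>?U'. module_bracket r' s' M' (fst (f (x, v))) y' = 0)"
      using bracket_eq_0[OF adm' n(2) fmem(1)[OF x v]] by simp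
    also have "\<dots> \<longleftrightarrow> (\<forall>y\<in>?U. module_bracket r s M x y = 0)"
    proof (intro iffI ballI)
      fix y assume y: "y \<in> ?U" and z: "\<forall>y'\<in>?U'. module_bracket r' s' M' (fst (f (x, v))) y' = 0"
      then have "f (0, module_bracket r s M x y) = f (0, 0)"
        using bracket[OF x v y 0(2)] fmem(1)[OF y 0(2)] f0 by simp
      then show "module_bracket r s M x y = 0"
        using finj 0 module_bracket_props(1)[OF adm x y] by blast
    next
      fix y' assume y': "y' \<in> ?U'" and z: "\<forall>y\<in>?U. module_bracket r s M x y = 0"
      obtain y w where y: "y \<in> ?U" "w \<in> ?R" "f (y, w) = (y', 0)" using fsurj[OF y' 0(4)] by blast
      then show "module_bracket r' s' M' (fst (f (x, v))) y' = 0"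
        using bracket[OF x v y(1,2)] z f0 by simp
    qed
    finally show ?thesis using bracket_eq_0[OF adm n(1) x] by simp
  qed
  define A where "A x = fst (f (x, 0))" for x
  define C where "C v = snd (f (0, v))" for v
  \<comment> \<open>The component of \<open>f\<close> from the module to the centre does not affect
    brackets and is dropped. The module component does not depend on \<open>v\<close>, as the centre
    is mapped to the centre.\<close>
  have fA: "fst (f (x, v)) = A x" if "x \<in> ?U" "v \<in> ?R" for x v
    using lin_on_add[OF lf, of "(x, 0)" "(0, v)"] centre[OF 0(1) that(2)] that 0 by (simp add: A_def)
  have fC: "f (0, v) = (0, C v)" if "v \<in> ?R" for v
    using centre[OF 0(1) that] by (simp add: C_def prod_eq_iff)
  have lA: "lin_on ?U A"
    unfolding lin_on_def A_def
    using lin_on_add[OF lf, of "(_, 0)" "(_, 0)"] lin_on_scale[OF lf, of "(_, 0)"] 0 by simp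
  have lC: "lin_on ?R C"
    unfolding lin_on_def C_def
    using lin_on_add[OF lf, of "(0, _)" "(0, _)"] lin_on_scale[OF lf, of "(0, _)"] 0 by simp
  have bA: "bij_betw A ?U ?U'" unfolding bij_betw_def
  proof
    show "inj_on A ?U"
      by (rule lin_on_inj[OF lA d(2)]) (use centre 0 in \<open>auto simp: A_def\<close>)
    show "A ` ?U = ?U'"
    proof (intro subset_antisym subsetI)
      fix x' assume "x' \<in> ?U'"
      then obtain x v where "x \<in> ?U" "v \<in> ?R" "f (x, v) = (x', 0)" using fsurj 0 by blast
      then show "x' \<in> A ` ?U" using fA[of x v] by auto
    qed (use fmem 0 in \<open>auto simp: A_def\<close>)
  qed
  have bC: "bij_betw C ?R ?R'" unfolding bij_betw_def
  proof
    show "inj_on C ?R"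
    proof (rule inj_onI)
      fix v w assume "v \<in> ?R" "w \<in> ?R" "C v = C w"
      then show "v = w" using finj[of 0 v 0 w] fC 0 by simp
    qed
    show "C ` ?R = ?R'"
    proof (intro subset_antisym subsetI)
      fix v' assume "v' \<in> ?R'"
      then obtain x v where xv: "x \<in> ?U" "v \<in> ?R" "f (x, v) = (0, v')" using fsurj 0 by blast
      then have "x = 0" using centre[OF xv(1,2)] by simp
      then show "v' \<in> C ` ?R" using xv fC by auto
    qed (use fmem 0 in \<open>auto simp: C_def\<close>)
  qed
  have AC: "module_bracket r' s' M' (A x) (A y) = C (module_bracket r s M x y)" if "x \<in> ?U" "y \<in> ?U" for x y
    using bracket[OF that(1) 0(2) that(2) 0(2)] by (simp add: A_def C_def)
  let ?D = "inv_into ?R C"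
  have D: "lin_on ?R' ?D" by (rule lin_on_inv_into[OF lC subspace_Rrs bC])
  have Dmem: "?D v' \<in> ?R" if "v' \<in> ?R'" for v' using bij_betw_apply[OF bij_betw_inv_into[OF bC] that] .
  have DC: "?D (C v) = v" if "v \<in> ?R" for v using bij_betw_inv_into_left[OF bC that] .
  have CD: "C (?D v) = v" if "v \<in> ?R'" for v using bij_betw_inv_into_right[OF bC that] .
  have Cmem: "C v \<in> ?R'" if "v \<in> ?R" for v using bij_betw_apply[OF bC that] .
  obtain F where lF: "lin_on ?R F" and FR: "F ` ?R \<subseteq> ?R'"
    and F: "\<And>w v'. w \<in> ?R \<Longrightarrow> v' \<in> ?R' \<Longrightarrow> form_rs r' s' (F w) v' = form_rs r s w (?D v')"
  proof (rule riesz_operator[OF form_rs_nondeg fin_space_Rrs, where E = ?R and q = "\<lambda>w v'. form_rs r s w (?D v')"])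
    show "lin_on ?R' (\<lambda>v'. form_rs r s w (?D v'))" for w
      by (rule lin_on_comp[OF D _ form_rs_lin[of ?R]]) (use Dmem in auto)
    show "lin_on ?R (\<lambda>w. form_rs r s w (?D v'))" for v'
      by (auto simp: lin_on_def form_rs_add form_rs_scale)
  qed (auto intro: subspace_Rrs)
  have "?R' \<subseteq> F ` ?R"
  proof
    fix z assume z: "z \<in> ?R'"
    have "lin_on ?R (\<lambda>v. form_rs r' s' z (C v))"
      by (rule lin_on_comp[OF lC _ form_rs_lin[of ?R']]) (use Cmem in auto)
    \<comment> \<open>The vector \<open>w\<close> is the adjoint of \<open>C\<close> applied to
      \<open>z\<close>, so its image under the inverse adjoint \<open>F\<close> is
      \<open>z\<close>.\<close>
    then obtain w where w: "w \<in> ?R" "\<And>v. v \<in> ?R \<Longrightarrow> form_rs r s w v = form_rs r' s' z (C v)"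
      using riesz[OF form_rs_nondeg fin_space_Rrs] by blast
    have "F w = z"
      by (rule nondeg_eqI[OF form_rs_nondeg subspace_Rrs]) (use w z FR F Dmem CD in auto)
    then show "z \<in> F ` ?R" using w by blast
  qed
  with FR have FRR: "F ` ?R = ?R'" by blast
  have rel: "module_form M' (act M' (F w) (A x)) (A y) = module_form M (act M w x) y"
    if w: "w \<in> ?R" and x: "x \<in> ?U" and y: "y \<in> ?U" for w x y
  proof -
    have A': "A x \<in> ?U'" "A y \<in> ?U'" using bij_betw_apply[OF bA] x y by auto
    have "module_form M' (act M' (F w) (A x)) (A y) = form_rs r' s' (F w) (module_bracket r' s' M' (A x) (A y))"
      using module_bracket_props(2)[OF adm' A'] w FR by blast
    also have "\<dots> = form_rs r s w (module_bracket r s M x y)"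
      using module_bracket_props(1)[OF adm x y] by (simp add: AC[OF x y] F[OF w Cmem] DC)
    also have "\<dots> = module_form M (act M w x) y"
      using module_bracket_props(2)[OF adm x y w] by simp
    finally show ?thesis .
  qed
  show thesis by (rule that[OF lA bA lF FRR rel])
qed

text \<open>
  \<open>X = J\<^sub>z\<^sup>-\<^sup>1 J\<^sub>w\<close> satisfies a quadratic equation whose constant term is the ratio of the
  norms, and an isomorphism conjugates \<open>X\<close> into the corresponding operator of the other module.
\<close>

lemma act_quotient:
  assumes adm: "admissible r s M" and z: "z \<in> Rrs r s" and w: "w \<in> Rrs r s"
    and q: "form_rs r s z z = q" "q \<noteq> 0" and X: "X = (\<lambda>x. - (1 / q) *\<^sub>R act M z (act M w x))"
    and x: "x \<in> module_space M"
  shows "X x \<in> module_space M" "act M z (X x) = act M w x"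
    "X (X x) = (2 * form_rs r s z w / q) *\<^sub>R X x - (form_rs r s w w / q) *\<^sub>R x"
proof -
  note d = admD[OF adm]
  have m: "act M w x \<in> module_space M" "act M z x \<in> module_space M" "act M z (act M w x) \<in> module_space M"
    using d(6) z w x by auto
  show "X x \<in> module_space M" unfolding X by (rule subspace_scale[OF d(2) m(3)])
  show "act M z (X x) = act M w x"
    using m q by (simp add: X lin_on_scale[OF d(4)[OF z]] d(7)[OF z] lin_on_minus[OF d(4)[OF z]] subspace_scale[OF d(2)])
  have e: "act M w (act M z (act M w x)) = - (2 * form_rs r s z w) *\<^sub>R act M w x + form_rs r s w w *\<^sub>R act M z x"
  proof -
    have "act M w (act M z (act M w x)) = - (2 * form_rs r s z w) *\<^sub>R act M w x - act M z (act M w (act M w x))"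
      using act_anticomm[OF adm z w m(1)] by (simp add: algebra_simps)
    also have "act M z (act M w (act M w x)) = - form_rs r s w w *\<^sub>R act M z x"
      unfolding d(7)[OF w x] by (rule lin_on_scale[OF d(4)[OF z] x])
    finally show ?thesis by simp
  qed
  have "act M z (act M w (act M z (act M w x))) =
      - (2 * form_rs r s z w) *\<^sub>R act M z (act M w x) + form_rs r s w w *\<^sub>R (- q *\<^sub>R x)"
    unfolding e using m d(7)[OF z x] q(1)
    by (simp only: lin_on_add[OF d(4)[OF z] subspace_scale[OF d(2)] subspace_scale[OF d(2)]] lin_on_scale[OF d(4)[OF z]])
  moreover have "X (X x) = (1 / q * (1 / q)) *\<^sub>R act M z (act M w (act M z (act M w x)))"
    using m d(6)[OF w] unfolding X
    by (simp only: lin_on_scale[OF d(4)[OF w]] lin_on_scale[OF d(4)[OF z]] scaleR_scaleR) simp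
  ultimately show "X (X x) = (2 * form_rs r s z w / q) *\<^sub>R X x - (form_rs r s w w / q) *\<^sub>R x"
    using q(2) by (simp add: X scaleR_diff_right)
qed

text \<open>With \<open>z\<close> fixed, the operators \<open>X\<close> and \<open>Y\<close> of the
  two modules are conjugate under \<open>A\<close>, so both quadratic equations hold for
  \<open>X\<close>. If their linear coefficients agree, so do the constant terms, which are the
  ratios of norms. Otherwise \<open>X\<close> is a scalar and \<open>w\<close> is a multiple of
  \<open>z\<close>, where the claim is immediate.\<close>

lemma form_ratio:
  assumes adm: "admissible r s M" and adm': "admissible r' s' M'" and n: "r + s > 0"
    and nz: "module_space M \<noteq> {0}"
    and A: "lin_on (module_space M) A" "bij_betw A (module_space M) (module_space M')"
    and F: "lin_on (Rrs r s) F" "F ` Rrs r s \<subseteq> Rrs r' s'"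
    and rel: "\<And>w x y. w \<in> Rrs r s \<Longrightarrow> x \<in> module_space M \<Longrightarrow> y \<in> module_space M \<Longrightarrow>
       module_form M' (act M' (F w) (A x)) (A y) = module_form M (act M w x) y"
  obtains c where "c \<noteq> 0" "\<And>w. w \<in> Rrs r s \<Longrightarrow> form_rs r' s' (F w) (F w) = c * form_rs r s w w"
proof -
  let ?U = "module_space M" and ?U' = "module_space M'"
  note d = admD[OF adm] and d' = admD[OF adm']
  define z where "z = pm_unit 0"
  define q where "q = form_rs r s z z"
  define p where "p = form_rs r' s' (F z) (F z)"
  have z: "z \<in> Rrs r s" unfolding z_def by (rule pm_unit_Rrs[OF n])
  have q0: "q \<noteq> 0" unfolding q_def z_def form_rs_unit[OF n] by (simp del: single_one)
  have AU: "A x \<in> ?U'" if "x \<in> ?U" for x using bij_betw_apply[OF A(2) that] .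
  have As: "\<exists>x\<in>?U. y = A x" if "y \<in> ?U'" for y using bij_betw_imp_surj_on[OF A(2)] that by blast
  have Ainj: "x = y" if "A x = A y" "x \<in> ?U" "y \<in> ?U" for x y
    using inj_onD[OF bij_betw_imp_inj_on[OF A(2)] that] .
  have FR: "F w \<in> Rrs r' s'" if "w \<in> Rrs r s" for w using F(2) that by blast
  \<comment> \<open>By \<open>rel\<close>, pairing the action of \<open>F w\<close> on
    \<open>A x\<close> with \<open>A y\<close> gives the old form, so equal vectors in the old
    module yield equal vectors in the new one.\<close>
  have transport: "act M' (F w) (A x) = act M' (F z) (A x')"
    if w: "w \<in> Rrs r s" and x: "x \<in> ?U" "x' \<in> ?U" "act M w x = act M z x'" for w x x'
  proof (rule nondeg_eqI[OF d'(3,2)])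
    show "act M' (F w) (A x) \<in> ?U'" "act M' (F z) (A x') \<in> ?U'" using d'(6) FR AU w x z by auto
    fix y assume "y \<in> ?U'"
    then obtain y' where "y' \<in> ?U" "y = A y'" using As by blast
    then show "module_form M' (act M' (F w) (A x)) y = module_form M' (act M' (F z) (A x')) y"
      using rel w x z by simp
  qed
  have Kinj: "x = 0" if x: "x \<in> ?U" and 0: "act M' (F z) (A x) = 0" for x
  proof (rule act_nonnull_inj[OF adm z x q0[unfolded q_def]], rule nondeg_nondeg[OF d(3) d(6)[OF z x]])
    fix y assume y: "y \<in> ?U"
    show "module_form M (act M z x) y = 0"
      using rel[OF z x y] 0 lin_on_zero[OF nondeg_lin2[OF d'(3,2) AU[OF y]] d'(2)] by simp
  qed
  obtain u where u: "u \<in> ?U" "u \<noteq> 0" using nz subspace_0[OF d(2)] by auto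
  \<comment> \<open>If \<open>F z\<close> were null, its action would square to zero, although
    \<open>Kinj\<close> makes it injective.\<close>
  have p0: "p \<noteq> 0"
  proof
    assume "p = 0"
    obtain u' where u': "u' \<in> ?U" "act M' (F z) (A u) = A u'" using As d'(6)[OF FR[OF z] AU[OF u(1)]] by blast
    have "act M' (F z) (A u') = 0"
      using d'(7)[OF FR[OF z] AU[OF u(1)]] \<open>p = 0\<close> u'(2) by (simp add: p_def)
    then have "u' = 0" using Kinj u'(1) by blast
    then have "act M' (F z) (A u) = 0" using u'(2) lin_on_zero[OF A(1) d(2)] by simp
    then show False using Kinj u by blast
  qed
  have main: "form_rs r' s' (F w) (F w) = (p / q) * form_rs r s w w" if w: "w \<in> Rrs r s" for w
  proof -
    define X where "X = (\<lambda>x. - (1 / q) *\<^sub>R act M z (act M w x))"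
    define Y where "Y = (\<lambda>x. - (1 / p) *\<^sub>R act M' (F z) (act M' (F w) x))"
    note X = act_quotient[OF adm z w q_def[symmetric] q0 X_def]
    note Y = act_quotient[OF adm' FR[OF z] FR[OF w] p_def[symmetric] p0 Y_def]
    have YA: "Y (A x) = A (X x)" if x: "x \<in> ?U" for x
    proof -
      have "act M' (F z) (Y (A x)) = act M' (F z) (A (X x))"
        using Y(2)[OF AU[OF x]] transport[OF w x X(1)[OF x]] X(2)[OF x] by simp
      then have "act M' (F z) (Y (A x) - A (X x)) = 0"
        using lin_on_diff[OF d'(4)[OF FR[OF z]] d'(2) Y(1)[OF AU[OF x]] AU[OF X(1)[OF x]]] by simp
      then have "Y (A x) - A (X x) = 0"
        by (rule act_nonnull_inj[OF adm' FR[OF z] subspace_diff[OF d'(2) Y(1)[OF AU[OF x]] AU[OF X(1)[OF x]]]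
              p0[unfolded p_def]])
      then show ?thesis by simp
    qed
    define al where "al = 2 * form_rs r s z w / q"
    define al' where "al' = 2 * form_rs r' s' (F z) (F w) / p"
    define ga where "ga = form_rs r s w w / q"
    define ga' where "ga' = form_rs r' s' (F w) (F w) / p"
    have key: "(al - al') *\<^sub>R X x = (ga - ga') *\<^sub>R x" if x: "x \<in> ?U" for x
    proof -
      have Xx: "X x \<in> ?U" by (rule X(1)[OF x])
      have "A (al *\<^sub>R X x - ga *\<^sub>R x) = A (X (X x))" using X(3)[OF x] by (simp add: al_def ga_def)
      also have "\<dots> = Y (Y (A x))" using YA[OF x] YA[OF Xx] by simp
      also have "\<dots> = al' *\<^sub>R Y (A x) - ga' *\<^sub>R A x" using Y(3)[OF AU[OF x]] by (simp add: al'_def ga'_def)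
      also have "\<dots> = A (al' *\<^sub>R X x - ga' *\<^sub>R x)"
        using Xx x by (simp add: YA lin_on_diff[OF A(1) d(2)] subspace_scale[OF d(2)] lin_on_scale[OF A(1)])
      finally have "al *\<^sub>R X x - ga *\<^sub>R x = al' *\<^sub>R X x - ga' *\<^sub>R x"
        by (rule Ainj) (use Xx x d(2) in \<open>auto simp: subspace_diff subspace_scale\<close>)
      then show ?thesis by (simp add: scaleR_left_diff_distrib algebra_simps)
    qed
    show ?thesis
    proof (cases "al = al'")
      case True
      then have "ga = ga'" using key[OF u(1)] u(2) by simp
      then show ?thesis using p0 q0 by (simp add: ga_def ga'_def field_simps)
    next
      case False
      \<comment> \<open>\<open>X\<close> is the scalar \<open>k\<close>, so \<open>w\<close> acts
        like \<open>k *\<^sub>R z\<close>, and faithfulness of the action gives equality.\<close>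
      define k where "k = (ga - ga') / (al - al')"
      have Xk: "X x = k *\<^sub>R x" if x: "x \<in> ?U" for x
      proof -
        have "(al - al') *\<^sub>R X x = (al - al') *\<^sub>R (k *\<^sub>R x)" using key[OF x] False by (simp add: k_def)
        then show ?thesis using False by (simp only: scaleR_cancel_left) simp
      qed
      have "w - k *\<^sub>R z = 0"
      proof (rule act_faithful[OF adm nz])
        show "w - k *\<^sub>R z \<in> Rrs r s" using w z subspace_Rrs by (simp add: subspace_diff subspace_scale)
        fix x assume x: "x \<in> ?U"
        have "act M (w - k *\<^sub>R z) x = act M w x - k *\<^sub>R act M z x"
          using lin_on_diff[OF d(5)[OF x] subspace_Rrs w subspace_scale[OF subspace_Rrs z]]
            act_scale_left[OF adm z x] by simp
        also have "act M w x = k *\<^sub>R act M z x"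
          using X(2)[OF x] Xk[OF x] lin_on_scale[OF d(4)[OF z] x] by simp
        finally show "act M (w - k *\<^sub>R z) x = 0" by simp
      qed
      then have "w = k *\<^sub>R z" by simp
      then show ?thesis
        using lin_on_scale[OF F(1) z] q0 by (simp add: form_rs_scale p_def[symmetric] q_def[symmetric])
    qed
  qed
  show thesis by (rule that[of "p / q"]) (use main p0 q0 in auto)
qed

section \<open>Inertia: signatures can be compared by dimension\<close>

lemma dim_Rrs: "dim (Rrs n 0) = n"
proof -
  have inj: "inj_on pm_unit {..<n}"
    by (rule inj_onI) (metis lookup_single_eq lookup_single_not_eq zero_neq_one)
  have "independent (pm_unit ` {..<n})"
  proof
    assume "dependent (pm_unit ` {..<n})"
    then obtain u i where i: "i < n" "u (pm_unit i) \<noteq> 0" and 0: "(\<Sum>v\<in>pm_unit ` {..<n}. u v *\<^sub>R v) = 0"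
      by (auto simp: dependent_finite)
    have "(\<Sum>i<n. Poly_Mapping.single i (u (pm_unit i))) = 0"
      using 0 by (simp add: sum.reindex[OF inj] scaleR_pm_unit)
    then have "Poly_Mapping.lookup (\<Sum>i<n. Poly_Mapping.single i (u (pm_unit i))) i = 0" by simp
    then show False using i by (simp add: lookup_pm_sum)
  qed
  moreover have "Rrs n 0 \<subseteq> span (pm_unit ` {..<n})"
  proof
    fix z assume "z \<in> Rrs n 0"
    then have "z = (\<Sum>i<n. Poly_Mapping.lookup z i *\<^sub>R pm_unit i)" using Rrs_expand[of z n 0] by simp
    also have "\<dots> \<in> span (pm_unit ` {..<n})" by (intro span_sum span_scale span_base) simp
    finally show "z \<in> span (pm_unit ` {..<n})" .
  qed
  moreover have "pm_unit ` {..<n} \<subseteq> Rrs n 0" using pm_unit_Rrs[of _ n 0] by auto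
  ultimately show ?thesis
    using basis_card_eq_dim[of "pm_unit ` {..<n}" "Rrs n 0"] card_image[OF inj] by simp
qed

lemma dim_bound:
  assumes "lin_on (Rrs m 0) f" "f ` Rrs m 0 \<subseteq> Rrs n 0" "\<And>w. w \<in> Rrs m 0 \<Longrightarrow> f w = 0 \<Longrightarrow> w = 0"
  shows "m \<le> n"
  using lin_on_inj_dim[OF assms(1) fin_space_Rrs lin_on_inj[OF assms(1) subspace_Rrs assms(3)]]
    fin_space_subset(2)[OF fin_space_Rrs lin_on_image_subspace[OF assms(1) subspace_Rrs] assms(2)]
  by (simp add: dim_Rrs)

text \<open>Sylvester's law as a dimension count. Restrict \<open>F\<close> to the positive
  coordinates and keep only the positive coordinates of its values. A vector in the kernel would
  have an image of nonpositive norm, and so is zero since \<open>c\<close> is positive. The negative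
  part is symmetric.\<close>

lemma signature_le:
  assumes F: "lin_on (Rrs r s) F" and c: "c > 0"
    and q: "\<And>w. w \<in> Rrs r s \<Longrightarrow> form_rs r' s' (F w) (F w) = c * form_rs r s w w"
  shows "r \<le> r'" "s \<le> s'"
proof -
  have sq0: "(\<Sum>i<m. v i * v i) \<le> 0 \<Longrightarrow> i < m \<Longrightarrow> v i = 0" for m i and v :: "nat \<Rightarrow> real"
    using sum_nonneg_eq_0_iff[of "{..<m}" "\<lambda>i. v i * v i"] sum_nonneg[of "{..<m}" "\<lambda>i. v i * v i"] by auto
  have sqn: "(\<Sum>i<m. v i * v i) \<ge> 0" for m and v :: "nat \<Rightarrow> real" by (rule sum_nonneg) simp
  have pm0: "w = 0" if "w \<in> Rrs m 0" "\<And>i. i < m \<Longrightarrow> Poly_Mapping.lookup w i = 0" for w m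
    using that by (intro poly_mapping_eqI) (metis add_0_right lookup_zero mem_Rrs not_less)
  show "r \<le> r'"
  proof (rule dim_bound)
    let ?f = "\<lambda>w. \<Sum>j<r'. Poly_Mapping.single j (Poly_Mapping.lookup (F w) j)"
    have sub: "Rrs r 0 \<subseteq> Rrs r s" by (auto simp: mem_Rrs)
    show "lin_on (Rrs r 0) ?f"
      using lin_on_subset[OF F sub]
      by (auto simp: lin_on_def lookup_add lookup_scaleR_pm single_add sum.distrib scaleR_sum_right scaleR_single)
    show "?f ` Rrs r 0 \<subseteq> Rrs r' 0" by (auto simp: mem_Rrs lookup_pm_sum)
    fix w assume w: "w \<in> Rrs r 0" "?f w = 0"
    have "Poly_Mapping.lookup (F w) j = 0" if "j < r'" for j
      using arg_cong[OF w(2), of "\<lambda>v. Poly_Mapping.lookup v j"] that by (simp add: lookup_pm_sum)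
    then have "form_rs r' s' (F w) (F w) \<le> 0" using sqn by (simp add: form_rs_def)
    then have "form_rs r s w w \<le> 0" using q[of w] sub w(1) c by (auto simp: mult_le_0_iff)
    moreover have "form_rs r s w w = (\<Sum>i<r. Poly_Mapping.lookup w i * Poly_Mapping.lookup w i)"
      using w(1) by (simp add: form_rs_def mem_Rrs)
    ultimately show "w = 0" using pm0[OF w(1)] sq0 by metis
  qed
  show "s \<le> s'"
  proof (rule dim_bound)
    \<comment> \<open>This moves a vector of length \<open>s\<close> to the negative coordinates,
      which start at index \<open>r\<close>.\<close>
    let ?h = "\<lambda>w. \<Sum>j<s. Poly_Mapping.single (r + j) (Poly_Mapping.lookup w j)"
    let ?f = "\<lambda>w. \<Sum>j<s'. Poly_Mapping.single j (Poly_Mapping.lookup (F (?h w)) (r' + j))"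
    have hl: "Poly_Mapping.lookup (?h w) i = (if r \<le> i \<and> i < r + s then Poly_Mapping.lookup w (i - r) else 0)" for w i
    proof -
      have "Poly_Mapping.lookup (?h w) i = (\<Sum>j<s. if j = i - r \<and> r \<le> i then Poly_Mapping.lookup w (i - r) else 0)"
        unfolding lookup_sum by (intro sum.cong) (auto simp: lookup_single when_def)
      then show ?thesis by (cases "r \<le> i") auto
    qed
    have hR: "?h w \<in> Rrs r s" for w by (simp add: mem_Rrs hl)
    have "lin_on (Rrs s 0) ?h"
      by (auto simp: lin_on_def lookup_add lookup_scaleR_pm single_add sum.distrib scaleR_sum_right scaleR_single)
    then have "lin_on (Rrs s 0) (\<lambda>w. F (?h w))" by (rule lin_on_comp[OF _ _ F]) (use hR in blast)
    then show "lin_on (Rrs s 0) ?f"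
      by (auto simp: lin_on_def lookup_add lookup_scaleR_pm single_add sum.distrib scaleR_sum_right scaleR_single)
    show "?f ` Rrs s 0 \<subseteq> Rrs s' 0" by (auto simp: mem_Rrs lookup_pm_sum)
    fix w assume w: "w \<in> Rrs s 0" "?f w = 0"
    have "Poly_Mapping.lookup (F (?h w)) (r' + j) = 0" if "j < s'" for j
      using arg_cong[OF w(2), of "\<lambda>v. Poly_Mapping.lookup v j"] that by (simp add: lookup_pm_sum)
    then have "form_rs r' s' (F (?h w)) (F (?h w)) \<ge> 0" using sqn by (simp add: form_rs_def)
    then have "form_rs r s (?h w) (?h w) \<ge> 0" using q[OF hR] c by (simp add: zero_le_mult_iff)
    moreover have "form_rs r s (?h w) (?h w) = - (\<Sum>i<s. Poly_Mapping.lookup w i * Poly_Mapping.lookup w i)"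
      by (simp add: form_rs_def hl)
    ultimately have "(\<Sum>i<s. Poly_Mapping.lookup w i * Poly_Mapping.lookup w i) \<le> 0" by simp
    then show "w = 0" using pm0[OF w(1)] sq0 by metis
  qed
qed

section \<open>Polar decomposition\<close>

lemma inner_on_subset:
  assumes "inner_on U p" "E \<subseteq> U"
  shows "inner_on E p"
  unfolding inner_on_def
proof (intro conjI ballI impI)
  fix x assume x: "x \<in> E"
  then have xU: "x \<in> U" using assms(2) by blast
  show "lin_on E (p x)" by (rule lin_on_subset[OF inner_on_lin[OF assms(1) xU] assms(2)])
  show "p x x > 0" if "x \<noteq> 0" by (rule inner_on_pos[OF assms(1) xU that])
  fix y assume "y \<in> E"
  then show "p x y = p y x" using inner_on_sym[OF assms(1) xU] assms(2) by blast
qed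

text \<open>Vectors orthogonal to all eigenvectors form a stable subspace, which must be zero; so
  eigenvectors span, and \<open>P\<close> takes square roots of eigenvalues on a basis of them. The
  last conclusion replaces a calculus of inverses: if S N S = N, then \<open>N\<close> sends an
  eigenvector with eigenvalue l to one with eigenvalue 1/l or to zero, and the roots cancel
  likewise.\<close>

lemma positive_sqrt:
  assumes p: "inner_on U p" and U: "fin_space U"
    and S: "lin_on U S" "\<And>x. x \<in> U \<Longrightarrow> S x \<in> U" "\<And>x y. x \<in> U \<Longrightarrow> y \<in> U \<Longrightarrow> p (S x) y = p x (S y)"
    and pos: "\<And>x. x \<in> U \<Longrightarrow> x \<noteq> 0 \<Longrightarrow> p (S x) x > 0"
  obtains P where "lin_on U P" "\<And>x. x \<in> U \<Longrightarrow> P x \<in> U" "\<And>x y. x \<in> U \<Longrightarrow> y \<in> U \<Longrightarrow> p (P x) y = p x (P y)"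
    "\<And>x. x \<in> U \<Longrightarrow> P (P x) = S x"
    "\<And>N x. lin_on U N \<Longrightarrow> (\<And>x. x \<in> U \<Longrightarrow> N x \<in> U) \<Longrightarrow> (\<And>x. x \<in> U \<Longrightarrow> S (N (S x)) = N x) \<Longrightarrow> x \<in> U \<Longrightarrow> P (N (P x)) = N x"
proof -
  have sub: "subspace U" by (rule fin_space_subspace[OF U])
  define Eig where "Eig = {x \<in> U. \<exists>c. S x = c *\<^sub>R x}"
  have EU: "Eig \<subseteq> U" by (auto simp: Eig_def)
  define Z where "Z = {x \<in> U. \<forall>y\<in>Eig. p x y = 0}"
  have subZ: "subspace Z" unfolding Z_def
    using lin_on_add[OF inner_on_lin2[OF p sub]] lin_on_scale[OF inner_on_lin2[OF p sub]]
      lin_on_zero[OF inner_on_lin2[OF p sub] sub] EU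
    by (intro subspaceI) (auto simp: subspace_0[OF sub] subspace_add[OF sub] subspace_scale[OF sub] subset_iff)
  have ZU: "Z \<subseteq> U" by (auto simp: Z_def)
  have Z0: "Z = {0}"
  proof (rule ccontr)
    assume ne: "Z \<noteq> {0}"
    have SZ: "S ` Z \<subseteq> Z"
    proof
      fix z assume "z \<in> S ` Z"
      then obtain x where x: "x \<in> U" "\<forall>y\<in>Eig. p x y = 0" "z = S x" by (auto simp: Z_def)
      have "p (S x) y = 0" if y: "y \<in> Eig" for y
      proof -
        obtain c where c: "y \<in> U" "S y = c *\<^sub>R y" using y by (auto simp: Eig_def)
        then show ?thesis using S(3)[OF x(1) c(1)] x(2) y inner_on_scale(2)[OF p sub x(1) c(1)] by simp
      qed
      then show "z \<in> Z" using x S(2) by (auto simp: Z_def)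
    qed
    have pZ: "inner_on Z p" by (rule inner_on_subset[OF p ZU])
    obtain c x where x: "x \<in> Z" "x \<noteq> 0" "S x = c *\<^sub>R x"
      by (rule self_adjoint_eigenvector[OF pZ fin_space_subset(1)[OF U subZ ZU] ne lin_on_subset[OF S(1) ZU] SZ])
        (rule S(3)[OF subsetD[OF ZU] subsetD[OF ZU]])
    then have "x \<in> Eig" using ZU by (auto simp: Eig_def)
    then have "p x x = 0" using x(1) by (auto simp: Z_def)
    then show False using inner_on_pos[OF p _ x(2)] x(1) ZU by fastforce
  qed
  have spE: "span Eig = U"
  proof
    show spU: "span Eig \<subseteq> U" by (rule span_minimal[OF EU sub])
    have fs: "fin_space (span Eig)" by (rule fin_space_subset(1)[OF U subspace_span spU])
    have pE: "inner_on (span Eig) p" by (rule inner_on_subset[OF p spU])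
    show "U \<subseteq> span Eig"
    proof
      fix x assume x: "x \<in> U"
      obtain u where u: "u \<in> span Eig" "\<forall>y\<in>span Eig. p u y = p x y"
        using riesz[OF inner_on_nondeg[OF pE] fs lin_on_subset[OF inner_on_lin[OF p x] spU]] by blast
      have uU: "u \<in> U" using u spU by blast
      have "x - u \<in> Z"
        using u(2) x uU EU lin_on_diff[OF inner_on_lin2[OF p sub] sub x uU]
        by (auto simp: Z_def subspace_diff[OF sub] span_base subset_iff)
      then show "x \<in> span Eig" using Z0 u(1) by auto
    qed
  qed
  obtain B where B: "B \<subseteq> Eig" "independent B" "Eig \<subseteq> span B" using maximal_independent_subset by blast
  have BU: "B \<subseteq> U" using B EU by blast
  have fB: "finite B" using independent_in_fin_space[OF U BU B(2)] by blast
  have spB: "span B = U" using B spE span_minimal[OF B(3)] span_mono[OF B(1)] by auto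
  obtain l where l: "\<And>b. b \<in> B \<Longrightarrow> S b = l b *\<^sub>R b" using B(1) unfolding Eig_def by (simp add: subset_iff) metis
  obtain P where P: "linear P" "\<And>b. b \<in> B \<Longrightarrow> P b = sqrt (l b) *\<^sub>R b"
    using linear_independent_extend[OF B(2), of "\<lambda>b. sqrt (l b) *\<^sub>R b"] by blast
  have cpos: "c > 0" if "S x = c *\<^sub>R x" "x \<in> U" "x \<noteq> 0" for c x
    using pos[OF that(2,3)] inner_on_pos[OF p that(2,3)] that(1) inner_on_scale(1)[OF p sub that(2,2)]
    by (simp add: zero_less_mult_iff)
  \<comment> \<open>\<open>P\<close> was prescribed on \<open>B\<close> only. A general eigenvector
    involves only basis vectors with its own eigenvalue, so \<open>P\<close> acts on it by the same
    root.\<close>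
  have eig: "P x = sqrt c *\<^sub>R x" if x: "x \<in> U" and Sx: "S x = c *\<^sub>R x" for c x
  proof -
    define r where "r = representation B x"
    have xr: "x = (\<Sum>b\<in>B. r b *\<^sub>R b)"
      using sum_representation_eq[OF B(2) _ fB, of x] x spB by (simp add: r_def)
    have "S x = (\<Sum>b\<in>B. r b *\<^sub>R S b)" using lin_on_sum_scale[OF S(1) sub, of B "\<lambda>b. b" r] BU xr by auto
    then have "S x = (\<Sum>b\<in>B. (r b * l b) *\<^sub>R b)" by (simp add: l)
    moreover have "c *\<^sub>R x = (\<Sum>b\<in>B. (c * r b) *\<^sub>R b)" by (subst xr) (simp add: scaleR_sum_right)
    ultimately have "(\<Sum>b\<in>B. (r b * l b - c * r b) *\<^sub>R b) = 0"
      using Sx by (simp add: scaleR_left_diff_distrib sum_subtractf)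
    then have z: "r b * l b - c * r b = 0" if "b \<in> B" for b
      using independentD[OF B(2) fB order_refl, of "\<lambda>b. r b * l b - c * r b"] that by blast
    have "P x = (\<Sum>b\<in>B. r b *\<^sub>R P b)" by (subst xr) (simp add: linear_sum[OF P(1)] linear_scale[OF P(1)])
    also have "\<dots> = (\<Sum>b\<in>B. (sqrt c * r b) *\<^sub>R b)"
    proof (intro sum.cong refl)
      fix b assume b: "b \<in> B"
      have "r b = 0 \<or> l b = c" using z[OF b] by (simp add: algebra_simps)
      then show "r b *\<^sub>R P b = (sqrt c * r b) *\<^sub>R b" using P(2)[OF b] by auto
    qed
    also have "\<dots> = sqrt c *\<^sub>R (\<Sum>b\<in>B. r b *\<^sub>R b)" by (simp add: scaleR_sum_right)
    also have "\<dots> = sqrt c *\<^sub>R x" using xr by simp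
    finally show ?thesis .
  qed
  have lP: "lin_on X P" for X by (rule linear_lin_on[OF P(1)])
  have PU: "P x \<in> U" if "x \<in> U" for x
  proof -
    have "P ` span B \<subseteq> span (P ` B)" using linear_span_image[OF P(1), of B] by simp
    moreover have "span (P ` B) \<subseteq> U"
      by (rule span_minimal) (use P(2) BU in \<open>auto simp: subspace_scale[OF sub] sub subset_iff\<close>)
    ultimately show ?thesis using that spB by blast
  qed
  note ext = lin_on_eqI[OF _ _ sub spB[THEN equalityD2] BU]
  have l0: "l b > 0" if "b \<in> B" for b
    using cpos[OF l[OF that]] that BU B(2) dependent_zero by blast
  have symB: "p (P a) b = p a (P b)" if ab: "a \<in> B" "b \<in> B" for a b
  proof -
    have abU: "a \<in> U" "b \<in> U" using ab BU by auto
    have "l a * p a b = l b * p a b"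
      using S(3)[OF abU] l ab inner_on_scale[OF p sub abU] by simp
    then have "l a = l b \<or> p a b = 0" by auto
    then show ?thesis using P(2) ab inner_on_scale[OF p sub abU] by auto
  qed
  have sym1: "p (P a) y = p a (P y)" if a: "a \<in> B" and y: "y \<in> U" for a y
  proof (rule ext[OF _ _ _ y])
    have aU: "a \<in> U" using a BU by auto
    show "lin_on U (p (P a))" by (rule inner_on_lin[OF p PU[OF aU]])
    show "lin_on U (\<lambda>y. p a (P y))" by (rule lin_on_comp[OF lP _ inner_on_lin[OF p aU]]) (use PU in auto)
  qed (rule symB[OF a])
  have sym: "p (P x) y = p x (P y)" if x: "x \<in> U" and y: "y \<in> U" for x y
  proof (rule ext[OF _ _ _ x])
    show "lin_on U (\<lambda>x. p (P x) y)" by (rule lin_on_comp[OF lP _ inner_on_lin2[OF p sub y]]) (use PU in auto)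
    show "lin_on U (\<lambda>x. p x (P y))" by (rule inner_on_lin2[OF p sub PU[OF y]])
  qed (rule sym1[OF _ y])
  have PP: "P (P x) = S x" if x: "x \<in> U" for x
  proof (rule ext[OF _ S(1) _ x])
    show "lin_on U (\<lambda>x. P (P x))" by (rule lin_on_comp[OF lP subset_UNIV lP])
    fix b assume b: "b \<in> B"
    have "P (P b) = (sqrt (l b) * sqrt (l b)) *\<^sub>R b" using P(2)[OF b] by (simp add: linear_scale[OF P(1)])
    then show "P (P b) = S b" using l0[OF b] l[OF b] by simp
  qed
  have N: "P (N (P x)) = N x" if N: "lin_on U N" "\<And>x. x \<in> U \<Longrightarrow> N x \<in> U" "\<And>x. x \<in> U \<Longrightarrow> S (N (S x)) = N x"
    and x: "x \<in> U" for N x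
  proof (rule ext[OF _ N(1) _ x])
    have "lin_on U (\<lambda>x. N (P x))" by (rule lin_on_comp[OF lP _ N(1)]) (use PU in auto)
    then show "lin_on U (\<lambda>x. P (N (P x)))" by (rule lin_on_comp[OF _ subset_UNIV lP])
    fix b assume b: "b \<in> B"
    then have bU: "b \<in> U" using BU by auto
    have "l b *\<^sub>R S (N b) = N b"
      using N(3)[OF bU] l[OF b] lin_on_scale[OF N(1) bU] lin_on_scale[OF S(1) N(2)[OF bU]] by simp
    then have "(1 / l b) *\<^sub>R (l b *\<^sub>R S (N b)) = (1 / l b) *\<^sub>R N b" by (rule arg_cong)
    then have "S (N b) = (1 / l b) *\<^sub>R N b" using l0[OF b] by simp
    then have "P (N b) = sqrt (1 / l b) *\<^sub>R N b" by (rule eig[OF N(2)[OF bU]])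
    then have "P (N (P b)) = (sqrt (l b) * sqrt (1 / l b)) *\<^sub>R N b"
      by (simp add: P(2)[OF b] lin_on_scale[OF N(1) bU] linear_scale[OF P(1)])
    then show "P (N (P b)) = N b" using l0[OF b] by (simp add: real_sqrt_mult[symmetric])
  qed
  show thesis by (rule that[of P]) (use lP PU sym PP N in auto)
qed

text \<open>The form of \<open>F w\<close> is \<open>c\<close> times that of \<open>w\<close>. If
  \<open>c\<close> were positive, \<open>signature_le\<close> would give both r \<le> s and s \<le>
  r. So \<open>c\<close> is negative, and a multiple of \<open>F\<close> carries the standard basis
  to one with opposite norms. This new basis acts on the second module.\<close>

lemma opposite_family:
  assumes rs: "r \<noteq> s" and V: "minimal_admissible r s V" and W: "minimal_admissible s r W"
    and iso: "lie_isomorphic (pseudo_H_algebra r s V) (pseudo_H_algebra s r W)"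
  obtains A K where "lin_on (module_space V) A" "bij_betw A (module_space V) (module_space W)"
    "clifford_family (r + s) (\<lambda>i. - sig_sign r i) (module_space W) K (module_form W)"
    "irreducible_family (r + s) (module_space W) K (module_form W)"
    "\<And>i x y. i < r + s \<Longrightarrow> x \<in> module_space V \<Longrightarrow> y \<in> module_space V \<Longrightarrow>
       module_form W (K i (A x)) (A y) = module_form V (act V (pm_unit i) x) y"
proof -
  let ?U = "module_space V" and ?U' = "module_space W"
  have adm: "admissible r s V" "admissible s r W" and nz: "?U \<noteq> {0}" "?U' \<noteq> {0}"
    using V W unfolding minimal_admissible_def by blast+
  note d = admD[OF adm(1)] and d' = admD[OF adm(2)]
  have n: "r + s > 0" "s + r > 0" using rs by auto
  obtain A F where A: "lin_on ?U A" "bij_betw A ?U ?U'" and F: "lin_on (Rrs r s) F" "F ` Rrs r s = Rrs s r"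
    and rel: "\<And>w x y. w \<in> Rrs r s \<Longrightarrow> x \<in> ?U \<Longrightarrow> y \<in> ?U \<Longrightarrow>
       module_form W (act W (F w) (A x)) (A y) = module_form V (act V w x) y"
    using lie_isomorphicD[OF adm n iso] by metis
  have FR: "F w \<in> Rrs s r" if "w \<in> Rrs r s" for w using F(2) that by blast
  have AU: "A x \<in> ?U'" if "x \<in> ?U" for x using bij_betw_apply[OF A(2) that] .
  obtain c where c: "c \<noteq> 0" "\<And>w. w \<in> Rrs r s \<Longrightarrow> form_rs s r (F w) (F w) = c * form_rs r s w w"
    using form_ratio[OF adm n(1) nz(1) A F(1) equalityD1[OF F(2)] rel] by metis
  have "\<not> c > 0" using signature_le[OF F(1) _ c(2)] rs by force
  then have c0: "c < 0" using c(1) by simp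
  have pol: "form_rs s r (F v) (F w) = c * form_rs r s v w" if v: "v \<in> Rrs r s" and w: "w \<in> Rrs r s" for v w
  proof -
    have "form_rs s r (F (v + w)) (F (v + w)) = c * form_rs r s (v + w) (v + w)"
      by (rule c(2)[OF subspace_add[OF subspace_Rrs v w]])
    then show ?thesis
      using c(2)[OF v] c(2)[OF w]
      by (simp add: lin_on_add[OF F(1) v w] form_rs_add form_rs_sym[of r s w v] form_rs_sym[of s r "F w" "F v"] algebra_simps)
  qed
  \<comment> \<open>Chosen such that the norms of the \<open>z i\<close> become exactly the negated
    signs.\<close>
  define t where "t = 1 / sqrt (- c)"
  have t: "t > 0" "t * t * c = - 1" using c0 by (auto simp: t_def field_simps)
  define z where "z i = t *\<^sub>R F (pm_unit i)" for i
  have zR: "z i \<in> Rrs s r" if "i < r + s" for i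
    unfolding z_def by (rule subspace_scale[OF subspace_Rrs FR[OF pm_unit_Rrs[OF that]]])
  have cl: "clifford_family (r + s) (\<lambda>i. - sig_sign r i) ?U' (\<lambda>i. act W (z i)) (module_form W)"
  proof (rule clifford_orthogonal[OF adm(2) zR])
    fix i j assume ij: "i < r + s" "j < r + s"
    have "form_rs s r (z i) (z j) = t * t * c * form_rs r s (pm_unit i) (pm_unit j)"
      by (simp add: z_def form_rs_scale pol[OF pm_unit_Rrs[OF ij(1)] pm_unit_Rrs[OF ij(2)]] del: single_one)
    then show "form_rs s r (z i) (z j) = (if i = j then - sig_sign r i else 0)"
      using t(2) form_rs_unit[OF ij(1)] by (simp add: lookup_single when_def del: single_one)
  qed
  have ir: "irreducible_family (r + s) ?U' (\<lambda>i. act W (z i)) (module_form W)"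
    unfolding irreducible_family_def
  proof (intro allI impI, elim conjE)
    fix E assume E: "subspace E" "E \<subseteq> ?U'" "E \<noteq> {0}" "\<forall>i<r + s. act W (z i) ` E \<subseteq> E"
      "\<forall>x\<in>E. (\<forall>y\<in>E. module_form W x y = 0) \<longrightarrow> x = 0"
    show "E = ?U'"
    proof (rule irreducible_familyD[OF minimal_irr[OF W] E(1-3)])
      fix j x assume j: "j < s + r" and x: "x \<in> E"
      have xU: "x \<in> ?U'" using x E(2) by blast
      \<comment> \<open>\<open>F\<close> is onto, so every standard generator is a combination of
        the \<open>z i\<close>, and subspaces stable under the new generators are stable under the
        old ones.\<close>
      obtain w where w: "w \<in> Rrs r s" "pm_unit j = F w" using F(2) pm_unit_Rrs[OF j] by blast
      have "F w = F (\<Sum>i<r + s. Poly_Mapping.lookup w i *\<^sub>R pm_unit i)" using Rrs_expand[OF w(1)] by simp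
      also have "\<dots> = (\<Sum>i<r + s. Poly_Mapping.lookup w i *\<^sub>R F (pm_unit i))"
        by (rule lin_on_sum_scale[OF F(1) subspace_Rrs]) (simp del: single_one)
      also have "\<dots> = (\<Sum>i<r + s. (Poly_Mapping.lookup w i / t) *\<^sub>R z i)" using t(1) by (simp add: z_def)
      finally have "act W (pm_unit j) x = act W (\<Sum>i<r + s. (Poly_Mapping.lookup w i / t) *\<^sub>R z i) x"
        using w(2) by simp
      also have "\<dots> = (\<Sum>i<r + s. (Poly_Mapping.lookup w i / t) *\<^sub>R act W (z i) x)"
        by (rule lin_on_sum_scale[OF d'(5)[OF xU] subspace_Rrs]) (simp add: zR)
      also have "\<dots> \<in> E" by (intro subspace_sum[OF E(1)] subspace_scale[OF E(1)]) (use E(4) x in auto)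
      finally show "act W (pm_unit j) x \<in> E" .
    qed (use E(5) in blast)
  qed
  \<comment> \<open>The rescaling of \<open>F\<close> by \<open>t\<close> is compensated in
    \<open>A\<close>, which enters the relation twice; hence the square root.\<close>
  define q where "q = 1 / sqrt t"
  have q: "q \<noteq> 0" "q * q * t = 1" using t(1) by (auto simp: q_def)
  define A' where "A' x = q *\<^sub>R A x" for x
  have lA': "lin_on ?U A'" unfolding A'_def by (rule lin_on_scaleR[OF A(1)])
  have bA': "bij_betw A' ?U ?U'"
    unfolding bij_betw_def
  proof
    show "inj_on A' ?U" using bij_betw_imp_inj_on[OF A(2)] q(1) by (auto simp: inj_on_def A'_def)
    show "A' ` ?U = ?U'"
    proof
      show "A' ` ?U \<subseteq> ?U'" using AU subspace_scale[OF d'(2)] by (auto simp: A'_def)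
      show "?U' \<subseteq> A' ` ?U"
      proof
        fix y assume "y \<in> ?U'"
        then obtain x where x: "x \<in> ?U" "y = A x" using bij_betw_imp_surj_on[OF A(2)] by blast
        then have "y = A' ((1 / q) *\<^sub>R x)" using q(1) by (simp add: A'_def lin_on_scale[OF A(1)])
        then show "y \<in> A' ` ?U" using subspace_scale[OF d(2) x(1)] by blast
      qed
    qed
  qed
  have rel': "module_form W (act W (z i) (A' x)) (A' y) = module_form V (act V (pm_unit i) x) y"
    if i: "i < r + s" and x: "x \<in> ?U" and y: "y \<in> ?U" for i x y
  proof -
    have Fi: "F (pm_unit i) \<in> Rrs s r" by (rule FR[OF pm_unit_Rrs[OF i]])
    let ?y = "act W (F (pm_unit i)) (A x)"
    have m: "?y \<in> ?U'" by (rule d'(6)[OF Fi AU[OF x]])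
    have "act W (z i) (A' x) = (q * t) *\<^sub>R ?y"
      unfolding z_def A'_def
      by (simp add: act_scale_left[OF adm(2) Fi] lin_on_scale[OF d'(4)[OF Fi]] AU x subspace_scale[OF d'(2)] del: single_one)
    then have "module_form W (act W (z i) (A' x)) (A' y) = (q * t) * (q * module_form W ?y (A y))"
      using lin_on_scale[OF nondeg_lin2[OF d'(3,2) subspace_scale[OF d'(2) AU[OF y]]] m]
        lin_on_scale[OF nondeg_lin[OF d'(3) m] AU[OF y]] by (simp add: A'_def del: single_one)
    then show ?thesis using rel[OF pm_unit_Rrs[OF i] x y] q(2) by (simp add: mult_ac)
  qed
  show thesis by (rule that[OF lA' bA' cl ir rel'])
qed

text \<open>
  \<open>G M\<^sub>i\<close> with the form \<open>p (G x) y\<close> is a Clifford family with signs \<open>e\<close>, and \<open>K M\<^sub>i\<close> with the form \<open>p (K x) y\<close>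
  is one with signs \<open>- e\<close>. Both define the bracket given by the skew forms \<open>p (M\<^sub>i x) y\<close>.
\<close>

definition double_system ::
  "nat \<Rightarrow> (nat \<Rightarrow> real) \<Rightarrow> 'u::real_vector set \<Rightarrow> ('u \<Rightarrow> 'u \<Rightarrow> real) \<Rightarrow> (nat \<Rightarrow> 'u \<Rightarrow> 'u) \<Rightarrow>
    ('u \<Rightarrow> 'u) \<Rightarrow> ('u \<Rightarrow> 'u) \<Rightarrow> bool" where
  "double_system n e U p M G K \<longleftrightarrow> fin_space U \<and> inner_on U p \<and> sign_family n e \<and>
     lin_on U G \<and> (\<forall>x\<in>U. G x \<in> U \<and> G (G x) = x) \<and> (\<forall>x\<in>U. \<forall>y\<in>U. p (G x) (G y) = p x y) \<and>
     lin_on U K \<and> (\<forall>x\<in>U. K x \<in> U \<and> K (K x) = x) \<and> (\<forall>x\<in>U. \<forall>y\<in>U. p (K x) (K y) = p x y) \<and>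
     (\<forall>i<n. lin_on U (M i) \<and> (\<forall>x\<in>U. M i x \<in> U \<and> M i (M i x) = - x \<and>
        G (M i x) = e i *\<^sub>R M i (G x) \<and> K (M i x) = - e i *\<^sub>R M i (K x)) \<and>
        (\<forall>x\<in>U. \<forall>y\<in>U. p (M i x) y = - p x (M i y))) \<and>
     (\<forall>i<n. \<forall>j<n. i \<noteq> j \<longrightarrow> (\<forall>x\<in>U. M i (M j x) = (- e i * e j) *\<^sub>R M j (M i x)))"

lemma double_systemD:
  assumes "double_system n e U p M G K"
  shows "fin_space U" "inner_on U p" "sign_family n e"
    "lin_on U G" "\<And>x. x \<in> U \<Longrightarrow> G x \<in> U" "\<And>x. x \<in> U \<Longrightarrow> G (G x) = x"
    "\<And>x y. x \<in> U \<Longrightarrow> y \<in> U \<Longrightarrow> p (G x) (G y) = p x y"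
    "lin_on U K" "\<And>x. x \<in> U \<Longrightarrow> K x \<in> U" "\<And>x. x \<in> U \<Longrightarrow> K (K x) = x"
    "\<And>x y. x \<in> U \<Longrightarrow> y \<in> U \<Longrightarrow> p (K x) (K y) = p x y"
    "\<And>i. i < n \<Longrightarrow> lin_on U (M i)" "\<And>i x. i < n \<Longrightarrow> x \<in> U \<Longrightarrow> M i x \<in> U"
    "\<And>i x. i < n \<Longrightarrow> x \<in> U \<Longrightarrow> M i (M i x) = - x"
    "\<And>i x. i < n \<Longrightarrow> x \<in> U \<Longrightarrow> G (M i x) = e i *\<^sub>R M i (G x)"
    "\<And>i x. i < n \<Longrightarrow> x \<in> U \<Longrightarrow> K (M i x) = - e i *\<^sub>R M i (K x)"
    "\<And>i x y. i < n \<Longrightarrow> x \<in> U \<Longrightarrow> y \<in> U \<Longrightarrow> p (M i x) y = - p x (M i y)"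
    "\<And>i j x. i < n \<Longrightarrow> j < n \<Longrightarrow> i \<noteq> j \<Longrightarrow> x \<in> U \<Longrightarrow> M i (M j x) = (- e i * e j) *\<^sub>R M j (M i x)"
  using assms unfolding double_system_def by blast+

lemma double_system_swap:
  assumes "double_system n e U p M G K"
  shows "double_system n (\<lambda>i. - e i) U p M K G"
proof -
  note b = double_systemD[OF assms]
  have "sign_family n (\<lambda>i. - e i)" using b(3) by (auto simp: sign_family_def)
  then show ?thesis
    unfolding double_system_def
  proof (intro conjI)
    show "\<forall>i<n. \<forall>j<n. i \<noteq> j \<longrightarrow> (\<forall>x\<in>U. M i (M j x) = (- (- e i) * - e j) *\<^sub>R M j (M i x))"
    proof (intro allI impI ballI)
      fix i j x assume "i < n" "j < n" "i \<noteq> j" "x \<in> U"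
      then show "M i (M j x) = (- (- e i) * - e j) *\<^sub>R M j (M i x)" using b(18)[of i j x] by simp
    qed
  qed (simp_all add: b(1,2,4-17))
qed

lemma double_system_clifford:
  assumes "double_system n e U p M G K"
  shows "clifford_family n e U (\<lambda>i x. G (M i x)) (\<lambda>x y. p (G x) y)"
proof -
  note b = double_systemD[OF assms]
  have sub: "subspace U" by (rule fin_space_subspace[OF b(1)])
  have ee: "e i * e i = 1" "e i * (e i * x) = x" if "i < n" for i x
    using sign_familyD[OF b(3) that] by (simp_all add: mult.assoc[symmetric])
  have MG: "M i (G x) = e i *\<^sub>R G (M i x)" if "i < n" "x \<in> U" for i x
    using b(15)[OF that] ee[OF that(1)] by simp
  have GMGM: "G (M i (G (M j x))) = e i *\<^sub>R M i (M j x)" if "i < n" "j < n" "x \<in> U" for i j x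
    using that b(5,6,13) by (simp add: MG lin_on_scale[OF b(4)])
  have sym: "p (G x) y = p x (G y)" if "x \<in> U" "y \<in> U" for x y
    using b(7)[OF that(1) b(5)[OF that(2)]] b(6)[OF that(2)] by simp
  have nsf: "nondegenerate_symmetric_form U (\<lambda>x y. p (G x) y)"
    unfolding nondegenerate_symmetric_form_def
  proof (intro conjI ballI impI)
    fix x y assume "x \<in> U" "y \<in> U"
    then show "p (G x) y = p (G y) x" using sym inner_on_sym[OF b(2)] b(5) by simp
  next
    fix x assume x: "x \<in> U" and 0: "\<forall>y\<in>U. p (G x) y = 0"
    then have "p x x = 0" using b(5)[OF x] b(7)[OF x x] by simp
    then show "x = 0" using inner_on_pos[OF b(2) x] by fastforce
  qed (use inner_on_lin[OF b(2)] b(5) in blast)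
  show ?thesis unfolding clifford_family_def
  proof (intro conjI allI impI ballI)
    fix i assume i: "i < n"
    show "lin_on U (\<lambda>x. G (M i x))" by (rule lin_on_comp[OF b(12)[OF i] _ b(4)]) (use b(13) i in auto)
    show "(\<lambda>x. G (M i x)) ` U \<subseteq> U" using b(5,13) i by auto
    { fix x assume x: "x \<in> U"
      show "G (M i (G (M i x))) = - e i *\<^sub>R x" using i x b(14) by (simp add: GMGM)
      { fix y assume y: "y \<in> U"
        show "p (G (G (M i x))) y = - p (G x) (G (M i y))" using i x y b(6,7,13,17) by simp }
      fix j assume j: "j < n" and ij: "i \<noteq> j"
      show "G (M i (G (M j x))) = - G (M j (G (M i x)))"
        using i j x ee by (simp add: GMGM b(18)[OF i j ij x]) }
  qed (use b nsf in auto)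
qed

text \<open>\<open>S = X\<^sup>* X\<close> can be written in terms of \<open>M\<^sub>0\<close>, and \<open>K\<close> is the orthogonal factor of \<open>X\<close>.\<close>

lemma polar_involution:
  assumes cl: "clifford_family n e U J b" and n: "n > 0" and e: "sign_family n e" and nf: "normal_form n e U J b p G"
    and X: "lin_on U X" "\<And>x. x \<in> U \<Longrightarrow> X x \<in> U" "\<And>x. x \<in> U \<Longrightarrow> X (X x) = x"
    and bX: "\<And>i x y. i < n \<Longrightarrow> x \<in> U \<Longrightarrow> y \<in> U \<Longrightarrow> b (J i (X x)) (X y) = - e i * b (J i x) y"
  obtains K where "double_system n e U p (\<lambda>i x. G (J i x)) G K"
proof -
  note d = clifford_familyD[OF cl] and g = normal_formD[OF nf]
  have ee: "e i * e i = 1" "e i * (e i * x) = x" if "i < n" for i x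
    using sign_familyD[OF e that] by (simp_all add: mult.assoc[symmetric])
  define M where "M i x = G (J i x)" for i x
  have MU: "M i x \<in> U" if "i < n" "x \<in> U" for i x using that d(5) g(5) by (simp add: M_def)
  have lM: "lin_on U (M i)" if "i < n" for i
    unfolding M_def by (rule lin_on_comp[OF d(4)[OF that] _ g(2)]) (use d(5) that in auto)
  have Mb: "p (M i x) y = b (J i x) y" if "i < n" "x \<in> U" "y \<in> U" for i x y
    using that d(5) g(8) by (simp add: M_def)
  have Mskew: "p (M i x) y = - p x (M i y)" if "i < n" "x \<in> U" "y \<in> U" for i x y
    using that Mb d(3,5,7) nondeg_sym[OF d(3)] inner_on_sym[OF g(1)] MU by metis
  have JG: "J i (G x) = e i *\<^sub>R G (J i x)" if "i < n" "x \<in> U" for i x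
    using g(4)[OF that] ee that by simp
  have MM: "M i (M j x) = e i *\<^sub>R J i (J j x)" if "i < n" "j < n" "x \<in> U" for i j x
    using that d(5) g(5,6) by (simp add: M_def JG lin_on_scale[OF g(2)])
  have Msq: "M i (M i x) = - x" if "i < n" "x \<in> U" for i x
    using that d(6) ee by (simp add: MM)
  have Morth: "p (M i x) (M i y) = p x y" if "i < n" "x \<in> U" "y \<in> U" for i x y
    using Mskew[OF that(1,2) MU[OF that(1,3)]] Msq[OF that(1,3)] inner_on_neg(2)[OF g(1) d(2) that(2,3)] by simp
  have neg: "p (- x) y = - p x y" "p x (- y) = - p x y" if "x \<in> U" "y \<in> U" for x y
    using inner_on_neg[OF g(1) d(2) that] by auto
  have XM: "p (M i (X x)) (X y) = - e i * p (M i x) y" if "i < n" "x \<in> U" "y \<in> U" for i x y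
    using that bX X(2) by (simp add: Mb)
  \<comment> \<open>By \<open>XM\<close>, the adjoint of \<open>X\<close> composed with
    \<open>M 0\<close> and then \<open>X\<close> is \<open>- e 0\<close> times \<open>M 0\<close>.
    As \<open>X\<close> and \<open>M 0\<close> are invertible with squares 1 and -1, the adjoint of
    \<open>X\<close> is \<open>e 0\<close> times M 0 X M 0. This yields the formula for the adjoint
    times \<open>X\<close>.\<close>
  define S where "S x = e 0 *\<^sub>R M 0 (X (M 0 (X x)))" for x
  have XU: "X ` U \<subseteq> U" using X(2) by auto
  have SU: "S x \<in> U" if "x \<in> U" for x using that X(2) MU n by (simp add: S_def subspace_scale[OF d(2)])
  have lMX: "lin_on U (\<lambda>x. M 0 (X x))" by (rule lin_on_comp[OF X(1) XU lM[OF n]])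
  have lS: "lin_on U S"
    unfolding S_def by (rule lin_on_scaleR[OF lin_on_comp[OF lMX _ lMX]]) (use X(2) MU n in auto)
  have Sa: "p (S x) y = p (X x) (X y)" if x: "x \<in> U" and y: "y \<in> U" for x y
  proof -
    let ?a = "X (M 0 (X x))"
    have a: "?a \<in> U" "X ?a = M 0 (X x)" using X(2,3) MU n x by auto
    have "p (X x) (X y) = - p (M 0 (X ?a)) (X y)"
      using a(2) Msq[OF n] X(2) x y by (simp add: neg)
    also have "\<dots> = e 0 * p (M 0 ?a) y" using XM[OF n a(1) y] by simp
    also have "\<dots> = p (S x) y" unfolding S_def using inner_on_scale(1)[OF g(1) d(2) MU[OF n a(1)] y] by simp
    finally show ?thesis by simp
  qed
  \<comment> \<open>\<open>X\<close> is an involution, so two of the factors in S X S cancel. This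
    relation and the next one are of the kind that passes to the root \<open>P\<close>.\<close>
  have SXS: "S (X (S x)) = X x" if x: "x \<in> U" for x
  proof (rule nondeg_eqI[OF inner_on_nondeg[OF g(1)] d(2)])
    show "S (X (S x)) \<in> U" "X x \<in> U" using SU X(2) x by auto
    fix y assume y: "y \<in> U"
    show "p (S (X (S x))) y = p (X x) y"
      using x y SU X(2,3) by (simp add: Sa)
  qed
  have SMS: "S (M i (S x)) = M i x" if i: "i < n" and x: "x \<in> U" for i x
  proof (rule nondeg_eqI[OF inner_on_nondeg[OF g(1)] d(2)])
    show "S (M i (S x)) \<in> U" "M i x \<in> U" using SU MU i x by auto
    fix y assume y: "y \<in> U"
    have m: "X y \<in> U" "M i (X y) \<in> U" "X (M i (X y)) \<in> U" "M i (S x) \<in> U" "X (M i (S x)) \<in> U" "X x \<in> U" "S x \<in> U"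
      using X(2) MU SU i x y by auto
    have "p (S (M i (S x))) y = p (X (M i (S x))) (X y)" using Sa m y by simp
    also have "\<dots> = p (M i (X (M i (S x)))) (M i (X y))" using Morth[OF i m(5,1)] by simp
    also have "\<dots> = - e i * p (M i (M i (S x))) (X (M i (X y)))"
      using XM[OF i m(4,3)] X(3)[OF m(2)] by simp
    also have "\<dots> = e i * p (S x) (X (M i (X y)))" using Msq[OF i m(7)] neg(1)[OF m(7,3)] by simp
    also have "\<dots> = e i * p (X x) (M i (X y))" using Sa[OF x m(3)] X(3)[OF m(2)] by simp
    also have "\<dots> = - e i * p (M i (X x)) (X y)" using Mskew[OF i m(6,1)] by simp
    also have "\<dots> = p (M i x) y" using XM[OF i x y] ee[OF i] by simp
    finally show "p (S (M i (S x))) y = p (M i x) y" .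
  qed
  obtain P where P: "lin_on U P" "\<And>x. x \<in> U \<Longrightarrow> P x \<in> U" "\<And>x y. x \<in> U \<Longrightarrow> y \<in> U \<Longrightarrow> p (P x) y = p x (P y)"
    "\<And>x. x \<in> U \<Longrightarrow> P (P x) = S x"
    and N: "\<And>N x. lin_on U N \<Longrightarrow> (\<And>x. x \<in> U \<Longrightarrow> N x \<in> U) \<Longrightarrow> (\<And>x. x \<in> U \<Longrightarrow> S (N (S x)) = N x) \<Longrightarrow> x \<in> U \<Longrightarrow> P (N (P x)) = N x"
  proof (rule positive_sqrt[OF g(1) d(1) lS SU])
    show "p (S x) y = p x (S y)" if "x \<in> U" "y \<in> U" for x y
      using Sa that SU inner_on_sym[OF g(1)] X(2) by metis
    show "p (S x) x > 0" if "x \<in> U" "x \<noteq> 0" for x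
    proof -
      have "X x \<noteq> 0" using X(3)[OF that(1)] that(2) lin_on_zero[OF X(1) d(2)] by metis
      then show ?thesis using Sa[OF that(1,1)] inner_on_pos[OF g(1) X(2)[OF that(1)]] by simp
    qed
  qed auto
  have PXP: "P (X (P x)) = X x" if "x \<in> U" for x by (rule N[OF X(1,2) SXS that])
  have PMP: "P (M i (P x)) = M i x" if "i < n" "x \<in> U" for i x by (rule N[OF lM MU SMS that(2)]) (use that in auto)
  \<comment> \<open>The orthogonal factor of \<open>X\<close> is \<open>X\<close> times the inverse
    of \<open>P\<close>. By \<open>PXP\<close> this equals \<open>P\<close> after \<open>X\<close>,
    so no inverse is required, and K K = P X P X = X X = 1.\<close>
  define K where "K x = P (X x)" for x
  have KU: "K x \<in> U" if "x \<in> U" for x using that X(2) P(2) by (simp add: K_def)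
  have KK: "K (K x) = x" if "x \<in> U" for x using that X(2,3) by (simp add: K_def PXP)
  have Korth: "p (K x) (K y) = p x y" if "x \<in> U" "y \<in> U" for x y
  proof -
    have m: "X x \<in> U" "X y \<in> U" "P (X y) \<in> U" using that X(2) P(2) by auto
    have "p (K x) (K y) = p (S (X y)) (X x)"
      using m SU by (simp add: K_def P(3,4) inner_on_sym[OF g(1), of "X x"])
    also have "\<dots> = p y x" using Sa[OF m(2,1)] X(3) that by simp
    finally show ?thesis using inner_on_sym[OF g(1)] that by simp
  qed
  have KM: "K (M i x) = - e i *\<^sub>R M i (K x)" if i: "i < n" and x: "x \<in> U" for i x
  proof (rule nondeg_eqI[OF inner_on_nondeg[OF g(1)] d(2)])
    show "K (M i x) \<in> U" by (rule KU[OF MU[OF i x]])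
    show "- e i *\<^sub>R M i (K x) \<in> U" by (rule subspace_scale[OF d(2) MU[OF i KU[OF x]]])
    fix y assume y: "y \<in> U"
    have m: "K y \<in> U" "X x \<in> U" "P (X x) \<in> U" "X (K y) \<in> U" using KU X(2) P(2) x y by auto
    \<comment> \<open>Write \<open>y\<close> as \<open>P (X (K y))\<close>. Then \<open>PMP\<close>
      absorbs the two factors \<open>P\<close>, and \<open>XM\<close> the two factors
      \<open>X\<close>.\<close>
    have "p (M i (K x)) y = p (M i (P (X x))) (P (X (K y)))" using KK[OF y] by (simp add: K_def)
    also have "\<dots> = p (M i (X x)) (X (K y))" using m MU[OF i m(3)] PMP[OF i m(2)] by (simp add: P(3)[symmetric])
    also have "\<dots> = - e i * p (M i x) (K y)" by (rule XM[OF i x m(1)])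
    also have "p (M i x) (K y) = p (K (M i x)) y"
      using Korth[OF MU[OF i x] m(1)] KK[OF y] by simp
    finally have "- e i * p (M i (K x)) y = p (K (M i x)) y" using ee[OF i] by simp
    then show "p (K (M i x)) y = p (- e i *\<^sub>R M i (K x)) y"
      using inner_on_scale(1)[OF g(1) d(2) MU[OF i KU[OF x]] y, of "- e i"] by simp
  qed
  have anti: "M i (M j x) = (- e i * e j) *\<^sub>R M j (M i x)" if "i < n" "j < n" "i \<noteq> j" "x \<in> U" for i j x
    using that ee d(8)[OF that] by (simp add: MM)
  have GM: "G (M i x) = e i *\<^sub>R M i (G x)" if "i < n" "x \<in> U" for i x
    using that d(5) g(5,6) ee by (simp add: M_def JG lin_on_scale[OF g(2)])
  have "double_system n e U p M G K"
    unfolding double_system_def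
  proof (intro conjI)
    show "lin_on U K" unfolding K_def by (rule lin_on_comp[OF X(1) XU P(1)])
    show "\<forall>i<n. \<forall>j<n. i \<noteq> j \<longrightarrow> (\<forall>x\<in>U. M i (M j x) = (- e i * e j) *\<^sub>R M j (M i x))"
      using anti by blast
  qed (simp_all add: d(1) g(1,2,5-7) e KU KK Korth KM GM lM MU Msq Mskew)
  then show thesis using that unfolding M_def by blast
qed

text \<open>Both modules get a normal form, but \<open>A\<close> does not carry one inner product to
  the other. Only the involution of the second module is pulled back; it reverses the skew forms up
  to the signs, and the polar decomposition then makes it orthogonal for the inner product of the
  first module.\<close>

lemma double_system_exists:
  assumes rs: "r \<noteq> s" and V: "minimal_admissible r s V" and W: "minimal_admissible s r W"
    and iso: "lie_isomorphic (pseudo_H_algebra r s V) (pseudo_H_algebra s r W)"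
  obtains p M G K where "double_system (r + s) (sig_sign r) (module_space V) p M G K"
    "dim (module_space V) = dim (module_space W)"
proof -
  let ?U = "module_space V" and ?U' = "module_space W"
  let ?J = "\<lambda>i. act V (pm_unit i)"
  have adm: "admissible r s V" "admissible s r W" and nz: "?U \<noteq> {0}" "?U' \<noteq> {0}"
    using V W unfolding minimal_admissible_def by blast+
  obtain A L where A: "lin_on ?U A" "bij_betw A ?U ?U'"
    and cl': "clifford_family (r + s) (\<lambda>i. - sig_sign r i) ?U' L (module_form W)"
    and ir': "irreducible_family (r + s) ?U' L (module_form W)"
    and rel: "\<And>i x y. i < r + s \<Longrightarrow> x \<in> ?U \<Longrightarrow> y \<in> ?U \<Longrightarrow>
       module_form W (L i (A x)) (A y) = module_form V (?J i x) y"
    by (rule opposite_family[OF rs V W iso]) (rule that)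
  note cl = clifford_standard[OF adm(1)]
  note d = clifford_familyD[OF cl] and d' = clifford_familyD[OF cl']
  have sf: "sign_family (r + s) (\<lambda>i. - sig_sign r i)" by (simp add: sign_family_def sig_sign_def)
  obtain p G where nf: "normal_form (r + s) (sig_sign r) ?U ?J (module_form V) p G"
    by (rule normal_form_exists[OF cl nz(1) minimal_irr[OF V] sign_family_sig])
  obtain p' G' where nf': "normal_form (r + s) (\<lambda>i. - sig_sign r i) ?U' L (module_form W) p' G'"
    by (rule normal_form_exists[OF cl' nz(2) ir' sf])
  note g' = normal_formD[OF nf']
  \<comment> \<open>The involution \<open>G'\<close> conjugated by \<open>A\<close>. It is an
    involution on the first module, in general not symmetric.\<close>
  define X where "X x = inv_into ?U A (G' (A x))" for x
  have AU: "A x \<in> ?U'" if "x \<in> ?U" for x using bij_betw_apply[OF A(2) that] .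
  have BU: "inv_into ?U A y \<in> ?U" if "y \<in> ?U'" for y using bij_betw_apply[OF bij_betw_inv_into[OF A(2)] that] .
  have AB: "A (inv_into ?U A y) = y" if "y \<in> ?U'" for y using bij_betw_inv_into_right[OF A(2) that] .
  have BA: "inv_into ?U A (A x) = x" if "x \<in> ?U" for x using bij_betw_inv_into_left[OF A(2) that] .
  have AX: "A (X x) = G' (A x)" if "x \<in> ?U" for x using that by (simp add: X_def AB AU g'(5))
  have "lin_on ?U (\<lambda>x. G' (A x))" by (rule lin_on_comp[OF A(1) _ g'(2)]) (use AU in auto)
  then have lX: "lin_on ?U X"
    unfolding X_def by (rule lin_on_comp[OF _ _ lin_on_inv_into[OF A(1) d(2) A(2)]]) (use AU g'(5) in auto)
  have XU: "X x \<in> ?U" if "x \<in> ?U" for x using that by (simp add: X_def BU AU g'(5))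
  have XX: "X (X x) = x" if "x \<in> ?U" for x
    using that AX[OF that] by (simp add: X_def[of "X x"] g'(6) AU BA)
  have "r + s > 0" using rs by auto
  have bX: "module_form V (?J i (X x)) (X y) = - sig_sign r i * module_form V (?J i x) y"
    if i: "i < r + s" and x: "x \<in> ?U" and y: "y \<in> ?U" for i x y
  proof -
    have m: "A x \<in> ?U'" "A y \<in> ?U'" "L i (A x) \<in> ?U'" "G' (A x) \<in> ?U'" "L i (G' (A x)) \<in> ?U'"
      using AU x y d'(5)[OF i] g'(5) by auto
    have "module_form V (?J i (X x)) (X y) = p' (G' (L i (G' (A x)))) (G' (A y))"
      using rel[OF i XU[OF x] XU[OF y]] AX x y g'(5,8) m by simp
    also have "\<dots> = p' (L i (G' (A x))) (A y)" by (rule g'(7)[OF m(5,2)])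
    also have "\<dots> = - sig_sign r i * p' (- sig_sign r i *\<^sub>R L i (G' (A x))) (A y)"
      using inner_on_scale(1)[OF g'(1) d'(2) m(5,2), of "- sig_sign r i"] by simp
    also have "- sig_sign r i *\<^sub>R L i (G' (A x)) = G' (L i (A x))" using g'(4)[OF i m(1)] by simp
    also have "p' (G' (L i (A x))) (A y) = module_form V (?J i x) y"
      using g'(8)[OF m(3,2)] rel[OF i x y] by simp
    finally show ?thesis .
  qed
  obtain K where K: "double_system (r + s) (sig_sign r) ?U p (\<lambda>i x. G (?J i x)) G K"
  proof (rule polar_involution[where J = ?J and b = "module_form V" and X = X and p = p and G = G
          and e = "sig_sign r" and n = "r + s" and U = ?U, OF cl \<open>r + s > 0\<close> sign_family_sig nf lX])
    show "X x \<in> ?U" if "x \<in> ?U" for x by (rule XU[OF that])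
    show "X (X x) = x" if "x \<in> ?U" for x by (rule XX[OF that])
    show "module_form V (?J i (X x)) (X y) = - sig_sign r i * module_form V (?J i x) y"
      if "i < r + s" "x \<in> ?U" "y \<in> ?U" for i x y by (rule bX[OF that])
  qed (rule that)
  have "dim ?U = dim ?U'"
    using lin_on_inj_dim[OF A(1) d(1) bij_betw_imp_inj_on[OF A(2)]] bij_betw_imp_surj_on[OF A(2)] by simp
  then show thesis using that K by blast
qed

section \<open>Tensor products with Pauli matrices\<close>

type_synonym bit4 = "bool \<times> bool \<times> bool \<times> bool"

fun xor4 :: "bit4 \<Rightarrow> bit4 \<Rightarrow> bit4" where
  "xor4 (a, b, c, d) (a', b', c', d') = (a \<noteq> a', b \<noteq> b', c \<noteq> c', d \<noteq> d')"

text \<open>The characters of the group (Z/2)^4: for a fixed first argument, multiplicative with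
  respect to \<open>xor4\<close>.\<close>

fun psign :: "bit4 \<Rightarrow> bit4 \<Rightarrow> real" where
  "psign (a, b, c, d) (a', b', c', d') = (if a \<and> a' then - 1 else 1) * (if b \<and> b' then - 1 else 1) *
     (if c \<and> c' then - 1 else 1) * (if d \<and> d' then - 1 else 1)"

declare split_paired_All [simp del]

lemma xor4_assoc: "xor4 (xor4 a b) c = xor4 a (xor4 b c)"
  by (cases a; cases b; cases c) auto

lemma xor4_comm: "xor4 a b = xor4 b a"
  by (cases a; cases b) auto

lemma xor4_cancel [simp]: "xor4 (xor4 a b) b = a"
  by (cases a; cases b) auto

lemma psign_comm: "psign a b = psign b a"
  by (cases a; cases b) (simp add: conj_commute)

lemma psign_xor: "psign a (xor4 b c) = psign a b * psign a c"
proof -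
  have "(if p \<and> q \<noteq> q' then - 1 else 1 :: real) = (if p \<and> q then - 1 else 1) * (if p \<and> q' then - 1 else 1)" for p q q'
    by auto
  then show ?thesis by (cases a; cases b; cases c) (simp only: psign.simps xor4.simps mult_ac)
qed

lemma psign_xor2: "psign (xor4 b c) a = psign b a * psign c a"
  using psign_xor[of a b c] by (simp only: psign_comm[of _ a])

lemma psign_sq [simp]: "psign a b * psign a b = 1" "psign a b * (psign a b * x) = x"
proof -
  have "psign a b = 1 \<or> psign a b = - 1" by (cases a; cases b) simp
  then show "psign a b * psign a b = 1" "psign a b * (psign a b * x) = x" by auto
qed

lemma bij_xor4: "bij (\<lambda>i. xor4 i a)"
  by (rule bij_betw_byWitness[of _ "\<lambda>i. xor4 i a"]) auto

type_synonym pauli = "bit4 \<times> bit4"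

text \<open>In a pair the first entry is the shift and the second the sign pattern.
  \<open>csign\<close> is the factor picked up when two such matrices are exchanged, and
  \<open>qsign\<close> is the square of one of them.\<close>

definition csign :: "pauli \<Rightarrow> pauli \<Rightarrow> real" where
  "csign x y = psign (snd x) (fst y) * psign (snd y) (fst x)"

definition qsign :: "pauli \<Rightarrow> real" where
  "qsign x = psign (snd x) (fst x)"

text \<open>
  The tensor product of \<open>f\<close> with the signed permutation \<open>e\<^sub>i \<mapsto> \<plusminus> e\<^sub>i\<^sub>+\<^sub>a\<close> of \<open>\<real>\<^sup>1\<^sup>6\<close>, a product of Pauli
  matrices.
\<close>

definition pauli_tensor :: "('u::real_vector \<Rightarrow> 'u) \<Rightarrow> pauli \<Rightarrow> 'u ^ bit4 \<Rightarrow> 'u ^ bit4" where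
  "pauli_tensor f x v = (\<chi> i. psign (snd x) i *\<^sub>R f (v $ xor4 i (fst x)))"

definition pow16 :: "'u::real_vector set \<Rightarrow> ('u ^ bit4) set" where
  "pow16 U = {v. \<forall>i. v $ i \<in> U}"

definition pow16_form :: "('u \<Rightarrow> 'u \<Rightarrow> real) \<Rightarrow> 'u ^ bit4 \<Rightarrow> 'u ^ bit4 \<Rightarrow> real" where
  "pow16_form p v w = (\<Sum>i\<in>UNIV. p (v $ i) (w $ i))"

lemma subspace_pow16: "subspace U \<Longrightarrow> subspace (pow16 U)"
  by (auto simp: subspace_def pow16_def)

lemma pow16_nth: "v \<in> pow16 U \<Longrightarrow> v $ i \<in> U"
  by (simp add: pow16_def)

lemma pauli_tensor_mem: "subspace U \<Longrightarrow> (\<And>x. x \<in> U \<Longrightarrow> f x \<in> U) \<Longrightarrow> v \<in> pow16 U \<Longrightarrow> pauli_tensor f x v \<in> pow16 U"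
  by (auto simp: pow16_def pauli_tensor_def subspace_scale)

lemma pauli_tensor_lin: "lin_on U f \<Longrightarrow> lin_on (pow16 U) (pauli_tensor f x)"
  by (auto simp: lin_on_def pow16_def pauli_tensor_def vec_eq_iff scaleR_add_right mult.commute)

text \<open>Shifts and sign patterns add up. The extra sign arises as the pattern of the inner
  matrix is moved past the shift of the outer one.\<close>

lemma pauli_tensor_tens:
  assumes f: "lin_on U f" and g: "\<And>x. x \<in> U \<Longrightarrow> g x \<in> U" and v: "v \<in> pow16 U"
  shows "pauli_tensor f x (pauli_tensor g y v) = psign (snd y) (fst x) *\<^sub>R pauli_tensor (\<lambda>u. f (g u)) (xor4 (fst x) (fst y), xor4 (snd x) (snd y)) v"
proof (subst vec_eq_iff, rule allI)
  fix i
  have "pauli_tensor f x (pauli_tensor g y v) $ i =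
      (psign (snd x) i * psign (snd y) (xor4 i (fst x))) *\<^sub>R f (g (v $ xor4 (xor4 i (fst x)) (fst y)))"
    by (simp add: pauli_tensor_def lin_on_scale[OF f g[OF pow16_nth[OF v]]])
  also have "psign (snd x) i * psign (snd y) (xor4 i (fst x)) = psign (snd y) (fst x) * psign (xor4 (snd x) (snd y)) i"
    by (simp add: psign_xor psign_xor2 mult_ac)
  finally show "pauli_tensor f x (pauli_tensor g y v) $ i =
      (psign (snd y) (fst x) *\<^sub>R pauli_tensor (\<lambda>u. f (g u)) (xor4 (fst x) (fst y), xor4 (snd x) (snd y)) v) $ i"
    by (simp add: pauli_tensor_def xor4_assoc)
qed

lemma pauli_tensor_commute:
  assumes "subspace U" "lin_on U f" "lin_on U g" "\<And>x. x \<in> U \<Longrightarrow> f x \<in> U" "\<And>x. x \<in> U \<Longrightarrow> g x \<in> U"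
    and s: "\<And>x. x \<in> U \<Longrightarrow> f (g x) = s *\<^sub>R g (f x)" and v: "v \<in> pow16 U"
  shows "pauli_tensor f x (pauli_tensor g y v) = (s * csign x y) *\<^sub>R pauli_tensor g y (pauli_tensor f x v)"
proof -
  have "pauli_tensor (\<lambda>u. f (g u)) z v = s *\<^sub>R pauli_tensor (\<lambda>u. g (f u)) z v" for z
    using s pow16_nth[OF v] by (simp add: pauli_tensor_def vec_eq_iff mult.commute)
  then show ?thesis
    using pauli_tensor_tens[where f = f and g = g, OF assms(2,5) v, of x y]
      pauli_tensor_tens[where f = g and g = f, OF assms(3,4) v, of y x]
    by (simp add: csign_def xor4_comm[of "fst y"] xor4_comm[of "snd y"] mult_ac)
qed

lemma pauli_tensor_square:
  assumes "lin_on U f" "\<And>x. x \<in> U \<Longrightarrow> f x \<in> U" "\<And>x. x \<in> U \<Longrightarrow> f (f x) = s *\<^sub>R x" and v: "v \<in> pow16 U"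
  shows "pauli_tensor f x (pauli_tensor f x v) = (s * qsign x) *\<^sub>R v"
proof -
  have z: "xor4 a a = (False, False, False, False)" "psign (False, False, False, False) a = 1"
    "xor4 a (False, False, False, False) = a" for a
    by (cases a; simp)+
  show ?thesis
  proof (subst pauli_tensor_tens[where f = f and g = f, OF assms(1,2) v])
    show "psign (snd x) (fst x) *\<^sub>R pauli_tensor (\<lambda>u. f (f u)) (xor4 (fst x) (fst x), xor4 (snd x) (snd x)) v = (s * qsign x) *\<^sub>R v"
      using assms(3) pow16_nth[OF v] by (simp add: pauli_tensor_def vec_eq_iff qsign_def z mult.commute)
  qed
qed

lemma inner_on_pow16_form:
  assumes p: "inner_on U p" and U: "subspace U"
  shows "inner_on (pow16 U) (pow16_form p)"
  unfolding inner_on_def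
proof (intro conjI ballI impI)
  fix x y assume "x \<in> pow16 U" "y \<in> pow16 U"
  then show "pow16_form p x y = pow16_form p y x"
    using inner_on_sym[OF p] by (simp add: pow16_form_def pow16_def)
next
  fix x assume x: "x \<in> pow16 U"
  show "lin_on (pow16 U) (pow16_form p x)"
    unfolding pow16_form_def
  proof (rule lin_on_setsum)
    fix i
    show "lin_on (pow16 U) (\<lambda>y. p (x $ i) (y $ i))"
      using inner_on_lin[OF p pow16_nth[OF x, of i]] by (auto simp: lin_on_def pow16_def)
  qed
  assume "x \<noteq> 0"
  then obtain i where i: "x $ i \<noteq> 0" by (auto simp: vec_eq_iff)
  have nn: "p (x $ j) (x $ j) \<ge> 0" for j
    using inner_on_pos[OF p pow16_nth[OF x, of j]] lin_on_zero[OF inner_on_lin[OF p subspace_0[OF U]] U]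
    by (cases "x $ j = 0") auto
  show "pow16_form p x x > 0" unfolding pow16_form_def
    by (rule sum_pos2[of _ i]) (use nn inner_on_pos[OF p pow16_nth[OF x] i] in auto)
qed

text \<open>A signed permutation matrix is orthogonal, so its transpose is its inverse, which is
  \<open>qsign x\<close> times the matrix itself.\<close>

lemma pow16_form_pauli:
  assumes p: "inner_on U p" and U: "subspace U" and f: "\<And>x. x \<in> U \<Longrightarrow> f x \<in> U"
    and s: "\<And>x y. x \<in> U \<Longrightarrow> y \<in> U \<Longrightarrow> p (f x) y = s * p x (f y)"
    and v: "v \<in> pow16 U" and w: "w \<in> pow16 U"
  shows "pow16_form p (pauli_tensor f x v) w = (s * qsign x) * pow16_form p v (pauli_tensor f x w)"
proof -
  have "pow16_form p (pauli_tensor f x v) w = (\<Sum>i\<in>UNIV. psign (snd x) i * p (f (v $ xor4 i (fst x))) (w $ i))"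
    using f pow16_nth[OF v] pow16_nth[OF w] by (simp add: pow16_form_def pauli_tensor_def inner_on_scale[OF p U])
  also have "\<dots> = (\<Sum>i\<in>UNIV. psign (snd x) (xor4 i (fst x)) * p (f (v $ i)) (w $ xor4 i (fst x)))"
    by (subst sum.reindex_bij_betw[OF bij_xor4[of "fst x"], symmetric]) simp
  also have "\<dots> = (\<Sum>i\<in>UNIV. (s * qsign x) * p (v $ i) (psign (snd x) i *\<^sub>R f (w $ xor4 i (fst x))))"
    using f pow16_nth[OF v] pow16_nth[OF w]
    by (simp add: inner_on_scale[OF p U] s psign_xor qsign_def mult_ac)
  finally show ?thesis by (simp add: pow16_form_def pauli_tensor_def sum_distrib_left)
qed

lemma pow16_fin_dim:
  assumes U: "fin_space (U :: 'u::real_vector set)"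
  shows "fin_space (pow16 U)" "dim (pow16 U) \<le> 16 * dim U"
proof -
  obtain B where B: "finite B" "independent B" "U = span B" "card B = dim U" "B \<subseteq> U"
    using fin_space_basis[OF U] by metis
  define ax :: "bit4 \<Rightarrow> 'u \<Rightarrow> 'u ^ bit4" where "ax k u = (\<chi> i. if i = k then u else 0)" for k u
  define C where "C = (\<lambda>(k, u). ax k u) ` (UNIV \<times> B)"
  have lin: "linear (ax k)" for k by (rule linearI) (auto simp: ax_def vec_eq_iff)
  have sub: "subspace U" by (rule fin_space_subspace[OF U])
  have "C \<subseteq> pow16 U" using B(5) subspace_0[OF sub] by (auto simp: C_def ax_def pow16_def)
  then have "span C \<subseteq> pow16 U" by (rule span_minimal[OF _ subspace_pow16[OF sub]])
  moreover have "pow16 U \<subseteq> span C"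
  proof
    fix v assume v: "v \<in> pow16 U"
    have "v = (\<Sum>k\<in>UNIV. ax k (v $ k))"
      by (simp add: vec_eq_iff ax_def)
    moreover have "ax k (v $ k) \<in> span C" for k
    proof -
      have "ax k (v $ k) \<in> ax k ` span B" using pow16_nth[OF v] B(3) by blast
      also have "\<dots> = span (ax k ` B)" by (rule linear_span_image[OF lin, symmetric])
      also have "\<dots> \<subseteq> span C" by (rule span_mono) (auto simp: C_def)
      finally show ?thesis .
    qed
    ultimately show "v \<in> span C" by (metis (no_types, lifting) span_sum)
  qed
  ultimately have sp: "pow16 U = span C" by blast
  have fC: "finite C" using B(1) by (simp add: C_def)
  show "fin_space (pow16 U)" unfolding fin_space_def using sp fC by blast
  have "card C \<le> card ((UNIV :: bit4 set) \<times> B)" unfolding C_def by (rule card_image_le) (use B(1) in simp)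
  also have "\<dots> = 16 * dim U" by (simp add: card_cartesian_product B(4) card_prod)
  finally have "card C \<le> 16 * dim U" .
  moreover have "dim (pow16 U) \<le> card C" by (rule dim_le_card) (use sp fC in auto)
  ultimately show "dim (pow16 U) \<le> 16 * dim U" by simp
qed

text \<open>
  These are the relations of \<^const>\<open>double_system\<close> for a family of Pauli matrices \<open>k\<close> on \<open>\<real>\<^sup>1\<^sup>6\<close> with \<open>G = y\<close>
  and \<open>K = x\<close>, together with \<open>x y = y x\<close>.
\<close>

definition pauli_sys :: "nat \<Rightarrow> (nat \<Rightarrow> real) \<Rightarrow> (nat \<Rightarrow> pauli) \<Rightarrow> pauli \<Rightarrow> pauli \<Rightarrow> bool" where
  "pauli_sys m e k x y \<longleftrightarrow> qsign x = 1 \<and> qsign y = 1 \<and> csign x y = 1 \<and>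
     (\<forall>l<m. qsign (k l) = - 1 \<and> csign x (k l) = - e l \<and> csign y (k l) = e l) \<and>
     (\<forall>l<m. \<forall>l'<m. l \<noteq> l' \<longrightarrow> csign (k l) (k l') = - e l * e l')"

lemma csign_comm: "csign x y = csign y x"
  by (simp add: csign_def mult.commute)

lemma csign_self [simp]: "csign x x = 1"
  by (simp add: csign_def)

text \<open>An old generator \<open>M j\<close> must pass a new one \<open>k l\<close> with the sign
  \<open>- e j * e' l\<close>. On the first factor there is no sign, so the Pauli matrix attached to
  \<open>M j\<close> has to supply it: this is \<open>x\<close> for \<open>e j = 1\<close> and
  \<open>y\<close> for \<open>e j = - 1\<close>. The same signs make \<open>G\<close> with
  \<open>y\<close> and \<open>K\<close> with \<open>x\<close> pass the new generators correctly. As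
  \<open>x\<close> and \<open>y\<close> commute, the relations of the old generators are unaffected.
  The map \<open>t\<close> says which indices are old and which are new.\<close>

lemma double_system_tensor:
  fixes t :: "nat \<Rightarrow> nat + nat"
  assumes b: "double_system n e U p M G K" and k: "pauli_sys m e' k x y" and e': "sign_family m e'"
    and t: "inj_on t {..<N}" "\<And>i j. i < N \<Longrightarrow> t i = Inl j \<Longrightarrow> j < n" "\<And>i l. i < N \<Longrightarrow> t i = Inr l \<Longrightarrow> l < m"
    and e: "\<And>i. i < N \<Longrightarrow> e'' i = (case t i of Inl j \<Rightarrow> e j | Inr l \<Rightarrow> e' l)"
  shows "double_system N e'' (pow16 U) (pow16_form p)
     (\<lambda>i. case t i of Inl j \<Rightarrow> pauli_tensor (M j) (if e j = 1 then x else y) | Inr l \<Rightarrow> pauli_tensor (\<lambda>u. u) (k l))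
     (pauli_tensor G y) (pauli_tensor K x)"
proof -
  note b = double_systemD[OF b]
  have sub: "subspace U" by (rule fin_space_subspace[OF b(1)])
  define F where "F i = (case t i of Inl j \<Rightarrow> M j | Inr l \<Rightarrow> (\<lambda>u. u))" for i
  define X where "X i = (case t i of Inl j \<Rightarrow> if e j = 1 then x else y | Inr l \<Rightarrow> k l)" for i
  have fam: "(case t i of Inl j \<Rightarrow> pauli_tensor (M j) (if e j = 1 then x else y) | Inr l \<Rightarrow> pauli_tensor (\<lambda>u. u) (k l)) = pauli_tensor (F i) (X i)" for i
    by (simp add: F_def X_def split: sum.split)
  note k' = k[unfolded pauli_sys_def]
  have q: "qsign x = 1" "qsign y = 1" "csign x y = 1" "csign y x = 1" using k' csign_comm[of x y] by auto
  have qk: "qsign (k l) = - 1" "csign x (k l) = - e' l" "csign y (k l) = e' l"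
    "csign (k l) x = - e' l" "csign (k l) y = e' l" if "l < m" for l
    using k' that csign_comm[of x "k l"] csign_comm[of y "k l"] by simp_all
  have qkk: "csign (k l) (k l') = - e' l * e' l'" if "l < m" "l' < m" "l \<noteq> l'" for l l'
    using k' that by blast
  have ej: "e j = 1 \<or> e j = - 1" if "j < n" for j using b(3) that by (simp add: sign_family_def)
  have lF: "lin_on U (F i)" if "i < N" for i
    using b(12) t(2)[OF that] by (auto simp: F_def lin_on_id split: sum.split)
  have FU: "F i u \<in> U" if "i < N" "u \<in> U" for i u
    using b(13) t(2)[OF that(1)] that(2) by (auto simp: F_def split: sum.split)
  \<comment> \<open>In this and the next three facts a sign splits into a factor \<open>s\<close>
    from \<open>U\<close> and one from the Pauli matrix. Here the -1 comes from \<open>M j\<close>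
    for an old index and from \<open>k l\<close> for a new one.\<close>
  have sq: "\<exists>s. s * qsign (X i) = - 1 \<and> (\<forall>u\<in>U. F i (F i u) = s *\<^sub>R u) \<and> (\<forall>u\<in>U. \<forall>w\<in>U. p (F i u) w = s * p u (F i w))"
    if i: "i < N" for i
  proof (cases "t i")
    case (Inl j)
    then show ?thesis using t(2)[OF i Inl] b(14,17) q(1,2) by (intro exI[of _ "- 1"]) (auto simp: F_def X_def)
  next
    case (Inr l)
    then show ?thesis using t(3)[OF i Inr] qk(1) by (intro exI[of _ 1]) (auto simp: F_def X_def)
  qed
  have cG: "\<exists>s. s * csign y (X i) = e'' i \<and> (\<forall>u\<in>U. G (F i u) = s *\<^sub>R F i (G u))" if i: "i < N" for i
  proof (cases "t i")
    case (Inl j)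
    then show ?thesis using t(2)[OF i Inl] b(15) q(4) e[OF i] by (intro exI[of _ "e j"]) (auto simp: F_def X_def)
  next
    case (Inr l)
    then show ?thesis using t(3)[OF i Inr] qk(3) e[OF i] by (intro exI[of _ 1]) (auto simp: F_def X_def)
  qed
  have cK: "\<exists>s. s * csign x (X i) = - e'' i \<and> (\<forall>u\<in>U. K (F i u) = s *\<^sub>R F i (K u))" if i: "i < N" for i
  proof (cases "t i")
    case (Inl j)
    then show ?thesis using t(2)[OF i Inl] b(16) q(3) e[OF i] by (intro exI[of _ "- e j"]) (auto simp: F_def X_def)
  next
    case (Inr l)
    then show ?thesis using t(3)[OF i Inr] qk(2) e[OF i] by (intro exI[of _ 1]) (auto simp: F_def X_def)
  qed
  have cF: "\<exists>s. s * csign (X i) (X j) = - e'' i * e'' j \<and> (\<forall>u\<in>U. F i (F j u) = s *\<^sub>R F j (F i u))"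
    if i: "i < N" and j: "j < N" and ij: "i \<noteq> j" for i j
  proof -
    have ne: "t i \<noteq> t j" using inj_onD[OF t(1)] i j ij by blast
    show ?thesis
    proof (cases "t i"; cases "t j")
      fix a c assume ac: "t i = Inl a" "t j = Inl c"
      have "a < n" "c < n" "a \<noteq> c" using t(2) i j ac ne by auto
      then show ?thesis
        using ac e[OF i] e[OF j] q b(18)[of a c]
        by (intro exI[of _ "- e a * e c"]) (simp add: F_def X_def)
    next
      fix a c assume ac: "t i = Inl a" "t j = Inr c"
      have "a < n" "c < m" using t(2,3) i j ac by auto
      then show ?thesis using ac e[OF i] e[OF j] q qk ej[of a] by (intro exI[of _ 1]) (auto simp: F_def X_def)
    next
      fix a c assume ac: "t i = Inr a" "t j = Inl c"
      have "a < m" "c < n" using t(2,3) i j ac by auto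
      then show ?thesis using ac e[OF i] e[OF j] q qk ej[of c] by (intro exI[of _ 1]) (auto simp: F_def X_def)
    next
      fix a c assume ac: "t i = Inr a" "t j = Inr c"
      have "a < m" "c < m" "a \<noteq> c" using t(3) i j ac ne by auto
      then show ?thesis using ac e[OF i] e[OF j] qkk by (intro exI[of _ 1]) (simp add: F_def X_def)
    qed
  qed
  have e'': "sign_family N e''"
    using b(3) e' e t(2,3) by (auto simp: sign_family_def split: sum.split)
  have inv: "lin_on (pow16 U) (pauli_tensor f z) \<and> (\<forall>v\<in>pow16 U. pauli_tensor f z v \<in> pow16 U \<and> pauli_tensor f z (pauli_tensor f z v) = v) \<and>
     (\<forall>v\<in>pow16 U. \<forall>w\<in>pow16 U. pow16_form p (pauli_tensor f z v) (pauli_tensor f z w) = pow16_form p v w)"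
    if lf: "lin_on U f" and fU: "\<And>u. u \<in> U \<Longrightarrow> f u \<in> U" and ff: "\<And>u. u \<in> U \<Longrightarrow> f (f u) = u"
      and fp: "\<And>u w. u \<in> U \<Longrightarrow> w \<in> U \<Longrightarrow> p (f u) (f w) = p u w" and z: "qsign z = 1" for f z
  proof (intro conjI ballI)
    show "lin_on (pow16 U) (pauli_tensor f z)" by (rule pauli_tensor_lin[OF lf])
    show mem: "pauli_tensor f z v \<in> pow16 U" if "v \<in> pow16 U" for v by (rule pauli_tensor_mem[where f = f, OF sub fU that])
    show sq: "pauli_tensor f z (pauli_tensor f z v) = v" if "v \<in> pow16 U" for v
      using pauli_tensor_square[OF lf fU, of 1 v z] ff that z by simp
    fix v w assume v: "v \<in> pow16 U" and w: "w \<in> pow16 U"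
    have s: "p (f u) u' = 1 * p u (f u')" if "u \<in> U" "u' \<in> U" for u u'
      using fp[OF that(1) fU[OF that(2)]] ff[OF that(2)] by simp
    show "pow16_form p (pauli_tensor f z v) (pauli_tensor f z w) = pow16_form p v w"
      using pow16_form_pauli[where f = f, OF b(2) sub fU s v mem[OF w], of z] sq[OF w] z by simp
  qed
  show ?thesis
    unfolding double_system_def fam
  proof (intro conjI)
    show "fin_space (pow16 U)" by (rule pow16_fin_dim(1)[OF b(1)])
    show "inner_on (pow16 U) (pow16_form p)" by (rule inner_on_pow16_form[OF b(2) sub])
    show "sign_family N e''" by (rule e'')
    note G = inv[OF b(4-7) q(2)] and K = inv[OF b(8-11) q(1)]
    show "lin_on (pow16 U) (pauli_tensor G y)" "lin_on (pow16 U) (pauli_tensor K x)" using G K by blast+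
    show "\<forall>v\<in>pow16 U. pauli_tensor G y v \<in> pow16 U \<and> pauli_tensor G y (pauli_tensor G y v) = v"
      "\<forall>v\<in>pow16 U. pauli_tensor K x v \<in> pow16 U \<and> pauli_tensor K x (pauli_tensor K x v) = v"
      using G K by blast+
    show "\<forall>v\<in>pow16 U. \<forall>w\<in>pow16 U. pow16_form p (pauli_tensor G y v) (pauli_tensor G y w) = pow16_form p v w"
      "\<forall>v\<in>pow16 U. \<forall>w\<in>pow16 U. pow16_form p (pauli_tensor K x v) (pauli_tensor K x w) = pow16_form p v w"
      using G K by blast+
    show "\<forall>i<N. lin_on (pow16 U) (pauli_tensor (F i) (X i)) \<and>
        (\<forall>v\<in>pow16 U. pauli_tensor (F i) (X i) v \<in> pow16 U \<and> pauli_tensor (F i) (X i) (pauli_tensor (F i) (X i) v) = - v \<and>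
           pauli_tensor G y (pauli_tensor (F i) (X i) v) = e'' i *\<^sub>R pauli_tensor (F i) (X i) (pauli_tensor G y v) \<and>
           pauli_tensor K x (pauli_tensor (F i) (X i) v) = - e'' i *\<^sub>R pauli_tensor (F i) (X i) (pauli_tensor K x v)) \<and>
        (\<forall>v\<in>pow16 U. \<forall>w\<in>pow16 U. pow16_form p (pauli_tensor (F i) (X i) v) w = - pow16_form p v (pauli_tensor (F i) (X i) w))"
    proof (intro allI impI conjI ballI)
      fix i assume i: "i < N"
      obtain s where s: "s * qsign (X i) = - 1" "\<And>u. u \<in> U \<Longrightarrow> F i (F i u) = s *\<^sub>R u"
        "\<And>u w. u \<in> U \<Longrightarrow> w \<in> U \<Longrightarrow> p (F i u) w = s * p u (F i w)"
        using sq[OF i] by blast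
      show "lin_on (pow16 U) (pauli_tensor (F i) (X i))" by (rule pauli_tensor_lin[OF lF[OF i]])
      fix v assume v: "v \<in> pow16 U"
      show "pauli_tensor (F i) (X i) v \<in> pow16 U" by (rule pauli_tensor_mem[where f = "F i", OF sub FU[OF i] v])
      show "pauli_tensor (F i) (X i) (pauli_tensor (F i) (X i) v) = - v"
        using pauli_tensor_square[OF lF[OF i] FU[OF i] s(2) v, of "X i"] s(1) by simp
      obtain s1 where s1: "s1 * csign y (X i) = e'' i" "\<And>u. u \<in> U \<Longrightarrow> G (F i u) = s1 *\<^sub>R F i (G u)"
        using cG[OF i] by blast
      show "pauli_tensor G y (pauli_tensor (F i) (X i) v) = e'' i *\<^sub>R pauli_tensor (F i) (X i) (pauli_tensor G y v)"
        using pauli_tensor_commute[OF sub b(4) lF[OF i] b(5) FU[OF i] s1(2) v, of y "X i"] s1(1) by simp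
      obtain s2 where s2: "s2 * csign x (X i) = - e'' i" "\<And>u. u \<in> U \<Longrightarrow> K (F i u) = s2 *\<^sub>R F i (K u)"
        using cK[OF i] by blast
      show "pauli_tensor K x (pauli_tensor (F i) (X i) v) = - e'' i *\<^sub>R pauli_tensor (F i) (X i) (pauli_tensor K x v)"
        using pauli_tensor_commute[OF sub b(8) lF[OF i] b(9) FU[OF i] s2(2) v, of x "X i"] s2(1) by simp
      fix w assume w: "w \<in> pow16 U"
      show "pow16_form p (pauli_tensor (F i) (X i) v) w = - pow16_form p v (pauli_tensor (F i) (X i) w)"
        using pow16_form_pauli[where f = "F i", OF b(2) sub FU[OF i] s(3) v w, of "X i"] s(1) by simp
    qed
    show "\<forall>i<N. \<forall>j<N. i \<noteq> j \<longrightarrow> (\<forall>v\<in>pow16 U. pauli_tensor (F i) (X i) (pauli_tensor (F j) (X j) v) =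
        (- e'' i * e'' j) *\<^sub>R pauli_tensor (F j) (X j) (pauli_tensor (F i) (X i) v))"
    proof (intro allI impI ballI)
      fix i j v assume i: "i < N" and j: "j < N" and ij: "i \<noteq> j" and v: "v \<in> pow16 U"
      obtain s where s: "s * csign (X i) (X j) = - e'' i * e'' j" "\<And>u. u \<in> U \<Longrightarrow> F i (F j u) = s *\<^sub>R F j (F i u)"
        using cF[OF i j ij] by blast
      show "pauli_tensor (F i) (X i) (pauli_tensor (F j) (X j) v) = (- e'' i * e'' j) *\<^sub>R pauli_tensor (F j) (X j) (pauli_tensor (F i) (X i) v)"
        using pauli_tensor_commute[OF sub lF[OF i] lF[OF j] FU[OF i] FU[OF j] s(2) v, of "X i" "X j"] s(1) by simp
    qed
  qed
qed

section \<open>Explicit Pauli matrices for the signatures (0, 8), (4, 4) and (8, 0)\<close>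

definition bits :: "nat \<Rightarrow> bit4" where
  "bits i = (odd (i div 8), odd (i div 4), odd (i div 2), odd i)"

text \<open>The next two families were found by a computer search.\<close>

definition pauli8 :: "nat \<Rightarrow> pauli" where
  "pauli8 l = map_prod bits bits
     ([(1, 1), (2, 3), (3, 6), (4, 7), (5, 4), (6, 5), (7, 10), (15, 2)] ! l)"

definition pauli44 :: "nat \<Rightarrow> pauli" where
  "pauli44 l = map_prod bits bits
     ([(1, 1), (2, 3), (3, 6), (4, 7), (1, 7), (2, 6), (3, 9), (11, 1)] ! l)"

lemma all_less_8: "(\<forall>l<8. P (l :: nat)) \<longleftrightarrow> P 0 \<and> P 1 \<and> P 2 \<and> P 3 \<and> P 4 \<and> P 5 \<and> P 6 \<and> P 7"
proof -
  have "{..<8 :: nat} = {0, 1, 2, 3, 4, 5, 6, 7}" by auto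
  then show ?thesis unfolding lessThan_iff[symmetric, of _ "8 :: nat"] Ball_def[symmetric] by simp
qed

text \<open>With equal signs the relations ask for eight pairwise anticommuting skew matrices. One
  involution commutes with all of them and is the identity; the other anticommutes with each and is,
  up to sign, the product of all eight. For the signature (8, 0) the two change places.\<close>

lemma pauli_sys_8: "pauli_sys 8 (sig_sign 0) pauli8 (bits 0, bits 0) (bits 15, bits 10)"
  unfolding pauli_sys_def all_less_8
  by (simp add: pauli8_def bits_def qsign_def csign_def sig_sign_def)

text \<open>The matrices form two quadruples, anticommuting inside a quadruple and commuting across.
  The involutions \<open>x\<close> and \<open>y\<close> are, up to sign, the products of the first
  and of the second quadruple; each anticommutes with the members of its own and commutes with the
  others.\<close>

lemma pauli_sys_44: "pauli_sys 8 (sig_sign 4) pauli44 (bits 4, bits 3) (bits 11, bits 9)"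
  unfolding pauli_sys_def all_less_8
  by (simp add: pauli44_def bits_def qsign_def csign_def sig_sign_def)

lemma pauli_sys_80: "pauli_sys 8 (sig_sign 8) pauli8 (bits 15, bits 10) (bits 0, bits 0)"
  unfolding pauli_sys_def all_less_8
  by (simp add: pauli8_def bits_def qsign_def csign_def sig_sign_def)

section \<open>Reduction of the signature\<close>

text \<open>As \<open>k\<close> anticommutes with \<open>h\<close> and is injective, it embeds the
  fixed space of \<open>h\<close> into the opposite eigenspace, and the two are independent. For the
  existence of a fixed vector take \<open>x + h x\<close>, or \<open>k x\<close> if this
  vanishes.\<close>

lemma halve:
  assumes U: "fin_space U" "U \<noteq> {0}"
    and h: "lin_on U h" "\<And>x. x \<in> U \<Longrightarrow> h x \<in> U" "\<And>x. x \<in> U \<Longrightarrow> h (h x) = x"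
    and k: "lin_on U k" "\<And>x. x \<in> U \<Longrightarrow> k x \<in> U" "\<And>x. x \<in> U \<Longrightarrow> k x = 0 \<Longrightarrow> x = 0"
    and hk: "\<And>x. x \<in> U \<Longrightarrow> h (k x) = - k (h x)"
  shows "subspace {x \<in> U. h x = x}" "{x \<in> U. h x = x} \<noteq> {0}" "2 * dim {x \<in> U. h x = x} \<le> dim U"
proof -
  let ?E = "{x \<in> U. h x = x}"
  have sub: "subspace U" by (rule fin_space_subspace[OF U(1)])
  show E: "subspace ?E"
    by (rule subspaceI) (simp_all add: subspace_0[OF sub] subspace_add[OF sub] subspace_scale[OF sub]
        lin_on_add[OF h(1)] lin_on_scale[OF h(1)] lin_on_zero[OF h(1) sub])
  have EU: "?E \<subseteq> U" by auto
  obtain x where x: "x \<in> U" "x \<noteq> 0" using U(2) subspace_0[OF sub] by auto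
  show "?E \<noteq> {0}"
  proof (cases "x + h x = 0")
    case True
    then have "h x = - x" by (simp add: add_eq_0_iff)
    then have "k x \<in> ?E" using hk x(1) k(2) lin_on_minus[OF k(1) x(1)] by simp
    moreover have "k x \<noteq> 0" using k(3) x by blast
    ultimately show ?thesis by blast
  next
    case False
    have "x + h x \<in> ?E"
      using x(1) h by (simp add: subspace_add[OF sub] lin_on_add[OF h(1)] add.commute)
    then show ?thesis using False by blast
  qed
  have fE: "fin_space ?E" by (rule fin_space_subset(1)[OF U(1) E EU])
  obtain B where B: "finite B" "independent B" "?E = span B" "card B = dim ?E" "B \<subseteq> ?E"
    by (rule fin_space_basis[OF fE])
  have kinj: "inj_on k U" by (rule lin_on_inj[OF k(1) sub k(3)])
  have BU: "B \<subseteq> U" using B(5) EU by blast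
  have kB: "inj_on k B" using kinj BU inj_on_subset by blast
  have hB: "h b = b" if "b \<in> B" for b using B(5) that by blast
  have hkB: "h (k b) = - k b" if "b \<in> B" for b using hk hB that BU by auto
  have disj: "B \<inter> k ` B = {}"
  proof (rule ccontr)
    assume "B \<inter> k ` B \<noteq> {}"
    then obtain b where b: "b \<in> B" "k b \<in> B" by blast
    have "k b = - k b" using hB[OF b(2)] hkB[OF b(1)] by simp
    then have "2 *\<^sub>R k b = 0" by (simp add: scaleR_2 eq_neg_iff_add_eq_0)
    then have "k b = 0" by simp
    then have "b = 0" using k(3) b BU by blast
    then show False using B(2) b dependent_zero by blast
  qed
  have kBU: "k ` B \<subseteq> U" using BU k(2) by blast
  have ind: "independent (B \<union> k ` B)"
  proof (rule independent_if_scalars_zero)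
    show "finite (B \<union> k ` B)" using B(1) by simp
    fix f x assume 0: "(\<Sum>x\<in>B \<union> k ` B. f x *\<^sub>R x) = 0" and x: "x \<in> B \<union> k ` B"
    define u where "u = (\<Sum>b\<in>B. f b *\<^sub>R b)"
    define w where "w = (\<Sum>b\<in>B. f (k b) *\<^sub>R b)"
    have uU: "u \<in> U" "w \<in> U" unfolding u_def w_def by (intro subspace_sum[OF sub] subspace_scale[OF sub]; use BU in blast)+
    have hs: "h (\<Sum>b\<in>B. c b *\<^sub>R b) = (\<Sum>b\<in>B. c b *\<^sub>R b)" for c
      by (subst lin_on_sum_scale[OF h(1) sub]) (use BU hB in \<open>auto intro!: sum.cong\<close>)
    have hu: "h u = u" "h w = w" unfolding u_def w_def by (rule hs)+
    have "(\<Sum>x\<in>k ` B. f x *\<^sub>R x) = (\<Sum>b\<in>B. f (k b) *\<^sub>R k b)" by (simp add: sum.reindex[OF kB])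
    also have "\<dots> = k w" unfolding w_def
      by (rule lin_on_sum_scale[OF k(1) sub, symmetric]) (use BU in blast)
    finally have e: "u + k w = 0"
      using 0 B(1) disj by (simp add: sum.union_disjoint u_def)
    then have "h (u + k w) = 0" using lin_on_zero[OF h(1) sub] by simp
    then have "u - k w = 0"
      using lin_on_add[OF h(1) uU(1) k(2)[OF uU(2)]] hu hk[OF uU(2)] by simp
    then have "2 *\<^sub>R u = 0" using e by (simp add: scaleR_2)
    then have u0: "u = 0" by simp
    then have "k w = 0" using e by simp
    then have w0: "w = 0" using k(3) uU(2) by blast
    have "f b = 0" "f (k b) = 0" if "b \<in> B" for b
      using independentD[OF B(2,1) order_refl, of f] independentD[OF B(2,1) order_refl, of "\<lambda>b. f (k b)"]
        u0 w0 that unfolding u_def w_def by blast+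
    then show "f x = 0" using x by blast
  qed
  have "card (B \<union> k ` B) = 2 * card B"
    using B(1) disj kB by (simp add: card_Un_disjoint card_image)
  moreover have "card (B \<union> k ` B) \<le> dim U"
    using independent_in_fin_space[OF U(1) _ ind] BU kBU by simp
  ultimately show "2 * dim ?E \<le> dim U" using B(4) by simp
qed

text \<open>For \<open>x\<close> fixed by the symmetric \<open>h\<close>, pairing with
  \<open>y + h y\<close> is twice pairing with \<open>y\<close>.\<close>

lemma halve_nondegenerate:
  assumes U: "subspace U" and h: "\<And>x. x \<in> U \<Longrightarrow> h x \<in> U" "\<And>x. x \<in> U \<Longrightarrow> h (h x) = x" "lin_on U h"
    and b: "\<And>x. x \<in> U \<Longrightarrow> lin_on U (b x)" "\<And>x y. x \<in> U \<Longrightarrow> y \<in> U \<Longrightarrow> b (h x) y = b x (h y)"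
    and nd: "\<And>x. x \<in> U \<Longrightarrow> (\<And>y. y \<in> U \<Longrightarrow> b x y = 0) \<Longrightarrow> x = (0 :: 'a :: real_vector)"
    and x: "x \<in> {x \<in> U. h x = x}" and 0: "\<And>y. y \<in> {x \<in> U. h x = x} \<Longrightarrow> b x y = (0 :: real)"
  shows "x = 0"
proof (rule nd)
  show xU: "x \<in> U" using x by simp
  fix y assume y: "y \<in> U"
  have "b x (y + h y) = 0" by (rule 0) (use y h U in \<open>simp add: subspace_add lin_on_add[OF h(3)] add.commute\<close>)
  moreover have "b x (y + h y) = b x y + b x y"
    using lin_on_add[OF b(1)[OF xU] y h(1)[OF y]] b(2)[OF xU y] x by simp
  ultimately show "b x y = 0" by simp
qed

text \<open>
  Four commuting involutions, products of four generators each, cut \<open>U\<close> down to a common eigenspace of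
  one sixteenth of its dimension. Their supports generate the extended Hamming code, whose words have
  pairwise even intersections.
\<close>

lemma reduce16:
  fixes U :: "'a::real_vector set" and v w :: "nat \<Rightarrow> nat"
  assumes c: "clifford_family n e U J b" and nz: "U \<noteq> {0}" and sf: "sign_family n e"
    and v: "\<And>l. l < 8 \<Longrightarrow> v l < n" "inj_on v {..<8}"
    and ev: "e (v 0) * e (v 1) * e (v 2) * e (v 3) = 1" "e (v 4) * e (v 5) * e (v 6) * e (v 7) = 1"
      "e (v 0) * e (v 1) * e (v 4) * e (v 5) = 1" "e (v 0) * e (v 2) * e (v 4) * e (v 6) = 1"
    and w: "\<And>i. i < m \<Longrightarrow> w i < n" "inj_on w {..<m}" "\<And>i l. i < m \<Longrightarrow> l < 8 \<Longrightarrow> w i \<noteq> v l"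
      "\<And>i. i < m \<Longrightarrow> e' i = e (w i)"
  obtains E where "E \<noteq> {0}" "16 * dim E \<le> dim U" "clifford_family m e' E (\<lambda>i. J (w i)) b"
proof -
  note d = clifford_familyD[OF c]
  note sub = d(2)
  define N where "N l = J (v l)" for l
  have Nm: "N l x \<in> U" if "l < 8" "x \<in> U" for l x using d(5) v(1) that by (simp add: N_def)
  have lN: "lin_on U (N l)" if "l < 8" for l using d(4) v(1) that by (simp add: N_def)
  have Nneg: "N l (- x) = - N l x" if "l < 8" "x \<in> U" for l x by (rule lin_on_minus[OF lN[OF that(1)] that(2)])
  have Nsc: "N l (a *\<^sub>R x) = a *\<^sub>R N l x" if "l < 8" "x \<in> U" for l a x by (rule lin_on_scale[OF lN[OF that(1)] that(2)])
  have Nsq: "N l (N l x) = - (e (v l) *\<^sub>R x)" if "l < 8" "x \<in> U" for l x using d(6) v(1) that by (simp add: N_def)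
  have Nsort: "N i (N j x) = - N j (N i x)" if "j < i" "i < 8" "x \<in> U" for i j x
  proof -
    have "v i \<noteq> v j" using inj_onD[OF v(2), of i j] that by auto
    then show ?thesis using d(8)[of "v i" "v j" x] v(1) that by (simp add: N_def)
  qed
  have Nb: "b (N l x) y = - b x (N l y)" if "l < 8" "x \<in> U" "y \<in> U" for l x y
    using d(7) v(1) that by (simp add: N_def)
  have Nw: "J (w i) (N l x) = - N l (J (w i) x)" if "i < m" "l < 8" "x \<in> U" for i l x
    unfolding N_def by (rule d(8)) (use w v that in auto)
  have Jw: "J (w i) x \<in> U" if "i < m" "x \<in> U" for i x using d(5) w(1) that by simp
  have Jneg: "J (w i) (- x) = - J (w i) x" if "i < m" "x \<in> U" for i x
    by (rule lin_on_minus[OF d(4)[OF w(1)[OF that(1)]] that(2)])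
  have Um: "- x \<in> U" "a *\<^sub>R x \<in> U" if "x \<in> U" for x a using that sub by (auto simp: subspace_neg subspace_scale)
  have N0: "x = 0" if "l < 8" "x \<in> U" "N l x = 0" for l x
    using Nsq[OF that(1,2)] that(3) lin_on_zero[OF lN[OF that(1)] sub] sign_familyD[OF sf v(1)[OF that(1)]] by auto
  \<comment> \<open>The supports are the code words 11110000, 00001111, 11001100 and 10101010. The
    assumptions \<open>ev\<close> on products of signs say that the squares are 1.\<close>
  define h1 where "h1 x = N 0 (N 1 (N 2 (N 3 x)))" for x
  define h2 where "h2 x = N 4 (N 5 (N 6 (N 7 x)))" for x
  define h3 where "h3 x = N 0 (N 1 (N 4 (N 5 x)))" for x
  define h4 where "h4 x = N 0 (N 2 (N 4 (N 6 x)))" for x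
  \<comment> \<open>The partner of each involution for \<open>halve\<close> has to anticommute with
    it and commute with all previous ones. \<open>N 3\<close> and \<open>N 7\<close> serve for
    \<open>h1\<close> and \<open>h2\<close>. For \<open>h3\<close> and \<open>h4\<close>, a product
    of two generators meets the earlier supports evenly and the current one in a single
    index.\<close>
  define k3 where "k3 x = N 1 (N 3 x)" for x
  define k4 where "k4 x = N 2 (N 3 x)" for x
  note defs = h1_def h2_def h3_def h4_def k3_def k4_def
  \<comment> \<open>As rewrite rules these sort a product of generators by index and collapse
    repetitions, so both sides of each identity below reach the same normal form.\<close>
  note ar = Nm Nneg Nsc Nsq Nsort Um
  have lc: "lin_on U (\<lambda>x. N i (f x))" if "i < 8" "lin_on U f" "\<And>x. x \<in> U \<Longrightarrow> f x \<in> U" for i f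
    by (rule lin_on_comp[OF that(2) _ lN[OF that(1)]]) (use that(3) in auto)
  have lin: "lin_on U h1" "lin_on U h2" "lin_on U h3" "lin_on U h4" "lin_on U k3" "lin_on U k4"
    unfolding defs by (intro lc lN; simp add: Nm)+
  have mem: "h1 x \<in> U" "h2 x \<in> U" "h3 x \<in> U" "h4 x \<in> U" "k3 x \<in> U" "k4 x \<in> U" if "x \<in> U" for x
    using that by (simp_all add: defs Nm)
  have sq: "h1 (h1 x) = x" "h2 (h2 x) = x" "h3 (h3 x) = x" "h4 (h4 x) = x" if "x \<in> U" for x
  proof -
    have "h1 (h1 x) = (e (v 0) * e (v 1) * e (v 2) * e (v 3)) *\<^sub>R x"
      "h2 (h2 x) = (e (v 4) * e (v 5) * e (v 6) * e (v 7)) *\<^sub>R x"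
      "h3 (h3 x) = (e (v 0) * e (v 1) * e (v 4) * e (v 5)) *\<^sub>R x"
      "h4 (h4 x) = (e (v 0) * e (v 2) * e (v 4) * e (v 6)) *\<^sub>R x"
      using that by (simp_all add: defs ar mult_ac)
    then show "h1 (h1 x) = x" "h2 (h2 x) = x" "h3 (h3 x) = x" "h4 (h4 x) = x" by (simp_all only: ev scaleR_one)
  qed
  have hsym: "b (h1 x) y = b x (h1 y)" "b (h2 x) y = b x (h2 y)" "b (h3 x) y = b x (h3 y)" "b (h4 x) y = b x (h4 y)"
    if "x \<in> U" "y \<in> U" for x y
    using that by (simp_all add: defs Nb Nm) (simp_all add: ar)
  have com: "h1 (h2 x) = h2 (h1 x)" "h1 (h3 x) = h3 (h1 x)" "h1 (h4 x) = h4 (h1 x)" "h2 (h3 x) = h3 (h2 x)"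
    "h2 (h4 x) = h4 (h2 x)" "h3 (h4 x) = h4 (h3 x)" if "x \<in> U" for x
    using that by (simp_all add: defs ar)
  have kcom: "h1 (N 7 x) = N 7 (h1 x)" "h1 (k3 x) = k3 (h1 x)" "h2 (k3 x) = k3 (h2 x)"
    "h1 (k4 x) = k4 (h1 x)" "h2 (k4 x) = k4 (h2 x)" "h3 (k4 x) = k4 (h3 x)" if "x \<in> U" for x
    using that by (simp_all add: defs ar)
  have kanti: "h1 (N 3 x) = - N 3 (h1 x)" "h2 (N 7 x) = - N 7 (h2 x)" "h3 (k3 x) = - k3 (h3 x)" "h4 (k4 x) = - k4 (h4 x)"
    if "x \<in> U" for x
    using that by (simp_all add: defs ar)
  \<comment> \<open>A generator outside the eight passes four factors, and the four signs
    cancel.\<close>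
  have jcom: "h1 (J (w i) x) = J (w i) (h1 x)" "h2 (J (w i) x) = J (w i) (h2 x)" "h3 (J (w i) x) = J (w i) (h3 x)"
    "h4 (J (w i) x) = J (w i) (h4 x)" if "i < m" "x \<in> U" for i x
    using that by (simp_all add: defs Nw Nm Jw Jneg Nneg Um)
  have kinj: "x = 0" if "x \<in> U" "k3 x = 0 \<or> k4 x = 0" for x
    using that N0[of 3] N0[of 1] N0[of 2] Nm[of 3 x] by (auto simp: k3_def k4_def)
  define E1 where "E1 = {x \<in> U. h1 x = x}"
  define E2 where "E2 = {x \<in> E1. h2 x = x}"
  define E3 where "E3 = {x \<in> E2. h3 x = x}"
  define E4 where "E4 = {x \<in> E3. h4 x = x}"
  have inc: "E1 \<subseteq> U" "E2 \<subseteq> U" "E3 \<subseteq> U" "E4 \<subseteq> U" by (auto simp: E1_def E2_def E3_def E4_def)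
  note Ed = E1_def E2_def E3_def E4_def
  have halve': "subspace {x \<in> E. h x = x} \<and> {x \<in> E. h x = x} \<noteq> {0} \<and> 2 * dim {x \<in> E. h x = x} \<le> dim E"
    if E: "subspace E" "E \<noteq> {0}" "E \<subseteq> U" and h: "lin_on U h" "\<And>x. x \<in> U \<Longrightarrow> h (h x) = x" "\<And>x. x \<in> E \<Longrightarrow> h x \<in> E"
      and k: "lin_on U k" "\<And>x. x \<in> E \<Longrightarrow> k x \<in> E" "\<And>x. x \<in> U \<Longrightarrow> k x = 0 \<Longrightarrow> x = 0"
      and hk: "\<And>x. x \<in> U \<Longrightarrow> h (k x) = - k (h x)"
    for E h k
    using halve[OF fin_space_subset(1)[OF d(1) E(1,3)] E(2) lin_on_subset[OF h(1) E(3)] h(3) _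
        lin_on_subset[OF k(1) E(3)] k(2)] h(2) k(3) hk E(3) by (simp_all add: subset_iff)
  have t1: "subspace E1 \<and> E1 \<noteq> {0} \<and> 2 * dim E1 \<le> dim U"
    unfolding E1_def
    by (rule halve'[OF sub nz order_refl, where h = h1 and k = "N 3"];
        (rule N0[of 3]; simp; fail)?; simp add: lin lN sq kanti mem Nm)
  note s1 = t1[THEN conjunct1] t1[THEN conjunct2, THEN conjunct1] t1[THEN conjunct2, THEN conjunct2]
  have t2: "subspace E2 \<and> E2 \<noteq> {0} \<and> 2 * dim E2 \<le> dim E1"
    unfolding E2_def
    by (rule halve'[OF s1(1,2) inc(1), where h = h2 and k = "N 7"];
        (rule N0[of 7]; simp; fail)?; simp add: lin lN sq kanti E1_def mem Nm com kcom)
  note s2 = t2[THEN conjunct1] t2[THEN conjunct2, THEN conjunct1] t2[THEN conjunct2, THEN conjunct2]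
  have t3: "subspace E3 \<and> E3 \<noteq> {0} \<and> 2 * dim E3 \<le> dim E2"
    unfolding E3_def
    by (rule halve'[OF s2(1,2) inc(2), where h = h3 and k = k3];
        (rule kinj; simp; fail)?; simp add: lin sq kanti E1_def E2_def mem com kcom)
  note s3 = t3[THEN conjunct1] t3[THEN conjunct2, THEN conjunct1] t3[THEN conjunct2, THEN conjunct2]
  have t4: "subspace E4 \<and> E4 \<noteq> {0} \<and> 2 * dim E4 \<le> dim E3"
    unfolding E4_def
    by (rule halve'[OF s3(1,2) inc(3), where h = h4 and k = k4];
        (rule kinj; simp; fail)?; simp add: lin sq kanti E1_def E2_def E3_def mem com kcom)
  note s4 = t4[THEN conjunct1] t4[THEN conjunct2, THEN conjunct1] t4[THEN conjunct2, THEN conjunct2]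
  have blin: "lin_on U (b x)" if "x \<in> U" for x by (rule nondeg_lin[OF d(3) that])
  have nd': "x = 0" if E: "subspace E" "E \<subseteq> U" and nd: "\<And>x. x \<in> E \<Longrightarrow> (\<And>y. y \<in> E \<Longrightarrow> b x y = 0) \<Longrightarrow> x = 0"
    and h: "\<And>x. x \<in> E \<Longrightarrow> h x \<in> E" "\<And>x. x \<in> U \<Longrightarrow> h (h x) = x" "lin_on U h"
      "\<And>x y. x \<in> U \<Longrightarrow> y \<in> U \<Longrightarrow> b (h x) y = b x (h y)"
    and x: "x \<in> {x \<in> E. h x = x}" and 0: "\<And>y. y \<in> {x \<in> E. h x = x} \<Longrightarrow> b x y = 0" for E h x
    by (rule halve_nondegenerate[OF E(1), of h b])
      (use E(2) nd h x 0 lin_on_subset[OF h(3) E(2)] lin_on_subset[OF blin E(2)] in \<open>auto simp: subset_iff\<close>)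
  have nd1: "x = 0" if "x \<in> E1" "\<And>y. y \<in> E1 \<Longrightarrow> b x y = 0" for x
    using nd'[OF sub order_refl nondeg_nondeg[OF d(3)] mem(1) sq(1) lin(1) hsym(1)] that unfolding E1_def by blast
  have nd2: "x = 0" if "x \<in> E2" "\<And>y. y \<in> E2 \<Longrightarrow> b x y = 0" for x
    by (rule nd'[OF s1(1) inc(1) nd1, of h2]) (use that in \<open>auto simp: E2_def E1_def mem com sq lin hsym\<close>)
  have nd3: "x = 0" if "x \<in> E3" "\<And>y. y \<in> E3 \<Longrightarrow> b x y = 0" for x
    by (rule nd'[OF s2(1) inc(2) nd2, of h3]) (use that in \<open>auto simp: E3_def E2_def E1_def mem com sq lin hsym\<close>)
  have nd4: "x = 0" if "x \<in> E4" "\<And>y. y \<in> E4 \<Longrightarrow> b x y = 0" for x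
    by (rule nd'[OF s3(1) inc(3) nd3, of h4]) (use that in \<open>auto simp: E4_def E3_def E2_def E1_def mem com sq lin hsym\<close>)
  have "clifford_family m e' E4 (\<lambda>i. J (w i)) b"
    by (rule clifford_restrict[OF c s4(1) inc(4) w(1,2,4) _ nd4])
      (auto simp: Ed Jw jcom)
  moreover have "16 * dim E4 \<le> dim U" using s1(3) s2(3) s3(3) s4(3) by linarith
  ultimately show thesis using that s4(2) by blast
qed

text \<open>The eight added coordinates are the ones used up by \<open>reduce16\<close>. In all
  three cases each code word contains an even number of negative coordinates, so its product of
  signs is 1.\<close>

lemma signature_reduction:
  fixes M :: "'a::real_vector clifford_module"
  assumes adm: "admissible (r + p) (s + q) M" and nz: "module_space M \<noteq> {0}"
    and pq: "p = 0 \<and> q = 8 \<or> p = 8 \<and> q = 0 \<or> p = 4 \<and> q = 4"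
  obtains M' :: "'a clifford_module" where "admissible r s M'" "module_space M' \<noteq> {0}"
    "16 * dim (module_space M') \<le> dim (module_space M)"
proof -
  \<comment> \<open>\<open>v\<close> lists the \<open>p\<close> added positive coordinates and then
    the added negative ones; the latter start at r + p + s, that is at r + s + l for l = p.
    \<open>w\<close> skips the added positive block.\<close>
  define v where "v l = (if l < p then r + l else r + s + l)" for l
  define w where "w i = (if i < r then i else i + p)" for i
  obtain E where "E \<noteq> {0}" "16 * dim E \<le> dim (module_space M)"
    "clifford_family (r + s) (sig_sign r) E (\<lambda>i. act M (pm_unit (w i))) (module_form M)"
  proof (rule reduce16[OF clifford_standard[OF adm] nz sign_family_sig, of v "r + s" w "sig_sign r"])
    show "inj_on v {..<8}" "inj_on w {..<r + s}" by (auto simp: inj_on_def v_def w_def split: if_splits)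
    show "\<And>i. i < r + s \<Longrightarrow> sig_sign r i = sig_sign (r + p) (w i)" by (auto simp: sig_sign_def w_def)
    show "\<And>i l. i < r + s \<Longrightarrow> l < 8 \<Longrightarrow> w i \<noteq> v l" "\<And>l. l < 8 \<Longrightarrow> v l < r + p + (s + q)"
      "\<And>i. i < r + s \<Longrightarrow> w i < r + p + (s + q)"
      using pq by (auto simp: w_def v_def)
  qed (use pq in \<open>auto simp: sig_sign_def v_def\<close>)
  then show thesis using that[of "fam_mod (r + s) E (\<lambda>i. act M (pm_unit (w i))) (module_form M)"]
    by (simp add: admissible_fam_mod)
qed

section \<open>Periodicity\<close>

lemma double_system_transfer:
  fixes U :: "'a::real_vector set" and f :: "'a \<Rightarrow> 'b::real_vector"
  assumes b: "double_system n e U p M G K" and f: "lin_on U f" "inj_on f U"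
  defines "g \<equiv> inv_into U f"
  shows "double_system n e (f ` U) (\<lambda>x y. p (g x) (g y)) (\<lambda>i x. f (M i (g x))) (\<lambda>x. f (G (g x))) (\<lambda>x. f (K (g x)))"
proof -
  note d = double_systemD[OF b]
  have sub: "subspace U" by (rule fin_space_subspace[OF d(1)])
  have bij: "bij_betw f U (f ` U)" using f(2) by (simp add: bij_betw_def)
  have lg: "lin_on (f ` U) g" unfolding g_def by (rule lin_on_inv_into[OF f(1) sub bij])
  have gf: "g (f x) = x" if "x \<in> U" for x using f(2) that by (simp add: g_def)
  have fs: "f (c *\<^sub>R x) = c *\<^sub>R f x" if "x \<in> U" for c x by (rule lin_on_scale[OF f(1) that])
  have fm: "f (- x) = - f x" if "x \<in> U" for x by (rule lin_on_minus[OF f(1) that])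
  have lin: "lin_on (f ` U) (\<lambda>x. f (h (g x)))" if "lin_on U h" "\<And>x. x \<in> U \<Longrightarrow> h x \<in> U" for h
    by (rule lin_on_comp[OF lin_on_comp[OF lg _ that(1)] _ f(1)]) (use gf that(2) in auto)
  have ip: "inner_on (f ` U) (\<lambda>x y. p (g x) (g y))"
    unfolding inner_on_def
  proof (intro conjI ballI impI)
    fix x assume x: "x \<in> f ` U"
    then have gx: "g x \<in> U" using gf by auto
    show "lin_on (f ` U) (\<lambda>y. p (g x) (g y))"
      by (rule lin_on_comp[OF lg _ inner_on_lin[OF d(2) gx]]) (use gf in auto)
    show "p (g x) (g x) > 0" if "x \<noteq> 0"
    proof (rule inner_on_pos[OF d(2) gx])
      show "g x \<noteq> 0" using that x gf lin_on_zero[OF f(1) sub] by auto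
    qed
    show "p (g x) (g y) = p (g y) (g x)" if "y \<in> f ` U" for y
      using inner_on_sym[OF d(2) gx] that gf by auto
  qed
  show ?thesis
    unfolding double_system_def
  proof (intro conjI)
    show "fin_space (f ` U)" by (rule lin_on_image_fin_space[OF f(1) d(1)])
    show "lin_on (f ` U) (\<lambda>x. f (G (g x)))" "lin_on (f ` U) (\<lambda>x. f (K (g x)))"
      using lin d(4,5,8,9) by blast+
    show "\<forall>i<n. \<forall>j<n. i \<noteq> j \<longrightarrow> (\<forall>x\<in>f ` U. f (M i (g (f (M j (g x))))) =
        (- e i * e j) *\<^sub>R f (M j (g (f (M i (g x))))))"
    proof (intro allI impI ballI)
      fix i j x assume ij: "i < n" "j < n" "i \<noteq> j" and "x \<in> f ` U"
      then obtain u where u: "u \<in> U" "x = f u" by blast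
      show "f (M i (g (f (M j (g x))))) = (- e i * e j) *\<^sub>R f (M j (g (f (M i (g x)))))"
      proof -
        have "f (M i (M j u)) = (- e i * e j) *\<^sub>R f (M j (M i u))"
          unfolding d(18)[OF ij u(1)] by (rule fs[OF d(13)[OF ij(2) d(13)[OF ij(1) u(1)]]])
        then show ?thesis using u ij d(13) by (simp add: gf)
      qed
    qed
    show "\<forall>i<n. lin_on (f ` U) (\<lambda>x. f (M i (g x))) \<and>
        (\<forall>x\<in>f ` U. f (M i (g x)) \<in> f ` U \<and> f (M i (g (f (M i (g x))))) = - x \<and>
           f (G (g (f (M i (g x))))) = e i *\<^sub>R f (M i (g (f (G (g x))))) \<and>
           f (K (g (f (M i (g x))))) = - e i *\<^sub>R f (M i (g (f (K (g x)))))) \<and>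
        (\<forall>x\<in>f ` U. \<forall>y\<in>f ` U. p (g (f (M i (g x)))) (g y) = - p (g x) (g (f (M i (g y)))))"
    proof (intro allI impI conjI ballI)
      fix i assume i: "i < n"
      show "lin_on (f ` U) (\<lambda>x. f (M i (g x)))" using lin[OF d(12)[OF i] d(13)[OF i]] .
      fix x assume "x \<in> f ` U"
      then obtain u where u: "u \<in> U" "x = f u" by blast
      note m = d(5)[OF u(1)] d(9)[OF u(1)] d(13)[OF i u(1)]
      show "f (M i (g x)) \<in> f ` U" using u m gf by simp
      show "f (M i (g (f (M i (g x))))) = - x" using u m by (simp add: gf d(14) i fm)
      show "f (G (g (f (M i (g x))))) = e i *\<^sub>R f (M i (g (f (G (g x)))))"
        using u m fs[OF d(13)[OF i m(1)]] by (simp add: gf d(15) i)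
      show "f (K (g (f (M i (g x))))) = - e i *\<^sub>R f (M i (g (f (K (g x)))))"
        using u m fs[OF d(13)[OF i m(2)], of "- e i"] by (simp add: gf d(16) i)
      fix y assume "y \<in> f ` U"
      then obtain u' where u': "u' \<in> U" "y = f u'" by blast
      show "p (g (f (M i (g x)))) (g y) = - p (g x) (g (f (M i (g y))))"
        using u u' m d(13)[OF i u'(1)] by (simp add: gf d(17) i)
    qed
  qed (use ip d(3,5,6,7,9,10,11) gf in auto)
qed

text \<open>
  Unlike the isomorphism of the Lie algebras, this property is inherited along the induction even where the
  two entries of the signature become equal.
\<close>

definition stable_pair :: "nat \<Rightarrow> nat \<Rightarrow> bool" where
  "stable_pair r s \<longleftrightarrow> (\<exists>(U :: (nat \<Rightarrow>\<^sub>0 real) set) p M G K. double_system (r + s) (sig_sign r) U p M G K \<and> U \<noteq> {0} \<and>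
     (\<forall>N :: (nat \<Rightarrow>\<^sub>0 real) clifford_module. (admissible r s N \<or> admissible s r N) \<and> module_space N \<noteq> {0} \<longrightarrow>
        dim U \<le> dim (module_space N)))"

text \<open>The definition of \<open>stable_pair\<close> has to fix a carrier type. Since the tensor
  product changes the type, this rule takes a system on any type and moves it back.\<close>

lemma stable_pairI:
  assumes b: "double_system (r + s) (sig_sign r) (U :: 'a::real_vector set) p M G K" and U: "U \<noteq> {0}"
    and min: "\<And>N :: (nat \<Rightarrow>\<^sub>0 real) clifford_module. admissible r s N \<or> admissible s r N \<Longrightarrow> module_space N \<noteq> {0} \<Longrightarrow>
        dim U \<le> dim (module_space N)"
  shows "stable_pair r s"
proof -
  have fU: "fin_space U" by (rule double_systemD(1)[OF b])
  have sub: "subspace U" by (rule fin_space_subspace[OF fU])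
  obtain f :: "'a \<Rightarrow> (nat \<Rightarrow>\<^sub>0 real)" where f: "lin_on U f" "inj_on f U" by (rule finite_coordinates[OF fU])
  have "dim (f ` U) = dim U" by (rule lin_on_inj_dim[OF f(1) fU f(2)])
  moreover have "f ` U \<noteq> {0}"
  proof
    assume "f ` U = {0}"
    then have "x = 0" if "x \<in> U" for x
      using that inj_onD[OF f(2), of x 0] subspace_0[OF sub] lin_on_zero[OF f(1) sub] by auto
    then show False using U subspace_0[OF sub] by blast
  qed
  moreover obtain q M' G' K' where "double_system (r + s) (sig_sign r) (f ` U) q M' G' K'" using double_system_transfer[OF b f] by blast
  ultimately show ?thesis
    unfolding stable_pair_def using min
    by (intro exI[of _ "f ` U"] exI[of _ q] exI[of _ M'] exI[of _ G'] exI[of _ K']) simp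
qed

lemma stable_pairE:
  assumes "stable_pair r s"
  obtains U :: "(nat \<Rightarrow>\<^sub>0 real) set" and p M G K where "double_system (r + s) (sig_sign r) U p M G K" "U \<noteq> {0}"
    "\<And>N :: (nat \<Rightarrow>\<^sub>0 real) clifford_module. admissible r s N \<or> admissible s r N \<Longrightarrow> module_space N \<noteq> {0} \<Longrightarrow>
        dim U \<le> dim (module_space N)"
  using assms unfolding stable_pair_def by (elim exE conjE) (rule that, auto)

text \<open>The isomorphism gives the two minimal modules equal dimension, so one space meets the
  bound for both signatures.\<close>

lemma stable_pair_base:
  assumes rs: "r \<noteq> s" and V: "minimal_admissible r s V" and W: "minimal_admissible s r W"
    and iso: "lie_isomorphic (pseudo_H_algebra r s V) (pseudo_H_algebra s r W)"
  shows "stable_pair r s"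
proof -
  obtain p M G K where b: "double_system (r + s) (sig_sign r) (module_space V) p M G K"
    and dim: "dim (module_space V) = dim (module_space W)" by (rule double_system_exists[OF rs V W iso])
  show ?thesis
  proof (rule stable_pairI[OF b])
    show "module_space V \<noteq> {0}" using V unfolding minimal_admissible_def by blast
    fix N :: "(nat \<Rightarrow>\<^sub>0 real) clifford_module"
    assume "admissible r s N \<or> admissible s r N" and "module_space N \<noteq> {0}"
    then show "dim (module_space V) \<le> dim (module_space N)"
      using minimal_dim_le[OF V] minimal_dim_le[OF W] dim by metis
  qed
qed

text \<open>A competitor of the larger signature contains a module of the smaller one of at most one
  sixteenth of its dimension. So it has dimension at least 16 times that of \<open>U\<close>, which
  bounds that of \<open>pow16 U\<close>.\<close>

lemma stable_pair_step:
  assumes st: "stable_pair r s" and pq: "p = 0 \<and> q = 8 \<or> p = 8 \<and> q = 0 \<or> p = 4 \<and> q = 4"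
  shows "stable_pair (r + p) (s + q)"
proof -
  obtain U :: "(nat \<Rightarrow>\<^sub>0 real) set" and ip M G K where b: "double_system (r + s) (sig_sign r) U ip M G K" and U: "U \<noteq> {0}"
    and min: "\<And>N :: (nat \<Rightarrow>\<^sub>0 real) clifford_module. admissible r s N \<or> admissible s r N \<Longrightarrow> module_space N \<noteq> {0} \<Longrightarrow>
        dim U \<le> dim (module_space N)"
    by (rule stable_pairE[OF st]) (rule that)
  have fU: "fin_space U" by (rule double_systemD(1)[OF b])
  have sub: "subspace U" by (rule fin_space_subspace[OF fU])
  obtain k x y where k: "pauli_sys 8 (sig_sign p) k x y"
    using pq pauli_sys_8 pauli_sys_80 pauli_sys_44 by blast
  \<comment> \<open>Positive coordinates come first, so the new ones enter in two places:
    \<open>p\<close> after the old positive ones and \<open>q\<close> at the end.\<close>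
  define t where "t i = (if i < r then Inl i else if i < r + p then Inr (i - r)
     else if i < r + p + s then Inl (i - p) else Inr (i - (r + s)))" for i :: nat
  have "double_system (r + p + (s + q)) (sig_sign (r + p)) (pow16 U) (pow16_form ip)
     (\<lambda>i. case t i of Inl j \<Rightarrow> pauli_tensor (M j) (if sig_sign r j = 1 then x else y) | Inr l \<Rightarrow> pauli_tensor (\<lambda>u. u) (k l))
     (pauli_tensor G y) (pauli_tensor K x)"
  proof (rule double_system_tensor[OF b k sign_family_sig])
    show "inj_on t {..<r + p + (s + q)}"
      by (rule inj_onI) (auto simp: t_def split: if_splits)
    show "\<And>i j. i < r + p + (s + q) \<Longrightarrow> t i = Inl j \<Longrightarrow> j < r + s"
      by (auto simp: t_def split: if_splits)
    show "\<And>i l. i < r + p + (s + q) \<Longrightarrow> t i = Inr l \<Longrightarrow> l < 8"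
      using pq by (auto simp: t_def split: if_splits)
    show "\<And>i. i < r + p + (s + q) \<Longrightarrow> sig_sign (r + p) i = (case t i of Inl j \<Rightarrow> sig_sign r j | Inr l \<Rightarrow> sig_sign p l)"
      by (auto simp: t_def sig_sign_def)
  qed
  then show ?thesis
  proof (rule stable_pairI)
    obtain u where u: "u \<in> U" "u \<noteq> 0" using U subspace_0[OF sub] by auto
    have "(\<chi> i. u) \<in> pow16 U" "(\<chi> i. u) \<noteq> (0 :: (nat \<Rightarrow>\<^sub>0 real) ^ bit4)"
      using u by (auto simp: pow16_def vec_eq_iff)
    then show "pow16 U \<noteq> {0}" by blast
    fix N :: "(nat \<Rightarrow>\<^sub>0 real) clifford_module"
    assume adm: "admissible (r + p) (s + q) N \<or> admissible (s + q) (r + p) N" and nz: "module_space N \<noteq> {0}"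
    obtain N' :: "(nat \<Rightarrow>\<^sub>0 real) clifford_module" where "admissible r s N' \<or> admissible s r N'" "module_space N' \<noteq> {0}"
      "16 * dim (module_space N') \<le> dim (module_space N)"
      using adm
    proof
      assume "admissible (r + p) (s + q) N"
      from signature_reduction[OF this nz pq] show thesis using that by blast
    next
      assume sq: "admissible (s + q) (r + p) N"
      \<comment> \<open>The list of admissible increments is symmetric, so the opposite signature
        reduces in the same way with \<open>p\<close> and \<open>q\<close> exchanged.\<close>
      have qp: "q = 0 \<and> p = 8 \<or> q = 8 \<and> p = 0 \<or> q = 4 \<and> p = 4" using pq by auto
      from signature_reduction[OF sq nz qp] show thesis using that by blast
    qed
    then have "16 * dim U \<le> dim (module_space N)" using min[of N'] by linarith
    then show "dim (pow16 U) \<le> dim (module_space N)" using pow16_fin_dim(2)[OF fU] by linarith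
  qed
qed

text \<open>Both Clifford families live on the same \<open>U\<close>, and since \<open>G\<close> and
  \<open>K\<close> are involutions both define the skew forms \<open>p (M i x) y\<close>. The
  identity on \<open>U\<close> with a permutation of central coordinates is thus an isomorphism.
  Both modules are minimal by the bound, and uniqueness passes to arbitrary ones.\<close>

lemma stable_pair_isomorphic:
  assumes st: "stable_pair r s" and V: "minimal_admissible r s V" and W: "minimal_admissible s r W"
  shows "lie_isomorphic (pseudo_H_algebra r s V) (pseudo_H_algebra s r W)"
proof -
  obtain U :: "(nat \<Rightarrow>\<^sub>0 real) set" and p M G K where b: "double_system (r + s) (sig_sign r) U p M G K" and U: "U \<noteq> {0}"
    and min: "\<And>N :: (nat \<Rightarrow>\<^sub>0 real) clifford_module. admissible r s N \<or> admissible s r N \<Longrightarrow> module_space N \<noteq> {0} \<Longrightarrow>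
        dim U \<le> dim (module_space N)"
    by (rule stable_pairE[OF st]) (rule that)
  note d = double_systemD[OF b]
  \<comment> \<open>After negation the positive signs belong to the indices from \<open>r\<close>
    on; \<open>t\<close> moves them to the front, as the signature (s, r) requires.\<close>
  define t where "t i = (if i < s then r + i else i - s)" for i
  define V0 where "V0 = fam_mod (r + s) U (\<lambda>i x. G (M i x)) (\<lambda>x y. p (G x) y)"
  define W0 where "W0 = fam_mod (s + r) U (\<lambda>i x. K (M (t i) x)) (\<lambda>x y. p (K x) y)"
  have aV: "admissible r s V0" unfolding V0_def by (rule admissible_fam_mod[OF double_system_clifford[OF b]])
  note c = double_system_clifford[OF double_system_swap[OF b]]
  note e = clifford_familyD[OF c]
  have "clifford_family (s + r) (sig_sign s) U (\<lambda>i x. K (M (t i) x)) (\<lambda>x y. p (K x) y)"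
    by (rule clifford_restrict[OF c e(2) order_refl, of "s + r" t])
      (use e(5) nondeg_nondeg[OF e(3)] in \<open>auto simp: t_def sig_sign_def inj_on_def split: if_splits\<close>)
  then have aW: "admissible s r W0" unfolding W0_def by (rule admissible_fam_mod)
  have mV: "minimal_admissible r s V0" and mW: "minimal_admissible s r W0"
    unfolding minimal_admissible_def using aV aW U min by (auto simp: V0_def W0_def)
  have "lie_isomorphic (pseudo_H_algebra r s V0) (pseudo_H_algebra s r W0)"
  proof (rule lie_isomorphicI[OF aV aW, of "\<lambda>x. x" "\<lambda>i. if i < r then s + i else i - r" "\<lambda>_. 1"])
    show "lin_on (module_space V0) (\<lambda>x. x)" by (rule lin_on_id)
    show "bij_betw (\<lambda>x. x) (module_space V0) (module_space W0)" by (simp add: V0_def W0_def bij_betw_def)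
    show "bij_betw (\<lambda>i. if i < r then s + i else i - r) {..<r + s} {..<s + r}"
      by (rule bij_betw_byWitness[of _ t]) (auto simp: t_def)
    fix i x y assume i: "i < r + s" and x: "x \<in> module_space V0" and y: "y \<in> module_space V0"
    let ?i = "if i < r then s + i else i - r"
    have ti: "t ?i = i" "?i < s + r" using i by (auto simp: t_def)
    show "module_form W0 (act W0 (pm_unit ?i) x) y = 1 * module_form V0 (act V0 (pm_unit i) x) y"
      using x y i d(6,10,13) ti unfolding V0_def W0_def fam_mod_simps act_fam_mod_unit[OF i] act_fam_mod_unit[OF ti(2)]
      by simp
  qed simp
  from lie_isomorphic_trans[OF minimal_admissible_unique[OF V mV] lie_isomorphic_trans[OF this minimal_admissible_unique[OF mW W]]]
  show ?thesis .
qed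

theorem theorem7:
  fixes r s k :: nat
    and V :: "'a::real_vector clifford_module"
    and W :: "'b::real_vector clifford_module"
  assumes "r \<noteq> s"
    and "minimal_admissible r s V"
    and "minimal_admissible s r W"
    and "lie_isomorphic (pseudo_H_algebra r s V) (pseudo_H_algebra s r W)"
    and "k \<ge> 1"
  shows
    "(\<forall>(V' :: 'c::real_vector clifford_module) (W' :: 'd::real_vector clifford_module).
        minimal_admissible r (s + 8 * k) V' \<and> minimal_admissible (s + 8 * k) r W' \<longrightarrow>
        lie_isomorphic (pseudo_H_algebra r (s + 8 * k) V') (pseudo_H_algebra (s + 8 * k) r W')) \<and>
     (\<forall>(V' :: 'c::real_vector clifford_module) (W' :: 'd::real_vector clifford_module).
        minimal_admissible (r + 8 * k) s V' \<and> minimal_admissible s (r + 8 * k) W' \<longrightarrow>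
        lie_isomorphic (pseudo_H_algebra (r + 8 * k) s V') (pseudo_H_algebra s (r + 8 * k) W')) \<and>
     (\<forall>(V' :: 'c::real_vector clifford_module) (W' :: 'd::real_vector clifford_module).
        minimal_admissible (r + 4 * k) (s + 4 * k) V' \<and>
        minimal_admissible (s + 4 * k) (r + 4 * k) W' \<longrightarrow>
        lie_isomorphic (pseudo_H_algebra (r + 4 * k) (s + 4 * k) V')
                       (pseudo_H_algebra (s + 4 * k) (r + 4 * k) W'))"
proof -
  \<comment> \<open>The three claims are one induction with different increments. It starts at 0,
    the only place where the given isomorphism and r \<noteq> s enter.\<close>
  have "stable_pair (r + p * k) (s + q * k)" if "p = 0 \<and> q = 8 \<or> p = 8 \<and> q = 0 \<or> p = 4 \<and> q = 4" for p q
  proof (induction k)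
    case 0
    then show ?case using stable_pair_base[OF assms(1-4)] by simp
  next
    case (Suc k)
    then show ?case using stable_pair_step[OF Suc that] by (simp add: algebra_simps)
  qed
  from this[of 0 8] this[of 8 0] this[of 4 4]
  have "stable_pair r (s + 8 * k)" "stable_pair (r + 8 * k) s" "stable_pair (r + 4 * k) (s + 4 * k)" by simp_all
  then show ?thesis using stable_pair_isomorphic by blast
qed

end
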